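(* For any $\epsilon>0$ and for almost every $x\in\mathbb{R}/\mathbb{Z}$ we have as $Q\to\infty$ that \[ N(Q,x)=\frac{12\log 2}{\pi^2}\log Q+O_\epsilon\left((\log Q)^{1/2}(\log\log Q)^{3/2+\epsilon}\right). \] Consequently, for almost every $x\in\mathbb{R}/\mathbb{Z}$ the number of intermediate convergents to $x$ with height less than or equal to $Q$ is asymptotic as $Q\to\infty$ to \[ \frac{12}{\pi^2}\log Q(\log\log Q)(1+o(1))+O(M_0(Q,x)), \] where $M_0(Q,x)=\max\{a_1(x),a_2(x),\ldots,a_{N(Q,x)-1}(x),a(Q,x)\}$.
   Context: For $x\in\mathbb{R}/\mathbb{Z}$ write $x=[0;a_1,a_2,\ldots]$ (simple continued fraction, $a_0=0$, partial quotients $a_n=a_n(x)\in\mathbb{N}$), with principal convergents $p_n/q_n=[0;a_1,\ldots,a_n]$ in lowest terms and $p_{-2}=q_{-1}=1$, $p_{-1}=q_{-2}=0$. For each positive integer $Q$, let $N(Q,x)=\min\{n\ge0: Q<q_n+q_{n-1}\}$, and let $a(Q,x)$ be the unique integer with $a(Q,x)q_{N(Q,x)-1}+q_{N(Q,x)-2}\le Q<(a(Q,x)+1)q_{N(Q,x)-1}+q_{N(Q,x)-2}$. For $n\ge1$ the fractions $\frac{mp_{n-1}+p_{n-2}}{mq_{n-1}+q_{n-2}}$ with $1\le m\le a_n-1$ are the intermediate convergents to $x$ (the case $m=a_n$ gives the principal convergent $p_n/q_n$). The height of a reduced fraction $a/q$ is $|q|$. "Almost every" refers to Lebesgue measure on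 $\mathbb{R}/\mathbb{Z}$. *)

theory Defs
  imports "HOL-Analysis.Analysis"
begin

text \<open>
  The circle \<open>\<real>/\<int>\<close> is represented by the fundamental domain \<open>{0..<1}\<close>.
\<close>

definition gauss_map :: "real \<Rightarrow> real" where
  "gauss_map x = frac (1 / x)"

text \<open>
  For rational \<open>x\<close> the expansion terminates and the remaining values are \<open>0\<close>, because
  \<open>1 / 0 = 0\<close>.
\<close>

primrec partial_quotient :: "real \<Rightarrow> nat \<Rightarrow> int" where
  "partial_quotient x 0 = 0"
| "partial_quotient x (Suc n) = \<lfloor>1 / (gauss_map ^^ n) x\<rfloor>"

text \<open>The value \<open>[0; a\<^sub>1, \<dots>, a\<^sub>n]\<close> of a finite continued fraction, given the list of the \<open>a\<^sub>i\<close>.\<close>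

primrec cf_value :: "int list \<Rightarrow> rat" where
  "cf_value [] = 0"
| "cf_value (a # as) = 1 / (of_int a + cf_value as)"

definition principal_convergent :: "real \<Rightarrow> nat \<Rightarrow> rat" where
  "principal_convergent x n = cf_value (map (partial_quotient x) [1..<Suc n])"

text \<open>
  The numbers \<open>p\<^sub>n\<close> and \<open>q\<^sub>n\<close> for \<open>n \<ge> -2\<close>. The initial values are the ones for which the recursion
  \<open>p\<^sub>n = a\<^sub>n p\<^sub>n\<^sub>-\<^sub>1 + p\<^sub>n\<^sub>-\<^sub>2\<close>, \<open>q\<^sub>n = a\<^sub>n q\<^sub>n\<^sub>-\<^sub>1 + q\<^sub>n\<^sub>-\<^sub>2\<close> holds from \<open>n = 0\<close> on, namely
  \<open>p\<^sub>-\<^sub>1 = q\<^sub>-\<^sub>2 = 1\<close> and \<open>p\<^sub>-\<^sub>2 = q\<^sub>-\<^sub>1 = 0\<close>.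
\<close>

definition cf_p :: "real \<Rightarrow> int \<Rightarrow> int" where
  "cf_p x n = (if n = -1 then 1 else if n = -2 then 0
     else fst (quotient_of (principal_convergent x (nat n))))"

definition cf_q :: "real \<Rightarrow> int \<Rightarrow> int" where
  "cf_q x n = (if n = -1 then 0 else if n = -2 then 1
     else snd (quotient_of (principal_convergent x (nat n))))"

definition conv_index :: "nat \<Rightarrow> real \<Rightarrow> nat" where
  "conv_index Q x = (LEAST n. int Q < cf_q x (int n) + cf_q x (int n - 1))"

definition conv_coeff :: "nat \<Rightarrow> real \<Rightarrow> int" where
  "conv_coeff Q x = (let N = int (conv_index Q x) in
     (THE a. a * cf_q x (N - 1) + cf_q x (N - 2) \<le> int Q \<and>
             int Q < (a + 1) * cf_q x (N - 1) + cf_q x (N - 2)))"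

definition max_quotient :: "nat \<Rightarrow> real \<Rightarrow> int" where
  "max_quotient Q x =
     Max (insert (conv_coeff Q x) (partial_quotient x ` {1..<conv_index Q x}))"

definition intermediate_convergents :: "real \<Rightarrow> rat set" where
  "intermediate_convergents x =
     {Fract (m * cf_p x (int n - 1) + cf_p x (int n - 2))
            (m * cf_q x (int n - 1) + cf_q x (int n - 2)) | n m.
        1 \<le> n \<and> 1 \<le> m \<and> m \<le> partial_quotient x n - 1}"

definition height :: "rat \<Rightarrow> int" where
  "height r = \<bar>snd (quotient_of r)\<bar>"

definition num_intermediate :: "nat \<Rightarrow> real \<Rightarrow> nat" where
  "num_intermediate Q x = card {r \<in> intermediate_convergents x. height r \<le> int Q}"

end

theory Submission
  imports Defs "HOL-Probability.Probability_Measure" "HOL-Real_Asymp.Real_Asymp"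
begin

text \<open>
  Put \<open>S\<^sub>n(x) = - \<Sum>\<^sub>k\<^sub><\<^sub>n ln (T\<^sup>k x)\<close> for the Gauss map \<open>T\<close>. Then \<open>S\<^sub>n\<close> is \<open>ln q\<^sub>n\<close> up to \<open>ln 2\<close>, so the first
  claim inverts the law \<open>S\<^sub>n = n \<pi>\<^sup>2 / (12 ln 2) + O(n\<^sup>1\<^sup>/\<^sup>2 (ln n)\<^sup>3\<^sup>/\<^sup>2\<^sup>+\<^sup>\<epsilon>)\<close>. The transfer operator of the Gauss
  measure contracts Lipschitz constants on \<open>(0, 1)\<close> by the factor \<open>7/8\<close>, hence correlations decay
  exponentially, the second moment of a centred sum of \<open>n\<close> consecutive terms is \<open>O(n)\<close>, and the
  Gal-Koksma method (dyadic blocks as in the Rademacher-Menshov inequality) gives the error term.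

  For the second claim, the intermediate convergents of height at most \<open>Q\<close> are counted by
  \<open>\<Sum>\<^sub>n\<^sub><\<^sub>N (a\<^sub>n - 1)\<close> plus at most \<open>a(Q, x)\<close>, and \<open>\<Sum>\<^sub>i\<^sub><\<^sub>n a\<^sub>i\<close> minus its largest term is asymptotic to
  \<open>n ln n / ln 2\<close> (Diamond and Vaaler). Along \<open>n = exp (j\<^sup>9\<^sup>/\<^sup>1\<^sup>0)\<close> truncate at \<open>u = n (ln n)\<^sup>3\<^sup>/\<^sup>4\<close>: the
  variances of the truncated sums and the probabilities of two terms above \<open>u\<close> are both summable
  in \<open>j\<close>, and \<open>u = o(n ln n)\<close>. The trimmed sums increase with \<open>n\<close>, which fills the gaps.
\<close>

section \<open>Continued fractions\<close>

text \<open>The obstacle in the second claim is that a_1 is not integrable for the Gauss measure: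
  the probability of a_1 > u is of order 1/u, so single quotients exceed n ln n infinitely often and
  no strong law holds for the full sums. The error M_0(Q, x) pays for removing the largest term. The
  constant arises as 1 / (\<kappa> ln 2) = 12 / \<pi>^2, from N ~ ln Q / \<kappa> with \<kappa> =
  \<pi>^2 / (12 ln 2) and trimmed sums ~ n ln n / ln 2. Neither - ln x nor the truncated quotients
  and their indicators are Lipschitz on (0, 1) in general. One application of the transfer operator
  makes them so, since on each branch they vary slowly and their dependence on the branch is damped
  by the weights. Hence the mixing statements assume a Lipschitz constant for
  \<open>transfer f\<close>, not for f. Its size matters: ln (u + 1) for quotients truncated at u,
  and 1 / (u + 1) for the indicator of a_1 > u. Variances need correlations only from above, so
  mixing is proved for nonnegative functions and with nonnegative integrals, where sums and
  integrals interchange freely.\<close>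

text \<open>Indices are shifted by one: \<open>cf_P x n\<close> and \<open>cf_Q x n\<close> are \<open>p\<^sub>n\<^sub>-\<^sub>1\<close> and \<open>q\<^sub>n\<^sub>-\<^sub>1\<close>.\<close>

fun cf_P :: "real \<Rightarrow> nat \<Rightarrow> int" where
  "cf_P x 0 = 1"
| "cf_P x (Suc 0) = 0"
| "cf_P x (Suc (Suc n)) = partial_quotient x (Suc n) * cf_P x (Suc n) + cf_P x n"

fun cf_Q :: "real \<Rightarrow> nat \<Rightarrow> int" where
  "cf_Q x 0 = 0"
| "cf_Q x (Suc 0) = 1"
| "cf_Q x (Suc (Suc n)) = partial_quotient x (Suc n) * cf_Q x (Suc n) + cf_Q x n"

declare partial_quotient.simps(2) [simp del]

text \<open>Off the rationals no iterate of the Gauss map reaches 0, so the default values of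
  terminating expansions never enter. The set is forward invariant and has full measure.\<close>

definition irrat01 :: "real set" where
  "irrat01 = {0<..<1} - \<rat>"

lemma gauss_map_irrat01:
  assumes "x \<in> irrat01"
  shows "gauss_map x \<in> irrat01"
proof -
  have x: "x \<notin> \<rat>" "0 < x" "x < 1" using assms by (auto simp: irrat01_def)
  have "1 / x \<notin> \<rat>"
  proof
    assume "1 / x \<in> \<rat>"
    from Rats_divide[OF Rats_1 this] show False using x by simp
  qed
  moreover have "1 / x = gauss_map x + of_int \<lfloor>1 / x\<rfloor>" by (simp add: gauss_map_def frac_def)
  ultimately have nr: "gauss_map x \<notin> \<rat>" by (metis Rats_add Rats_of_int)
  then have "gauss_map x \<noteq> 0" by (metis Rats_0)
  moreover have "0 \<le> gauss_map x" "gauss_map x < 1"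
    by (auto simp: gauss_map_def frac_lt_1)
  ultimately show ?thesis using nr by (auto simp: irrat01_def)
qed

lemma gauss_iter_irrat01: "x \<in> irrat01 \<Longrightarrow> (gauss_map ^^ n) x \<in> irrat01"
  by (induction n) (auto intro: gauss_map_irrat01)

lemma gauss_iter_bounds:
  assumes "x \<in> irrat01"
  shows "0 < (gauss_map ^^ n) x" "(gauss_map ^^ n) x < 1"
  using gauss_iter_irrat01[OF assms, of n] by (auto simp: irrat01_def)

lemma partial_quotient_ge_1:
  assumes "x \<in> irrat01"
  shows "1 \<le> partial_quotient x (Suc n)"
  using gauss_iter_bounds[OF assms, of n] by (simp add: le_floor_iff partial_quotient.simps(2))

lemma partial_quotient_shift:
  "partial_quotient x (Suc (Suc n)) = partial_quotient (gauss_map x) (Suc n)"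
  by (simp add: funpow_swap1 partial_quotient.simps(2))

lemma cf_Q_pos:
  assumes "x \<in> irrat01"
  shows "0 < cf_Q x (Suc n)"
proof (induction n rule: less_induct)
  case (less n)
  show ?case
  proof (cases n)
    case (Suc m)
    have "0 \<le> cf_Q x m" using less[of "m - 1"] Suc by (cases m) auto
    moreover have "0 < partial_quotient x (Suc m) * cf_Q x (Suc m)"
      using less[of m] Suc partial_quotient_ge_1[OF assms, of m] by (intro mult_pos_pos) auto
    ultimately show ?thesis using Suc by simp
  qed simp
qed

lemma cf_Q_nonneg: "x \<in> irrat01 \<Longrightarrow> 0 \<le> cf_Q x n"
  using cf_Q_pos[of x "n - 1"] by (cases n) auto

lemma cf_Q_mono:
  assumes "x \<in> irrat01"
  shows "cf_Q x n \<le> cf_Q x (Suc n)"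
proof (cases n)
  case (Suc m)
  have "1 * cf_Q x (Suc m) \<le> partial_quotient x (Suc m) * cf_Q x (Suc m)"
    using partial_quotient_ge_1[OF assms, of m] cf_Q_pos[OF assms, of m]
    by (intro mult_right_mono) auto
  then show ?thesis using Suc cf_Q_nonneg[OF assms, of m] by simp
qed simp

lemma cf_Q_sum_step:
  assumes "x \<in> irrat01"
  shows "cf_Q x n + cf_Q x (Suc n) \<le> cf_Q x (Suc (Suc n))"
proof -
  have "1 * cf_Q x (Suc n) \<le> partial_quotient x (Suc n) * cf_Q x (Suc n)"
    using partial_quotient_ge_1[OF assms, of n] cf_Q_pos[OF assms, of n]
    by (intro mult_right_mono) auto
  then show ?thesis by simp
qed

lemma cf_Q_mono_le: "x \<in> irrat01 \<Longrightarrow> m \<le> n \<Longrightarrow> cf_Q x m \<le> cf_Q x n"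
  by (rule lift_Suc_mono_le[of "cf_Q x"]) (auto intro: cf_Q_mono)

text \<open>Crude linear growth, whose purpose is to show that some index satisfies the condition
  under \<open>LEAST\<close> in \<open>conv_index\<close>.\<close>

lemma cf_Q_ge_index:
  assumes "x \<in> irrat01"
  shows "int n \<le> cf_Q x (Suc (Suc n))"
proof (induction n)
  case 0 then show ?case using cf_Q_nonneg[OF assms, of "Suc (Suc 0)"] by (simp del: cf_Q.simps)
next
  case (Suc n)
  then show ?case using cf_Q_sum_step[OF assms, of "Suc n"] cf_Q_pos[OF assms, of n] by linarith
qed

lemma cf_det: "cf_P x (Suc n) * cf_Q x n - cf_P x n * cf_Q x (Suc n) = (-1) ^ Suc n"
  by (induction n) (auto simp: algebra_simps)

text \<open>The recursions append quotients on the right, while \<open>cf_value\<close> and the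
  Gauss map remove them on the left; this and the next identity translate between the two.\<close>

lemma cf_P_shift: "cf_P x (Suc n) = cf_Q (gauss_map x) n"
  by (induction "gauss_map x" n rule: cf_Q.induct)
    (auto simp: partial_quotient_shift)

lemma cf_Q_shift:
  "cf_Q x (Suc n) = partial_quotient x 1 * cf_Q (gauss_map x) n + cf_P (gauss_map x) n"
  by (induction "gauss_map x" n rule: cf_Q.induct)
    (auto simp: partial_quotient_shift algebra_simps)

lemma principal_convergent_Suc:
  "principal_convergent x (Suc n) =
     1 / (of_int (partial_quotient x 1) + principal_convergent (gauss_map x) n)"
proof -
  have "map (partial_quotient x) [1..<Suc (Suc n)] =
      partial_quotient x 1 # map (partial_quotient x) (map Suc [1..<Suc n])"
    by (simp only: map_Suc_upt) (simp add: upt_conv_Cons del: upt_Suc)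
  also have "map (partial_quotient x) (map Suc [1..<Suc n]) =
      map (partial_quotient (gauss_map x)) [1..<Suc n]"
    unfolding map_map
  proof (rule map_cong[OF refl])
    fix i assume "i \<in> set [1..<Suc n]"
    then have "1 \<le> i" by (simp only: set_upt atLeastLessThan_iff)
    then obtain j where "i = Suc j" by (cases i) auto
    then show "(partial_quotient x \<circ> Suc) i = partial_quotient (gauss_map x) i"
      by (simp add: partial_quotient_shift)
  qed
  finally show ?thesis by (simp add: principal_convergent_def del: upt_Suc)
qed

lemma principal_convergent_eq:
  "x \<in> irrat01 \<Longrightarrow> principal_convergent x n = of_int (cf_P x (Suc n)) / of_int (cf_Q x (Suc n))"
proof (induction n arbitrary: x)
  case 0
  then show ?case by (simp add: principal_convergent_def)
next
  case (Suc n)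
  have g: "gauss_map x \<in> irrat01" using Suc.prems by (rule gauss_map_irrat01)
  have pos: "0 < cf_Q (gauss_map x) (Suc n)" by (rule cf_Q_pos[OF g])
  show ?case
    unfolding principal_convergent_Suc Suc.IH[OF g] cf_P_shift[of x] cf_Q_shift[of x]
    using pos by (simp add: field_simps)
qed

lemma cf_coprime: "coprime (cf_P x n) (cf_Q x n)"
proof (rule coprimeI)
  fix d assume d: "d dvd cf_P x n" "d dvd cf_Q x n"
  then have "d dvd cf_P x (Suc n) * cf_Q x n - cf_P x n * cf_Q x (Suc n)" by (intro dvd_diff) auto
  then have "d dvd (-1) ^ Suc n" unfolding cf_det .
  moreover have "(-1) ^ Suc n dvd (1 :: int)" by (cases "even n") auto
  ultimately show "is_unit d" by (rule dvd_trans)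
qed

lemma quotient_of_principal_convergent:
  assumes "x \<in> irrat01"
  shows "quotient_of (principal_convergent x n) = (cf_P x (Suc n), cf_Q x (Suc n))"
  using cf_coprime[of x "Suc n"] cf_Q_pos[OF assms, of n] principal_convergent_eq[OF assms, of n]
  by (simp add: quotient_of_Fract Fract_of_int_quotient[symmetric] normalize_stable)

lemma cf_q_eq:
  assumes "x \<in> irrat01"
  shows "cf_q x (int n) = cf_Q x (Suc n)" "cf_q x (int n - 1) = cf_Q x n"
proof -
  show "cf_q x (int n) = cf_Q x (Suc n)" for n
    using quotient_of_principal_convergent[OF assms] by (simp add: cf_q_def)
  from this[of "n - 1"] show "cf_q x (int n - 1) = cf_Q x n"
    by (cases n) (auto simp: cf_q_def)
qed

lemma cf_p_eq:
  assumes "x \<in> irrat01"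
  shows "cf_p x (int n) = cf_P x (Suc n)" "cf_p x (int n - 1) = cf_P x n"
proof -
  show "cf_p x (int n) = cf_P x (Suc n)" for n
    using quotient_of_principal_convergent[OF assms] by (simp add: cf_p_def)
  from this[of "n - 1"] show "cf_p x (int n - 1) = cf_P x n"
    by (cases n) (auto simp: cf_p_def)
qed

section \<open>The index N(Q, x) and the coefficient a(Q, x)\<close>

lemma conv_index_eq:
  assumes "x \<in> irrat01"
  shows "conv_index Q x = (LEAST n. int Q < cf_Q x (Suc n) + cf_Q x n)"
  by (simp add: conv_index_def cf_q_eq[OF assms])

lemma conv_index_upper:
  assumes "x \<in> irrat01"
  shows "int Q < cf_Q x (Suc (conv_index Q x)) + cf_Q x (conv_index Q x)"
proof -
  have "int Q < cf_Q x (Suc (Suc (Suc Q))) + cf_Q x (Suc (Suc Q))"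
    using cf_Q_ge_index[OF assms, of Q] cf_Q_pos[OF assms, of "Suc (Suc Q)"] by linarith
  then show ?thesis unfolding conv_index_eq[OF assms] by (rule LeastI)
qed

lemma conv_index_lower:
  assumes "x \<in> irrat01" "n < conv_index Q x"
  shows "cf_Q x (Suc n) + cf_Q x n \<le> int Q"
  using assms(2) not_less_Least unfolding conv_index_eq[OF assms(1)] by (metis linorder_not_less)

lemma conv_index_pos:
  assumes "x \<in> irrat01" "1 \<le> Q"
  shows "0 < conv_index Q x"
proof (rule ccontr)
  assume "\<not> 0 < conv_index Q x"
  then have "conv_index Q x = 0" by simp
  then show False using conv_index_upper[OF assms(1), of Q] assms(2) by simp
qed

text \<open>With N = n + 1 the two defining inequalities are those of Euclidean division of Q -
  q_{N-2} by q_{N-1}. For N = 0 the divisor would be q_{-1} = 0, hence the form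
  \<open>Suc n\<close>.\<close>

lemma conv_coeff_eq:
  assumes "x \<in> irrat01" "conv_index Q x = Suc n"
  shows "conv_coeff Q x = (int Q - cf_Q x n) div cf_Q x (Suc n)"
proof -
  have pos: "0 < cf_Q x (Suc n)" by (rule cf_Q_pos[OF assms(1)])
  have e: "int (conv_index Q x) - 1 = int n" "int (conv_index Q x) - 2 = int n - 1"
    using assms(2) by auto
  show ?thesis
    unfolding conv_coeff_def Let_def e cf_q_eq[OF assms(1)]
  proof (rule the_equality)
    let ?a = "(int Q - cf_Q x n) div cf_Q x (Suc n)"
    have m: "int Q - cf_Q x n = ?a * cf_Q x (Suc n) + (int Q - cf_Q x n) mod cf_Q x (Suc n)"
      by (rule div_mult_mod_eq[symmetric])
    have "0 \<le> (int Q - cf_Q x n) mod cf_Q x (Suc n)"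
      "(int Q - cf_Q x n) mod cf_Q x (Suc n) < cf_Q x (Suc n)" using pos by auto
    then show "?a * cf_Q x (Suc n) + cf_Q x n \<le> int Q \<and>
        int Q < (?a + 1) * cf_Q x (Suc n) + cf_Q x n"
      using m by (simp add: distrib_right)
  next
    fix a assume a: "a * cf_Q x (Suc n) + cf_Q x n \<le> int Q \<and>
        int Q < (a + 1) * cf_Q x (Suc n) + cf_Q x n"
    have "int Q - cf_Q x n = cf_Q x (Suc n) * a + (int Q - cf_Q x n - a * cf_Q x (Suc n))" by simp
    then show "a = (int Q - cf_Q x n) div cf_Q x (Suc n)"
      by (rule int_div_pos_eq[symmetric]) (use a in \<open>auto simp: algebra_simps\<close>)
  qed
qed

lemma conv_coeff_iff:
  assumes "x \<in> irrat01" "conv_index Q x = Suc n"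
  shows "m \<le> conv_coeff Q x \<longleftrightarrow> m * cf_Q x (Suc n) + cf_Q x n \<le> int Q"
proof -
  define q c where "q = cf_Q x (Suc n)" and "c = conv_coeff Q x"
  have q: "0 < q" unfolding q_def by (rule cf_Q_pos[OF assms(1)])
  have "int Q - cf_Q x n = c * q + (int Q - cf_Q x n) mod q"
    unfolding c_def conv_coeff_eq[OF assms] q_def by (rule div_mult_mod_eq[symmetric])
  moreover have "0 \<le> (int Q - cf_Q x n) mod q" "(int Q - cf_Q x n) mod q < q" using q by auto
  moreover have "m * q \<le> c * q" if "m \<le> c" using that q by simp
  moreover have "(c + 1) * q \<le> m * q" if "\<not> m \<le> c" using that q by (intro mult_right_mono) auto
  moreover have "(c + 1) * q = c * q + q" by (simp add: distrib_right)
  ultimately have "m \<le> c \<longleftrightarrow> m * q + cf_Q x n \<le> int Q" by linarith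
  then show ?thesis by (simp add: q_def c_def del: cf_Q.simps)
qed

text \<open>With y = T^n x one has 1/y = a_{n+1} + T y, so y (q_{n+1} + T y q_n) = q_n + y q_{n-1}
  and the product telescopes. The sum of - ln along an orbit thereby becomes an exact function of
  the denominators.\<close>

lemma gauss_iter_prod:
  assumes "x \<in> irrat01"
  shows "(\<Prod>k<n. (gauss_map ^^ k) x) *
    (of_int (cf_Q x (Suc n)) + (gauss_map ^^ n) x * of_int (cf_Q x n)) = 1"
proof (induction n)
  case (Suc n)
  define y where "y = (gauss_map ^^ n) x"
  have y: "y > 0" using gauss_iter_bounds[OF assms] by (simp add: y_def)
  have "of_int (partial_quotient x (Suc n)) + gauss_map y = 1 / y"
    by (simp add: y_def gauss_map_def frac_def partial_quotient.simps(2))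
  then have 1: "y * gauss_map y + y * of_int (partial_quotient x (Suc n)) = 1"
    using y by (simp add: field_simps)
  have "y * (of_int (cf_Q x (Suc (Suc n))) + gauss_map y * of_int (cf_Q x (Suc n))) =
      (y * gauss_map y + y * of_int (partial_quotient x (Suc n))) * of_int (cf_Q x (Suc n)) +
      y * of_int (cf_Q x n)"
    by (simp add: algebra_simps)
  also have "\<dots> = of_int (cf_Q x (Suc n)) + y * of_int (cf_Q x n)"
    unfolding 1 by simp
  finally have 2: "y * (of_int (cf_Q x (Suc (Suc n))) + gauss_map y * of_int (cf_Q x (Suc n))) =
      of_int (cf_Q x (Suc n)) + y * of_int (cf_Q x n)" .
  have "(\<Prod>k<Suc n. (gauss_map ^^ k) x) *
      (of_int (cf_Q x (Suc (Suc n))) + (gauss_map ^^ Suc n) x * of_int (cf_Q x (Suc n))) =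
    (\<Prod>k<n. (gauss_map ^^ k) x) *
      (y * (of_int (cf_Q x (Suc (Suc n))) + gauss_map y * of_int (cf_Q x (Suc n))))"
    by (simp only: y_def prod.lessThan_Suc funpow.simps o_def mult.assoc)
  then show ?case unfolding 2 using Suc by (simp only: y_def)
qed simp

lemma log_sum_eq:
  assumes "x \<in> irrat01"
  shows "(\<Sum>k<n. - ln ((gauss_map ^^ k) x)) =
    ln (of_int (cf_Q x (Suc n)) + (gauss_map ^^ n) x * of_int (cf_Q x n))"
proof -
  let ?p = "\<Prod>k<n. (gauss_map ^^ k) x"
  have p: "?p > 0" using gauss_iter_bounds[OF assms] by (intro prod_pos) auto
  have "of_int (cf_Q x (Suc n)) + (gauss_map ^^ n) x * of_int (cf_Q x n) = 1 / ?p"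
    using gauss_iter_prod[OF assms, of n] p
    by (metis nonzero_mult_div_cancel_left less_irrefl)
  moreover have "ln ?p = (\<Sum>k<n. ln ((gauss_map ^^ k) x))"
    using gauss_iter_bounds(1)[OF assms] by (intro ln_prod) (auto, metis less_irrefl)
  moreover have "ln (1 / ?p) = - ln ?p" using ln_inverse[of ?p] p by (simp only: inverse_eq_divide)
  ultimately show ?thesis by (simp only: sum_negf)
qed

text \<open>Both bounds come from 0 < T^n x < 1. The upper end is the very threshold that defines
  N(Q, x), so S_{N-1} <= ln Q will hold without loss.\<close>

lemma log_sum_bounds:
  assumes "x \<in> irrat01"
  shows "ln (of_int (cf_Q x (Suc n))) \<le> (\<Sum>k<n. - ln ((gauss_map ^^ k) x))"
    and "(\<Sum>k<n. - ln ((gauss_map ^^ k) x)) \<le> ln (of_int (cf_Q x (Suc n) + cf_Q x n))"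
proof -
  have q: "0 < real_of_int (cf_Q x (Suc n))" "0 \<le> real_of_int (cf_Q x n)"
    using cf_Q_pos[OF assms, of n] cf_Q_nonneg[OF assms, of n] by auto
  have y: "0 < (gauss_map ^^ n) x" "(gauss_map ^^ n) x < 1"
    using gauss_iter_bounds[OF assms] by auto
  have b: "0 \<le> (gauss_map ^^ n) x * real_of_int (cf_Q x n)"
    "(gauss_map ^^ n) x * real_of_int (cf_Q x n) \<le> real_of_int (cf_Q x n)"
    using q y by (auto intro: mult_left_le_one_le)
  show "ln (of_int (cf_Q x (Suc n))) \<le> (\<Sum>k<n. - ln ((gauss_map ^^ k) x))"
    "(\<Sum>k<n. - ln ((gauss_map ^^ k) x)) \<le> ln (of_int (cf_Q x (Suc n) + cf_Q x n))"
    unfolding log_sum_eq[OF assms] using q b by (simp_all del: cf_Q.simps)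
qed

text \<open>Minimality of N gives q_{N-1} + q_{N-2} <= Q < q_N + q_{N-1} <= 2 q_N; the factor 2 is
  the source of ln 2.\<close>

lemma log_sum_conv_index:
  assumes "x \<in> irrat01" "1 \<le> Q"
  shows "(\<Sum>k<conv_index Q x - 1. - ln ((gauss_map ^^ k) x)) \<le> ln (real Q)"
    and "ln (real Q) \<le> (\<Sum>k<conv_index Q x. - ln ((gauss_map ^^ k) x)) + ln 2"
proof -
  obtain n where n: "conv_index Q x = Suc n"
    using conv_index_pos[OF assms] by (cases "conv_index Q x") auto
  have q: "0 < real_of_int (cf_Q x (Suc n))" "0 < real_of_int (cf_Q x (Suc (Suc n)))" "0 \<le> real_of_int (cf_Q x n)"
    using cf_Q_pos[OF assms(1)] cf_Q_nonneg[OF assms(1), of n] by (auto simp del: cf_Q.simps)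
  have "real_of_int (cf_Q x (Suc n) + cf_Q x n) \<le> real Q"
    using conv_index_lower[OF assms(1), of n Q] n by linarith
  then have "ln (real_of_int (cf_Q x (Suc n) + cf_Q x n)) \<le> ln (real Q)"
    using q by (simp del: cf_Q.simps)
  with log_sum_bounds(2)[OF assms(1), of n]
  show "(\<Sum>k<conv_index Q x - 1. - ln ((gauss_map ^^ k) x)) \<le> ln (real Q)" by (simp add: n del: cf_Q.simps)
  have "real Q \<le> 2 * real_of_int (cf_Q x (Suc (Suc n)))"
    using conv_index_upper[OF assms(1), of Q] cf_Q_mono[OF assms(1), of "Suc n"] unfolding n by linarith
  then have "ln (real Q) \<le> ln (2 * real_of_int (cf_Q x (Suc (Suc n))))"
    using assms(2) by simp
  also have "\<dots> = ln 2 + ln (real_of_int (cf_Q x (Suc (Suc n))))"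
    using q by (simp add: ln_mult del: cf_Q.simps)
  finally show "ln (real Q) \<le> (\<Sum>k<conv_index Q x. - ln ((gauss_map ^^ k) x)) + ln 2"
    using log_sum_bounds(1)[OF assms(1), of "Suc n"] by (simp add: n del: cf_Q.simps sum.lessThan_Suc)
qed

text \<open>The intermediate fraction with parameters \<open>(n, m)\<close> is \<open>inter_frac x (n - 1) m\<close>.\<close>

definition inter_height :: "real \<Rightarrow> nat \<Rightarrow> int \<Rightarrow> int" where
  "inter_height x i m = m * cf_Q x (Suc i) + cf_Q x i"

definition inter_frac :: "real \<Rightarrow> nat \<Rightarrow> int \<Rightarrow> rat" where
  "inter_frac x i m = Fract (m * cf_P x (Suc i) + cf_P x i) (inter_height x i m)"

lemma inter_height_ge:
  assumes "x \<in> irrat01" "1 \<le> m"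
  shows "cf_Q x (Suc i) + cf_Q x i \<le> inter_height x i m"
proof -
  have "1 * cf_Q x (Suc i) \<le> m * cf_Q x (Suc i)"
    using assms cf_Q_pos[OF assms(1), of i] by (intro mult_right_mono) auto
  then show ?thesis by (simp add: inter_height_def)
qed

lemma inter_height_pos: "x \<in> irrat01 \<Longrightarrow> 1 \<le> m \<Longrightarrow> 0 < inter_height x i m"
  using inter_height_ge[of x m i] cf_Q_pos[of x i] cf_Q_nonneg[of x i] by linarith

lemma inter_height_le:
  assumes "x \<in> irrat01" "m \<le> partial_quotient x (Suc i) - 1"
  shows "inter_height x i m < cf_Q x (Suc (Suc i))"
proof -
  have "m * cf_Q x (Suc i) \<le> (partial_quotient x (Suc i) - 1) * cf_Q x (Suc i)"
    using assms(2) cf_Q_pos[OF assms(1), of i] by (intro mult_right_mono) auto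
  also have "\<dots> = cf_Q x (Suc (Suc i)) - cf_Q x (Suc i) - cf_Q x i" by (simp add: algebra_simps)
  finally show ?thesis using cf_Q_pos[OF assms(1), of i] unfolding inter_height_def by linarith
qed

text \<open>The parameter m cancels from the determinant against p_i / q_i, so a common divisor
  divides p_i q_{i-1} - p_{i-1} q_i, which is 1 or -1; the fraction is already reduced.\<close>

lemma height_inter_frac:
  assumes "x \<in> irrat01" "1 \<le> m"
  shows "height (inter_frac x i m) = inter_height x i m"
proof -
  have "coprime (m * cf_P x (Suc i) + cf_P x i) (inter_height x i m)"
  proof (rule coprimeI)
    fix d assume d: "d dvd m * cf_P x (Suc i) + cf_P x i" "d dvd inter_height x i m"
    have "d dvd cf_P x (Suc i) * inter_height x i m
        - (m * cf_P x (Suc i) + cf_P x i) * cf_Q x (Suc i)"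
      using d by (intro dvd_diff) auto
    also have "\<dots> = cf_P x (Suc i) * cf_Q x i - cf_P x i * cf_Q x (Suc i)"
      by (simp add: inter_height_def algebra_simps)
    also have "\<dots> = (-1) ^ Suc i" by (rule cf_det)
    finally have "d dvd (-1) ^ Suc i" .
    moreover have "(-1) ^ Suc i dvd (1 :: int)" by (cases "even i") auto
    ultimately show "is_unit d" by (rule dvd_trans)
  qed
  then show ?thesis using inter_height_pos[OF assms, of i]
    by (simp add: height_def inter_frac_def quotient_of_Fract)
qed

text \<open>Heights with first index i lie in [q_i + q_{i-1}, q_{i+1}), and these ranges are
  disjoint and increasing in i; so the height alone determines i and then m.\<close>

lemma inter_frac_inj:
  assumes "x \<in> irrat01"
  shows "inj_on (\<lambda>(i, m). inter_frac x i m) {(i, m). 1 \<le> m \<and> m \<le> partial_quotient x (Suc i) - 1}"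
proof -
  have lt: "inter_height x i m < inter_height x j m'"
    if "i < j" "m \<le> partial_quotient x (Suc i) - 1" "1 \<le> m'" for i j m m'
  proof -
    have "cf_Q x (Suc (Suc i)) \<le> cf_Q x (Suc j)" using that by (intro cf_Q_mono_le assms) auto
    then show ?thesis
      using inter_height_le[OF assms that(2)] inter_height_ge[OF assms that(3), of j]
        cf_Q_nonneg[OF assms, of j] by linarith
  qed
  show ?thesis
  proof (rule inj_onI, clarify)
    fix i m j m'
    assume m: "1 \<le> m" "m \<le> partial_quotient x (Suc i) - 1"
      "1 \<le> m'" "m' \<le> partial_quotient x (Suc j) - 1"
      and eq: "inter_frac x i m = inter_frac x j m'"
    then have h: "inter_height x i m = inter_height x j m'"
      using height_inter_frac[OF assms m(1), of i] height_inter_frac[OF assms m(3), of j] by simp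
    have "\<not> i < j" using lt[of i j m m'] m h by auto
    moreover have "\<not> j < i" using lt[of j i m' m] m h by auto
    ultimately have "i = j" by simp
    moreover from this h have "m = m'"
      using cf_Q_pos[OF assms, of i] by (simp add: inter_height_def)
    ultimately show "i = j \<and> m = m'" by simp
  qed
qed

lemma intermediate_convergents_eq:
  assumes "x \<in> irrat01"
  shows "intermediate_convergents x =
    (\<lambda>(i, m). inter_frac x i m) ` {(i, m). 1 \<le> m \<and> m \<le> partial_quotient x (Suc i) - 1}"
proof -
  have e: "Fract (m * cf_p x (int (Suc i) - 1) + cf_p x (int (Suc i) - 2))
            (m * cf_q x (int (Suc i) - 1) + cf_q x (int (Suc i) - 2)) = inter_frac x i m" for i m
  proof -
    have "int (Suc i) - 1 = int i" "int (Suc i) - 2 = int i - 1" by auto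
    then show ?thesis
      by (simp only: cf_p_eq[OF assms] cf_q_eq[OF assms] inter_frac_def inter_height_def)
  qed
  show ?thesis
  proof (intro set_eqI iffI)
    fix r assume "r \<in> intermediate_convergents x"
    then obtain n m where r: "1 \<le> n" "1 \<le> m" "m \<le> partial_quotient x n - 1"
      "r = Fract (m * cf_p x (int n - 1) + cf_p x (int n - 2))
            (m * cf_q x (int n - 1) + cf_q x (int n - 2))"
      unfolding intermediate_convergents_def by blast
    then obtain i where "n = Suc i" by (cases n) auto
    with r e have "r = inter_frac x i m" by simp
    with r \<open>n = Suc i\<close> show "r \<in> (\<lambda>(i, m). inter_frac x i m) `
        {(i, m). 1 \<le> m \<and> m \<le> partial_quotient x (Suc i) - 1}"
      by (intro image_eqI[of _ _ "(i, m)"]) auto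
  next
    fix r assume "r \<in> (\<lambda>(i, m). inter_frac x i m) `
        {(i, m). 1 \<le> m \<and> m \<le> partial_quotient x (Suc i) - 1}"
    then obtain i m where "1 \<le> m" "m \<le> partial_quotient x (Suc i) - 1" "r = inter_frac x i m" by auto
    then have "r = Fract (m * cf_p x (int (Suc i) - 1) + cf_p x (int (Suc i) - 2))
            (m * cf_q x (int (Suc i) - 1) + cf_q x (int (Suc i) - 2)) \<and>
        1 \<le> Suc i \<and> 1 \<le> m \<and> m \<le> partial_quotient x (Suc i) - 1" using e by simp
    then show "r \<in> intermediate_convergents x"
      unfolding intermediate_convergents_def by blast
  qed
qed

text \<open>Write N = n + 1. Blocks i < n lie below q_n <= Q and count fully; blocks i > n start at
  or above q_N + q_{N-1} > Q. In block n the condition height <= Q reads m <= a(Q, x), and b is the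
  minimum of a(Q, x) and a_N - 1, because m = a_N gives a principal convergent.\<close>

lemma num_intermediate_eq:
  assumes "x \<in> irrat01" "1 \<le> Q"
  obtains b where "0 \<le> b" "b \<le> conv_coeff Q x"
    "int (num_intermediate Q x) = (\<Sum>i<conv_index Q x - 1. partial_quotient x (Suc i) - 1) + b"
proof -
  obtain n where n: "conv_index Q x = Suc n"
    using conv_index_pos[OF assms] by (cases "conv_index Q x") auto
  define b where "b = min (partial_quotient x (Suc n) - 1) (conv_coeff Q x)"
  define B where "B i = (if i < n then partial_quotient x (Suc i) - 1 else b)" for i
  have c: "1 \<le> conv_coeff Q x"
    unfolding conv_coeff_iff[OF assms(1) n] using conv_index_lower[OF assms(1), of n Q] n by simp
  have b0: "0 \<le> b" using c partial_quotient_ge_1[OF assms(1), of n] by (simp add: b_def)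
  have B0: "0 \<le> B i" for i using b0 partial_quotient_ge_1[OF assms(1), of i] by (simp add: B_def)
  have key: "m \<le> partial_quotient x (Suc i) - 1 \<and> inter_height x i m \<le> int Q \<longleftrightarrow> i \<le> n \<and> m \<le> B i"
    if "1 \<le> m" for i m
  proof (cases i n rule: linorder_cases)
    case less
    have "inter_height x i m \<le> int Q" if "m \<le> partial_quotient x (Suc i) - 1"
    proof -
      have "cf_Q x (Suc (Suc i)) \<le> cf_Q x (Suc n)" using less by (intro cf_Q_mono_le assms) auto
      then show ?thesis
        using inter_height_le[OF assms(1) that] conv_index_lower[OF assms(1), of n Q]
          cf_Q_nonneg[OF assms(1), of n] n by linarith
    qed
    then show ?thesis using less by (auto simp: B_def)
  next
    case equal
    then show ?thesis using conv_coeff_iff[OF assms(1) n, of m]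
      by (auto simp: B_def b_def inter_height_def)
  next
    case greater
    have "cf_Q x (Suc (Suc n)) \<le> cf_Q x (Suc i)" "cf_Q x (Suc n) \<le> cf_Q x i"
      using greater by (intro cf_Q_mono_le assms; simp)+
    then show ?thesis using greater inter_height_ge[OF assms(1) that, of i]
      conv_index_upper[OF assms(1), of Q] unfolding n by linarith
  qed
  let ?A = "{(i, m). 1 \<le> m \<and> m \<le> partial_quotient x (Suc i) - 1 \<and> inter_height x i m \<le> int Q}"
  have A: "?A = (SIGMA i:{..n}. {1..B i})"
  proof (intro set_eqI)
    fix p :: "nat \<times> int"
    show "p \<in> ?A \<longleftrightarrow> p \<in> (SIGMA i:{..n}. {1..B i})"
      using key[of "snd p" "fst p"] by (cases p) auto
  qed
  have "{r \<in> intermediate_convergents x. height r \<le> int Q} = (\<lambda>(i, m). inter_frac x i m) ` ?A"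
    unfolding intermediate_convergents_eq[OF assms(1)]
    using height_inter_frac[OF assms(1)] by auto
  moreover have "inj_on (\<lambda>(i, m). inter_frac x i m) ?A"
    by (rule inj_on_subset[OF inter_frac_inj[OF assms(1)]]) auto
  ultimately have "num_intermediate Q x = card (SIGMA i:{..n}. {1..B i})"
    unfolding num_intermediate_def A[symmetric] by (simp only: card_image)
  also have "\<dots> = (\<Sum>i\<le>n. card {1..B i})" by (subst card_SigmaI) auto
  finally have "int (num_intermediate Q x) = (\<Sum>i\<le>n. B i)" using B0 by simp
  also have "\<dots> = (\<Sum>i<n. B i) + B n" by (simp add: lessThan_Suc_atMost[symmetric])
  also have "(\<Sum>i<n. B i) = (\<Sum>i<n. partial_quotient x (Suc i) - 1)"
    by (intro sum.cong) (auto simp: B_def)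
  also have "B n = b" by (simp add: B_def)
  finally have "int (num_intermediate Q x) = (\<Sum>i<n. partial_quotient x (Suc i) - 1) + b" .
  moreover have "b \<le> conv_coeff Q x" by (simp add: b_def)
  ultimately show ?thesis using that[of b] b0 n by simp
qed

section \<open>The Gauss measure and its transfer operator\<close>

text \<open>A measure on the whole line with the density cut off outside (0, 1): measurability is
  then plain Borel measurability, and membership in (0, 1) is recovered almost everywhere.\<close>

definition gauss_measure :: "real measure" where
  "gauss_measure = density lborel
     (\<lambda>x. ennreal (1 / (ln 2 * (1 + x))) * indicator {0<..<1} x)"

text \<open>The inverse branch of the Gauss map on which the first quotient is k + 1.\<close>

definition branch :: "nat \<Rightarrow> real \<Rightarrow> real" where
  "branch k y = 1 / (real k + 1 + y)"

text \<open>The Jacobian 1 / (k + 1 + y)^2 of the branch times the ratio of the Gauss densities at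
  \<open>branch k y\<close> and y: the conditional probability of first quotient k + 1 given T x =
  y.\<close>

definition branch_weight :: "nat \<Rightarrow> real \<Rightarrow> real" where
  "branch_weight k y = (1 + y) / ((real k + 1 + y) * (real k + 2 + y))"

lemma sets_gauss_measure [simp, measurable_cong]: "sets gauss_measure = sets borel"
  by (simp add: gauss_measure_def)

lemma space_gauss_measure [simp]: "space gauss_measure = UNIV"
  by (simp add: gauss_measure_def)

lemma gauss_map_measurable [measurable]: "gauss_map \<in> borel_measurable borel"
  unfolding gauss_map_def frac_def by measurable

lemma branch_measurable [measurable]: "branch k \<in> borel_measurable borel"
  unfolding branch_def by measurable

lemma branch_weight_measurable [measurable]: "branch_weight k \<in> borel_measurable borel"
  unfolding branch_weight_def by measurable

lemma nn_integral_gauss: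
  assumes [measurable]: "f \<in> borel_measurable borel"
  shows "(\<integral>\<^sup>+x. f x \<partial>gauss_measure) =
    (\<integral>\<^sup>+x. ennreal (1 / (ln 2 * (1 + x))) * f x * indicator {0<..<1} x \<partial>lborel)"
  unfolding gauss_measure_def
  by (subst nn_integral_density) (auto intro!: nn_integral_cong simp: mult_ac)

lemma AE_gauss_iff:
  "(AE x in gauss_measure. P x) \<longleftrightarrow> (AE x in lborel. x \<in> {0<..<1} \<longrightarrow> P x)"
  unfolding gauss_measure_def
  by (subst AE_density) (auto intro!: AE_cong simp: indicator_def)

lemma emeasure_gauss_atMost:
  assumes "0 \<le> b" "b \<le> 1"
  shows "emeasure gauss_measure {..b} = ennreal (log 2 (1 + b))"
proof -
  have "emeasure gauss_measure {..b} = (\<integral>\<^sup>+x. indicator {..b} x \<partial>gauss_measure)" by simp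
  also have "\<dots> = (\<integral>\<^sup>+x. ennreal (1 / (ln 2 * (1 + x))) * indicator {..b} x * indicator {0<..<1} x \<partial>lborel)"
    by (rule nn_integral_gauss) measurable
  also have "\<dots> = (\<integral>\<^sup>+x. ennreal (1 / (ln 2 * (1 + x))) * indicator {0..b} x \<partial>lborel)"
    using AE_lborel_singleton[of 0] AE_lborel_singleton[of 1]
    by (intro nn_integral_cong_AE, eventually_elim) (use assms in \<open>auto simp: indicator_def\<close>)
  also have "\<dots> = ennreal (1 / ln 2 * ln (1 + b) - 1 / ln 2 * ln (1 + 0))"
    using assms by (intro nn_integral_FTC_Icc) (auto intro!: derivative_eq_intros)
  finally show ?thesis by (simp add: log_def)
qed

lemma prob_space_gauss_measure: "prob_space gauss_measure"
proof
  have "emeasure gauss_measure {1<..} = 0"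
    using AE_iff_measurable[of "{1<..}" gauss_measure "\<lambda>x. x \<le> 1"]
    by (auto simp: AE_gauss_iff not_le)
  moreover have "emeasure gauss_measure ({..1} \<union> {1<..}) =
      emeasure gauss_measure {..1} + emeasure gauss_measure {1<..}"
    by (subst plus_emeasure) auto
  moreover have "{..1} \<union> {1<..} = (UNIV :: real set)" by auto
  ultimately show "emeasure gauss_measure (space gauss_measure) = 1"
    using emeasure_gauss_atMost[of 1] by (simp add: log_def)
qed

interpretation gauss: prob_space gauss_measure by (rule prob_space_gauss_measure)

lemma AE_gauss_unit: "AE x in gauss_measure. 0 < x \<and> x < 1"
  by (auto simp: AE_gauss_iff)

text \<open>The Gauss density is positive on (0, 1), so its null sets there are Lebesgue null; the
  endpoint 0 is a single point.\<close>

lemma AE_gauss_imp_lebesgue: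
  assumes "AE x in gauss_measure. P x"
  shows "AE x in lebesgue_on {0..<1}. P x"
proof -
  have "AE x in lborel. x \<in> {0<..<1} \<longrightarrow> P x" using assms by (simp add: AE_gauss_iff)
  then have "AE x in lborel. x \<in> {0..<1} \<longrightarrow> P x"
    using AE_lborel_singleton[of 0] by eventually_elim auto
  then have "AE x in lebesgue. x \<in> {0..<1} \<longrightarrow> P x" by (rule AE_completion)
  then show ?thesis by (subst AE_restrict_space_iff) auto
qed

lemma AE_gauss_irrat01: "AE x in gauss_measure. x \<in> irrat01"
proof -
  have "\<rat> \<in> null_sets (lborel :: real measure)"
    by (intro countable_imp_null_set_lborel countable_rat)
  then have "AE x in lborel. (x::real) \<notin> \<rat>" by (rule AE_not_in)
  then show ?thesis unfolding AE_gauss_iff by eventually_elim (auto simp: irrat01_def)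
qed

lemma nn_integral_branch:
  fixes h :: "real \<Rightarrow> ennreal"
  assumes [measurable]: "h \<in> borel_measurable borel"
  shows "(\<integral>\<^sup>+x. h x * indicator {1 / (real k + 2)..1 / (real k + 1)} x \<partial>lborel) =
    (\<integral>\<^sup>+y. h (branch k y) * ennreal (1 / (real k + 1 + y)^2) * indicator {0..1} y \<partial>lborel)"
proof -
  \<comment> \<open>The substitution rule asks for an increasing map and \<open>branch k\<close>
    decreases; so t = 1 - y is used as variable and the reflection is undone afterwards.\<close>
  let ?g = "\<lambda>t. 1 / (real k + 2 - t)" and ?g' = "\<lambda>t. 1 / (real k + 2 - t)^2"
  have ne: "real k + 2 - t \<noteq> 0" if "t \<in> {0..1}" for t using that by auto
  have "(\<integral>\<^sup>+x. h x * indicator {?g 0..?g 1} x \<partial>lborel) =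
      (\<integral>\<^sup>+t. h (?g t) * ennreal (?g' t) * indicator {0..1} t \<partial>lborel)"
    by (rule nn_integral_substitution_aux)
      (auto intro!: derivative_eq_intros continuous_intros simp: power2_eq_square dest: ne)
  also have "\<dots> = ennreal \<bar>- 1\<bar> * (\<integral>\<^sup>+y. h (?g (1 + - 1 * y)) * ennreal (?g' (1 + - 1 * y)) *
      indicator {0..1} (1 + - 1 * y) \<partial>lborel)"
    by (rule nn_integral_real_affine) auto
  also have "\<dots> = (\<integral>\<^sup>+y. h (branch k y) * ennreal (1 / (real k + 1 + y)^2) * indicator {0..1} y \<partial>lborel)"
    by (auto intro!: nn_integral_cong simp: branch_def indicator_def add_ac)
  finally show ?thesis by (simp add: add_ac)
qed

text \<open>Closed intervals suit the substitution rule but share their endpoints. Off this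
  countable set a point x of (0, 1) lies in exactly one of them, the one with k + 1 = floor
  (1/x).\<close>

lemma AE_branch_cover:
  "AE x in lborel. (\<Sum>k. indicator {1 / (real k + 2)..1 / (real k + 1)} x) =
     (indicator {0<..<1} x :: ennreal)"
proof -
  let ?C = "insert 0 (range (\<lambda>k. 1 / (real k + 1)))"
  have "?C \<in> null_sets lborel" by (intro countable_imp_null_set_lborel) auto
  then have "AE x in lborel. x \<notin> ?C" by (rule AE_not_in)
  then show ?thesis
  proof eventually_elim
    case (elim x)
    let ?I = "\<lambda>k::nat. {1 / (real k + 2)..1 / (real k + 1)}"
    show ?case
    proof (cases "0 < x \<and> x < 1")
      case False
      have "x \<notin> ?I k" for k
      proof
        assume a: "x \<in> ?I k"
        have "0 < x" by (rule less_le_trans[of _ "1 / (real k + 2)"]) (use a in auto)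
        moreover have "x \<le> 1" by (rule order_trans[of _ "1 / (real k + 1)"]) (use a in auto)
        ultimately have "x = 1 / (real 0 + 1)" using False by simp
        then show False using elim by blast
      qed
      then show ?thesis using False by simp
    next
      case True
      define k where "k = nat \<lfloor>1 / x\<rfloor> - 1"
      have "1 \<le> \<lfloor>1 / x\<rfloor>" using True by (simp add: le_floor_iff)
      then have "\<lfloor>1 / x\<rfloor> = int k + 1" unfolding k_def by linarith
      then have k: "real k + 1 = of_int \<lfloor>1 / x\<rfloor>" by simp
      have "x \<notin> ?I j" if "j \<noteq> k" for j
      proof
        assume a: "x \<in> ?I j"
        then have "real j + 1 \<le> 1 / x" "1 / x \<le> real j + 2" using True by (auto simp: field_simps)
        moreover have "1 / x \<noteq> real (Suc j) + 1"
        proof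
          assume "1 / x = real (Suc j) + 1"
          then have "x = 1 / (real (Suc j) + 1)" using True by (simp add: field_simps)
          then show False using elim by blast
        qed
        ultimately have "\<lfloor>1 / x\<rfloor> = int j + 1" by (intro floor_unique) auto
        then show False using k that by simp
      qed
      moreover have "x \<in> ?I k"
      proof -
        have "real k + 1 \<le> 1 / x" "1 / x \<le> real k + 2" using k by linarith+
        then show ?thesis using True by (auto simp: field_simps)
      qed
      ultimately have "(\<Sum>k. indicator (?I k) x) = (\<Sum>i\<in>{k}. indicator (?I i) x :: ennreal)"
        by (intro suminf_finite) auto
      then show ?thesis using True \<open>x \<in> ?I k\<close> by simp
    qed
  qed
qed

lemma gauss_map_branch: "0 < y \<Longrightarrow> y < 1 \<Longrightarrow> gauss_map (branch k y) = y"
  by (simp add: gauss_map_def branch_def frac_unique_iff)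

lemma floor_inverse_branch: "0 < y \<Longrightarrow> y < 1 \<Longrightarrow> \<lfloor>1 / branch k y\<rfloor> = int k + 1"
  by (auto simp: branch_def intro!: floor_unique)

lemma branch_in_unit: "0 < y \<Longrightarrow> y < 1 \<Longrightarrow> 0 < branch k y \<and> branch k y < 1"
  by (auto simp: branch_def)

lemma branch_weight_pos: "0 \<le> y \<Longrightarrow> 0 < branch_weight k y"
  by (auto simp: branch_weight_def intro!: divide_pos_pos mult_pos_pos)

text \<open>The unit interval is cut along the branch intervals and each piece is pulled back by its
  branch: \<open>gauss_map x\<close> becomes y, and Jacobian times density becomes the weight.
  Values in \<open>ennreal\<close> let the sum pass through the integral unconditionally.\<close>

lemma nn_integral_gauss_transfer:
  fixes f g :: "real \<Rightarrow> ennreal"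
  assumes [measurable]: "f \<in> borel_measurable borel" "g \<in> borel_measurable borel"
  shows "(\<integral>\<^sup>+x. f x * g (gauss_map x) \<partial>gauss_measure) =
    (\<integral>\<^sup>+y. (\<Sum>k. ennreal (branch_weight k y) * f (branch k y)) * g y \<partial>gauss_measure)"
proof -
  let ?I = "\<lambda>k::nat. {1 / (real k + 2)..1 / (real k + 1)}"
  define h where "h = (\<lambda>x. ennreal (1 / (ln 2 * (1 + x))) * (f x * g (gauss_map x)))"
  have [measurable]: "h \<in> borel_measurable borel" unfolding h_def by measurable
  have eq: "h (branch k y) * ennreal (1 / (real k + 1 + y)^2) * indicator {0..1} y =
      ennreal (1 / (ln 2 * (1 + y))) * (ennreal (branch_weight k y) * f (branch k y) * g y) * indicator {0<..<1} y"
    if "y \<noteq> 0" "y \<noteq> 1" for k y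
  proof (cases "0 < y \<and> y < 1")
    case True
    have "1 / (ln 2 * (1 + branch k y)) * (1 / (real k + 1 + y)^2) =
        1 / (ln 2 * (1 + y)) * branch_weight k y"
      using True by (simp add: branch_def branch_weight_def divide_simps power2_eq_square)
    then have "ennreal (1 / (ln 2 * (1 + branch k y))) * ennreal (1 / (real k + 1 + y)^2) =
        ennreal (1 / (ln 2 * (1 + y))) * ennreal (branch_weight k y)"
      using True branch_in_unit[of y k] branch_weight_pos[of y k] by (simp add: ennreal_mult[symmetric])
    then show ?thesis using True by (simp add: h_def gauss_map_branch mult_ac)
  qed (use that in \<open>auto simp: indicator_def\<close>)
  have "(\<integral>\<^sup>+x. f x * g (gauss_map x) \<partial>gauss_measure) = (\<integral>\<^sup>+x. h x * indicator {0<..<1} x \<partial>lborel)"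
    by (subst nn_integral_gauss) (auto simp: h_def)
  also have "\<dots> = (\<integral>\<^sup>+x. (\<Sum>k. h x * indicator (?I k) x) \<partial>lborel)"
    using AE_branch_cover by (intro nn_integral_cong_AE, eventually_elim) simp
  also have "\<dots> = (\<Sum>k. \<integral>\<^sup>+x. h x * indicator (?I k) x \<partial>lborel)" by (rule nn_integral_suminf) measurable
  also have "\<dots> = (\<Sum>k. \<integral>\<^sup>+y. h (branch k y) * ennreal (1 / (real k + 1 + y)^2) * indicator {0..1} y \<partial>lborel)"
    by (subst nn_integral_branch) auto
  also have "\<dots> = (\<integral>\<^sup>+y. (\<Sum>k. h (branch k y) * ennreal (1 / (real k + 1 + y)^2) * indicator {0..1} y) \<partial>lborel)"
    by (rule nn_integral_suminf[symmetric]) measurable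
  also have "\<dots> = (\<integral>\<^sup>+y. (\<Sum>k. ennreal (1 / (ln 2 * (1 + y))) *
      (ennreal (branch_weight k y) * f (branch k y) * g y) * indicator {0<..<1} y) \<partial>lborel)"
    using AE_lborel_singleton[of 0] AE_lborel_singleton[of 1]
    by (intro nn_integral_cong_AE, eventually_elim) (intro arg_cong[of _ _ suminf] ext eq)
  also have "\<dots> = (\<integral>\<^sup>+y. ennreal (1 / (ln 2 * (1 + y))) *
      ((\<Sum>k. ennreal (branch_weight k y) * f (branch k y)) * g y) * indicator {0<..<1} y \<partial>lborel)"
    by (simp only: ennreal_suminf_multc ennreal_suminf_cmult)
  also have "\<dots> = (\<integral>\<^sup>+y. (\<Sum>k. ennreal (branch_weight k y) * f (branch k y)) * g y \<partial>gauss_measure)"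
    by (rule nn_integral_gauss[symmetric]) measurable
  finally show ?thesis .
qed

text \<open>The adjoint of composition with \<open>gauss_map\<close> in the Gauss measure. A real
  \<open>suminf\<close> is meaningful only for convergent series, hence the summability conditions
  on f below.\<close>

definition transfer :: "(real \<Rightarrow> real) \<Rightarrow> real \<Rightarrow> real" where
  "transfer f y = (\<Sum>k. branch_weight k y * f (branch k y))"

lemma transfer_measurable [measurable]:
  assumes [measurable]: "f \<in> borel_measurable borel"
  shows "transfer f \<in> borel_measurable borel"
  unfolding transfer_def by measurable

section \<open>Telescoping weights and Lipschitz bounds for branch sums\<close>

lemma branch_weight_eq_diff:
  assumes "0 < y"
  shows "branch_weight k y = (1 + y) / (real k + 1 + y) - (1 + y) / (real (Suc k) + 1 + y)"
  using assms by (simp add: branch_weight_def divide_simps) (simp add: algebra_simps)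

lemma sum_branch_weight:
  assumes "0 < y"
  shows "(\<Sum>k<n. branch_weight k y) = 1 - (1 + y) / (real n + 1 + y)"
proof -
  have "(\<Sum>k<n. branch_weight k y) =
      (\<Sum>k<n. (1 + y) / (real k + 1 + y) - (1 + y) / (real (Suc k) + 1 + y))"
    using branch_weight_eq_diff[OF assms] by simp
  also have "\<dots> = (1 + y) / (real 0 + 1 + y) - (1 + y) / (real n + 1 + y)"
    by (rule sum_lessThan_telescope')
  finally show ?thesis using assms by simp
qed

lemma branch_weight_sums_1:
  assumes "0 < y"
  shows "(\<lambda>k. branch_weight k y) sums 1"
proof -
  have "(\<lambda>n. 1 - (1 + y) / (real n + 1 + y)) \<longlonglongrightarrow> 1" by real_asymp
  then show ?thesis by (simp add: sums_def sum_branch_weight[OF assms])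
qed

lemma sum_branch_weight_le_1: "0 < y \<Longrightarrow> (\<Sum>k<n. branch_weight k y) \<le> 1"
  by (simp add: sum_branch_weight)

text \<open>The variation of the weights is handled by Abel summation, since their tails have the closed form
  \<open>(1 + y) / (n + 1 + y)\<close>.\<close>

lemma lipschitz_weighted_sum:
  fixes F :: "nat \<Rightarrow> real \<Rightarrow> real"
  assumes y: "0 < y" and z: "0 < z"
    and A: "\<And>k. \<bar>F k y - F k z\<bar> \<le> A k * \<bar>y - z\<bar>"
    and B: "\<And>k. \<bar>F (Suc k) z - F k z\<bar> \<le> B k"
    and \<alpha>: "\<And>n. (\<Sum>k<n. branch_weight k y * A k) \<le> \<alpha>"
    and \<beta>: "\<And>n. (\<Sum>k<n. B k * ((real k + 1) / (real k + 2)^2)) \<le> \<beta>"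
    and lim: "(\<lambda>n. F n z / (real n + 1)) \<longlonglongrightarrow> 0"
    and sy: "summable (\<lambda>k. branch_weight k y * F k y)"
    and sz: "summable (\<lambda>k. branch_weight k z * F k z)"
  shows "\<bar>(\<Sum>k. branch_weight k y * F k y) - (\<Sum>k. branch_weight k z * F k z)\<bar> \<le> (\<alpha> + \<beta>) * \<bar>y - z\<bar>"
proof -
  \<comment> \<open>\<open>D k\<close> is the difference at y and z of the tails of the weights from
    index k on.\<close>
  define D where "D k = (1 + y) / (real k + 1 + y) - (1 + z) / (real k + 1 + z)" for k
  define S where "S n = (\<Sum>k<n. branch_weight k y * F k y) - (\<Sum>k<n. branch_weight k z * F k z)" for n
  \<comment> \<open>The numerator collapses to k (y - z): the tail difference carries the factor y -
    z, has size 1/k and vanishes at k = 0. So Abel summation leaves a boundary term only at n, which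
    \<open>lim\<close> removes.\<close>
  have D: "D k = (real k / ((real k + 1 + y) * (real k + 1 + z))) * (y - z)" for k
    using y z by (simp add: D_def divide_simps) (simp add: algebra_simps)
  have DD: "D k - D (Suc k) = branch_weight k y - branch_weight k z" for k
    by (simp add: D_def branch_weight_eq_diff y z)
  have D_le: "\<bar>D k\<bar> \<le> (real k / (real k + 1)^2) * \<bar>y - z\<bar>" for k
    unfolding D abs_mult power2_eq_square using y z
    by (intro mult_right_mono) (auto intro!: divide_left_mono mult_mono mult_pos_pos)
  have abel: "(\<Sum>k<n. (D k - D (Suc k)) * F k z) =
      (\<Sum>k<n. D (Suc k) * (F (Suc k) z - F k z)) - D n * F n z" for n
  proof (induction n)
    case (Suc n)
    then show ?case by (simp add: algebra_simps)
  qed (simp add: D)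
  have "S n = (\<Sum>k<n. branch_weight k y * (F k y - F k z)) + (\<Sum>k<n. (D k - D (Suc k)) * F k z)" for n
    unfolding S_def sum_subtractf[symmetric] sum.distrib[symmetric] DD
    by (intro sum.cong refl) (simp add: algebra_simps)
  then have S: "S n = (\<Sum>k<n. branch_weight k y * (F k y - F k z)) +
      (\<Sum>k<n. D (Suc k) * (F (Suc k) z - F k z)) - D n * F n z" for n
    by (simp add: abel)
  have bound: "\<bar>S n\<bar> \<le> (\<alpha> + \<beta>) * \<bar>y - z\<bar> + \<bar>y - z\<bar> * \<bar>F n z / (real n + 1)\<bar>" for n
  proof -
    have "\<bar>\<Sum>k<n. branch_weight k y * (F k y - F k z)\<bar> \<le> (\<Sum>k<n. branch_weight k y * A k * \<bar>y - z\<bar>)"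
      using A y branch_weight_pos[of y]
      by (intro order_trans[OF sum_abs] sum_mono)
        (auto simp: abs_mult mult.assoc less_imp_le intro!: mult_left_mono)
    also have "\<dots> \<le> \<alpha> * \<bar>y - z\<bar>"
      unfolding sum_distrib_right[symmetric] by (intro mult_right_mono \<alpha>) auto
    finally have 1: "\<bar>\<Sum>k<n. branch_weight k y * (F k y - F k z)\<bar> \<le> \<alpha> * \<bar>y - z\<bar>" .
    have "\<bar>D (Suc k) * (F (Suc k) z - F k z)\<bar> \<le> B k * ((real k + 1) / (real k + 2)^2) * \<bar>y - z\<bar>" for k
    proof -
      have "\<bar>D (Suc k)\<bar> \<le> ((real k + 1) / (real k + 2)^2) * \<bar>y - z\<bar>"
        using D_le[of "Suc k"] by (simp add: add_ac)
      then have "\<bar>D (Suc k)\<bar> * \<bar>F (Suc k) z - F k z\<bar> \<le> (((real k + 1) / (real k + 2)^2) * \<bar>y - z\<bar>) * B k"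
        by (intro mult_mono B) auto
      then show ?thesis by (simp only: abs_mult mult_ac)
    qed
    then have "\<bar>\<Sum>k<n. D (Suc k) * (F (Suc k) z - F k z)\<bar> \<le>
        (\<Sum>k<n. B k * ((real k + 1) / (real k + 2)^2) * \<bar>y - z\<bar>)"
      by (intro order_trans[OF sum_abs] sum_mono) auto
    also have "\<dots> \<le> \<beta> * \<bar>y - z\<bar>"
      unfolding sum_distrib_right[symmetric] by (intro mult_right_mono \<beta>) auto
    finally have 2: "\<bar>\<Sum>k<n. D (Suc k) * (F (Suc k) z - F k z)\<bar> \<le> \<beta> * \<bar>y - z\<bar>" .
    have "real n / (real n + 1)^2 \<le> 1 / (real n + 1)" by (simp add: divide_simps power2_eq_square)
    then have "\<bar>D n\<bar> \<le> 1 / (real n + 1) * \<bar>y - z\<bar>"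
      by (intro order_trans[OF D_le] mult_right_mono) auto
    then have "\<bar>D n * F n z\<bar> \<le> 1 / (real n + 1) * \<bar>y - z\<bar> * \<bar>F n z\<bar>"
      unfolding abs_mult by (intro mult_right_mono) auto
    then have 3: "\<bar>D n * F n z\<bar> \<le> \<bar>y - z\<bar> * \<bar>F n z / (real n + 1)\<bar>" by (simp add: mult_ac)
    show ?thesis using 1 2 3 unfolding S distrib_right by linarith
  qed
  have "S \<longlonglongrightarrow> (\<Sum>k. branch_weight k y * F k y) - (\<Sum>k. branch_weight k z * F k z)"
    unfolding S_def by (intro tendsto_diff summable_LIMSEQ sy sz)
  then have 1: "(\<lambda>n. \<bar>S n\<bar>) \<longlonglongrightarrow> \<bar>(\<Sum>k. branch_weight k y * F k y) - (\<Sum>k. branch_weight k z * F k z)\<bar>"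
    by (rule tendsto_rabs)
  have 2: "(\<lambda>n. (\<alpha> + \<beta>) * \<bar>y - z\<bar> + \<bar>y - z\<bar> * \<bar>F n z / (real n + 1)\<bar>) \<longlonglongrightarrow> (\<alpha> + \<beta>) * \<bar>y - z\<bar> + \<bar>y - z\<bar> * \<bar>0\<bar>"
    by (intro tendsto_intros lim)
  show ?thesis using LIMSEQ_le[OF 1 2] bound by auto
qed

lemma branch_diff_le:
  assumes "0 < y" "0 < z"
  shows "\<bar>branch k y - branch k z\<bar> \<le> 1 / (real k + 1)^2 * \<bar>y - z\<bar>"
proof -
  have "branch k y - branch k z = (z - y) / ((real k + 1 + y) * (real k + 1 + z))"
    using assms by (simp add: branch_def divide_simps)
  then have "\<bar>branch k y - branch k z\<bar> = 1 / ((real k + 1 + y) * (real k + 1 + z)) * \<bar>y - z\<bar>"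
    using assms by (simp add: abs_mult)
  also have "\<dots> \<le> 1 / (real k + 1)^2 * \<bar>y - z\<bar>"
    using assms unfolding power2_eq_square
    by (intro mult_right_mono divide_left_mono mult_mono mult_pos_pos) auto
  finally show ?thesis .
qed

lemma branch_Suc_diff_le:
  assumes "0 < z"
  shows "\<bar>branch (Suc k) z - branch k z\<bar> \<le> 1 / ((real k + 1) * (real k + 2))"
proof -
  have "branch (Suc k) z - branch k z = - (1 / ((real k + 1 + z) * (real k + 2 + z)))"
    using assms by (simp add: branch_def divide_simps)
  then have "\<bar>branch (Suc k) z - branch k z\<bar> = 1 / ((real k + 1 + z) * (real k + 2 + z))"
    using assms by (simp add: abs_mult)
  also have "\<dots> \<le> 1 / ((real k + 1) * (real k + 2))"
    using assms by (intro divide_left_mono mult_mono mult_pos_pos) auto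
  finally show ?thesis .
qed

text \<open>Split off k = 0: that weight is 1 / (2 + y) <= 1/2, and for k >= 1 the factor is at most
  1/4. This gives 1/4 + (1 - 1/4) / 2 = 5/8.\<close>

lemma sum_weight_div_square_le:
  assumes "0 < y"
  shows "(\<Sum>k<n. branch_weight k y * (1 / (real k + 1)^2)) \<le> 5 / 8"
proof -
  have "branch_weight k y * (1 / (real k + 1)^2) \<le>
      branch_weight k y * (1 / 4) + (if k = 0 then 3 / 8 else 0)" for k
  proof (cases k)
    case 0
    have "branch_weight 0 y = 1 / (2 + y)" using assms by (simp add: branch_weight_def)
    also have "\<dots> \<le> 1 / 2" using assms by (intro divide_left_mono) auto
    finally show ?thesis using 0 by simp
  next
    case (Suc j)
    have "2^2 \<le> (real k + 1)^2" using Suc by (intro power_mono) auto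
    then have "1 / (real k + 1)^2 \<le> 1 / 4" by (intro divide_left_mono) auto
    from mult_left_mono[OF this, of "branch_weight k y"] show ?thesis
      using Suc branch_weight_pos[of y k] assms by simp
  qed
  then have "(\<Sum>k<n. branch_weight k y * (1 / (real k + 1)^2)) \<le>
      (\<Sum>k<n. branch_weight k y * (1 / 4) + (if k = 0 then 3 / 8 else 0))"
    by (intro sum_mono)
  also have "\<dots> = (\<Sum>k<n. branch_weight k y) * (1 / 4) + (\<Sum>k<n. if k = 0 then 3 / 8 else 0)"
    by (simp only: sum.distrib sum_distrib_right)
  also have "\<dots> \<le> 1 * (1 / 4) + 3 / 8"
    by (intro add_mono mult_right_mono sum_branch_weight_le_1 assms) auto
  finally show ?thesis by simp
qed

text \<open>(k + 2)^3 dominates (k + 1) (k + 2) (k + 3), whose reciprocals telescope from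
  1/4.\<close>

lemma sum_inverse_cubes_le: "(\<Sum>k<n. 1 / (real k + 2)^3) \<le> 1 / 4"
proof -
  have "1 / (real k + 2)^3 \<le> 1 / (2 * (real k + 1) * (real k + 2)) - 1 / (2 * (real (Suc k) + 1) * (real (Suc k) + 2))" for k
  proof -
    have "(real k + 1) * (real k + 2) * (real k + 3) \<le> (real k + 2)^3"
      by (simp add: power3_eq_cube algebra_simps)
    then have "1 / (real k + 2)^3 \<le> 1 / ((real k + 1) * (real k + 2) * (real k + 3))"
      by (intro divide_left_mono) auto
    also have "\<dots> = 1 / (2 * (real k + 1) * (real k + 2)) - 1 / (2 * (real (Suc k) + 1) * (real (Suc k) + 2))"
      by (simp add: divide_simps) (simp add: algebra_simps)
    finally show ?thesis .
  qed
  then have "(\<Sum>k<n. 1 / (real k + 2)^3) \<le>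
      (\<Sum>k<n. 1 / (2 * (real k + 1) * (real k + 2)) - 1 / (2 * (real (Suc k) + 1) * (real (Suc k) + 2)))"
    by (intro sum_mono)
  also have "\<dots> = 1 / (2 * (real 0 + 1) * (real 0 + 2)) - 1 / (2 * (real n + 1) * (real n + 2))"
    by (rule sum_lessThan_telescope')
  also have "\<dots> \<le> 1 / 4" by simp
  finally show ?thesis .
qed

lemma lipschitz_unit_bounded:
  assumes "L-lipschitz_on {0<..<1} f"
  obtains C where "\<And>t. t \<in> {0<..<1::real} \<Longrightarrow> \<bar>f t\<bar> \<le> (C::real)"
proof
  fix t :: real assume t: "t \<in> {0<..<1}"
  have "\<bar>f t - f (1/2)\<bar> \<le> L * \<bar>t - 1/2\<bar>"
    using lipschitz_onD[OF assms t, of "1/2"] by (simp add: dist_real_def)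
  also have "\<dots> \<le> L * 1" using t lipschitz_on_nonneg[OF assms] by (intro mult_left_mono) auto
  finally show "\<bar>f t\<bar> \<le> \<bar>f (1/2)\<bar> + L" by simp
qed

lemma transfer_summable_bounded:
  assumes "\<And>t. t \<in> {0<..<1} \<Longrightarrow> \<bar>f t\<bar> \<le> C" "0 < y" "y < 1"
  shows "summable (\<lambda>k. branch_weight k y * f (branch k y))"
proof (rule summable_comparison_test')
  show "summable (\<lambda>k. branch_weight k y * C)"
    using branch_weight_sums_1[OF assms(2)] by (intro summable_mult2) (rule sums_summable)
  show "norm (branch_weight k y * f (branch k y)) \<le> branch_weight k y * C" for k
    using assms branch_in_unit[of y k] branch_weight_pos[of y k]
    by (auto simp: abs_mult less_imp_le intro!: mult_left_mono)
qed

text \<open>The displacement of the branch points contributes 5/8 of L and the variation of the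
  weights 1/4, together 7/8. Only that the sum is below 1 matters: it gives exponential
  mixing.\<close>

lemma transfer_contraction:
  assumes "L-lipschitz_on {0<..<1} f"
  shows "(L * (7/8))-lipschitz_on {0<..<1} (transfer f)"
proof (rule lipschitz_onI)
  obtain C where C: "\<And>t. t \<in> {0<..<1::real} \<Longrightarrow> \<bar>f t\<bar> \<le> C" by (rule lipschitz_unit_bounded[OF assms]) blast
  have L: "0 \<le> L" by (rule lipschitz_on_nonneg[OF assms])
  show "0 \<le> L * (7/8)" using L by simp
  fix y z :: real assume yz: "y \<in> {0<..<1}" "z \<in> {0<..<1}"
  have lip: "\<bar>f s - f t\<bar> \<le> L * \<bar>s - t\<bar>" if "s \<in> {0<..<1}" "t \<in> {0<..<1}" for s t
    using lipschitz_onD[OF assms that] by (simp add: dist_real_def)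
  have b: "branch k y \<in> {0<..<1}" "branch k z \<in> {0<..<1}" for k
    using yz branch_in_unit[of _ k] by auto
  have "\<bar>(\<Sum>k. branch_weight k y * f (branch k y)) - (\<Sum>k. branch_weight k z * f (branch k z))\<bar>
      \<le> (L * (5/8) + L * (1/4)) * \<bar>y - z\<bar>"
  proof (rule lipschitz_weighted_sum[where A = "\<lambda>k. L * (1 / (real k + 1)^2)"
        and B = "\<lambda>k. L * (1 / ((real k + 1) * (real k + 2)))"])
    show "0 < y" "0 < z" using yz by auto
    show "\<bar>f (branch k y) - f (branch k z)\<bar> \<le> L * (1 / (real k + 1)^2) * \<bar>y - z\<bar>" for k
    proof -
      have "\<bar>f (branch k y) - f (branch k z)\<bar> \<le> L * \<bar>branch k y - branch k z\<bar>" by (rule lip[OF b])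
      also have "\<dots> \<le> L * (1 / (real k + 1)^2 * \<bar>y - z\<bar>)"
        using yz by (intro mult_left_mono branch_diff_le L) auto
      finally show ?thesis by (simp only: mult.assoc)
    qed
    show "\<bar>f (branch (Suc k) z) - f (branch k z)\<bar> \<le> L * (1 / ((real k + 1) * (real k + 2)))" for k
    proof -
      have "\<bar>f (branch (Suc k) z) - f (branch k z)\<bar> \<le> L * \<bar>branch (Suc k) z - branch k z\<bar>"
        by (rule lip[OF b(2) b(2)])
      also have "\<dots> \<le> L * (1 / ((real k + 1) * (real k + 2)))"
        using yz by (intro mult_left_mono branch_Suc_diff_le L) auto
      finally show ?thesis .
    qed
    show "(\<Sum>k<n. branch_weight k y * (L * (1 / (real k + 1)^2))) \<le> L * (5/8)" for n
    proof -
      have "(\<Sum>k<n. branch_weight k y * (L * (1 / (real k + 1)^2))) =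
          L * (\<Sum>k<n. branch_weight k y * (1 / (real k + 1)^2))"
        unfolding sum_distrib_left by (intro sum.cong) (auto simp: mult_ac)
      also have "\<dots> \<le> L * (5/8)" using yz by (intro mult_left_mono sum_weight_div_square_le L) auto
      finally show ?thesis .
    qed
    show "(\<Sum>k<n. L * (1 / ((real k + 1) * (real k + 2))) * ((real k + 1) / (real k + 2)^2)) \<le> L * (1/4)" for n
    proof -
      have "1 / ((real k + 1) * (real k + 2)) * ((real k + 1) / (real k + 2)^2) = 1 / (real k + 2)^3" for k
        by (simp add: power2_eq_square power3_eq_cube)
      then have "(\<Sum>k<n. L * (1 / ((real k + 1) * (real k + 2))) * ((real k + 1) / (real k + 2)^2)) =
          L * (\<Sum>k<n. 1 / (real k + 2)^3)"
        unfolding sum_distrib_left by (simp only: mult.assoc)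
      also have "\<dots> \<le> L * (1/4)" by (intro mult_left_mono sum_inverse_cubes_le L)
      finally show ?thesis .
    qed
    have "(\<lambda>n. C / (real n + 1)) \<longlonglongrightarrow> 0" by real_asymp
    then show "(\<lambda>n. f (branch n z) / (real n + 1)) \<longlonglongrightarrow> 0"
      by (rule Lim_null_comparison[rotated]) (use C b in \<open>auto intro!: divide_right_mono always_eventually\<close>)
    show "summable (\<lambda>k. branch_weight k y * f (branch k y))"
      "summable (\<lambda>k. branch_weight k z * f (branch k z))"
      using yz by (auto intro!: transfer_summable_bounded[of f C] C)
  qed
  then show "dist (transfer f y) (transfer f z) \<le> L * (7/8) * dist y z"
    by (simp add: transfer_def dist_real_def algebra_simps)
qed

lemma nn_integral_transfer_step:
  fixes g :: "real \<Rightarrow> ennreal"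
  assumes [measurable]: "f \<in> borel_measurable borel" "g \<in> borel_measurable borel"
    and f0: "\<And>t. 0 < t \<Longrightarrow> t < 1 \<Longrightarrow> 0 \<le> f t"
    and s: "\<And>y. 0 < y \<Longrightarrow> y < 1 \<Longrightarrow> summable (\<lambda>k. branch_weight k y * f (branch k y))"
  shows "(\<integral>\<^sup>+x. ennreal (f x) * g (gauss_map x) \<partial>gauss_measure) =
    (\<integral>\<^sup>+y. ennreal (transfer f y) * g y \<partial>gauss_measure)"
proof -
  have eq: "(\<Sum>k. ennreal (branch_weight k y) * ennreal (f (branch k y))) = ennreal (transfer f y)"
    if "0 < y \<and> y < 1" for y
  proof -
    have "(\<Sum>k. ennreal (branch_weight k y * f (branch k y))) = ennreal (transfer f y)"
      unfolding transfer_def using that f0 branch_in_unit[of y] branch_weight_pos[of y] s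
      by (intro suminf_ennreal2) (auto intro!: mult_nonneg_nonneg simp: less_imp_le)
    then show ?thesis
      using that branch_weight_pos[of y] by (simp add: ennreal_mult' less_imp_le)
  qed
  have "(\<integral>\<^sup>+y. (\<Sum>k. ennreal (branch_weight k y) * ennreal (f (branch k y))) * g y \<partial>gauss_measure) =
      (\<integral>\<^sup>+y. ennreal (transfer f y) * g y \<partial>gauss_measure)"
    using AE_gauss_unit by (intro nn_integral_cong_AE, eventually_elim) (simp add: eq)
  then show ?thesis by (subst nn_integral_gauss_transfer) auto
qed

lemma transfer_nonneg:
  assumes "\<And>t. 0 < t \<Longrightarrow> t < 1 \<Longrightarrow> 0 \<le> f t" "0 < y" "y < 1"
    "summable (\<lambda>k. branch_weight k y * f (branch k y))"
  shows "0 \<le> transfer f y"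
  unfolding transfer_def using assms branch_in_unit[of y] branch_weight_pos[of y]
  by (intro suminf_nonneg) (auto intro!: mult_nonneg_nonneg simp: less_imp_le)

text \<open>The claims feed each other: the Lipschitz bound makes the iterate bounded on (0, 1),
  which gives the summability needed to apply the operator once more.\<close>

lemma transfer_iterate:
  assumes [measurable]: "f \<in> borel_measurable borel"
    and f0: "\<And>t. 0 < t \<Longrightarrow> t < 1 \<Longrightarrow> 0 \<le> f t"
    and s: "\<And>y. 0 < y \<Longrightarrow> y < 1 \<Longrightarrow> summable (\<lambda>k. branch_weight k y * f (branch k y))"
    and lip: "L-lipschitz_on {0<..<1} (transfer f)"
  shows "(transfer ^^ Suc k) f \<in> borel_measurable borel"
    and "\<And>y. 0 < y \<Longrightarrow> y < 1 \<Longrightarrow> 0 \<le> (transfer ^^ Suc k) f y"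
    and "(L * (7/8)^k)-lipschitz_on {0<..<1} ((transfer ^^ Suc k) f)"
    and "\<And>g :: real \<Rightarrow> ennreal. g \<in> borel_measurable borel \<Longrightarrow>
      (\<integral>\<^sup>+x. ennreal (f x) * g ((gauss_map ^^ Suc k) x) \<partial>gauss_measure) =
      (\<integral>\<^sup>+y. ennreal ((transfer ^^ Suc k) f y) * g y \<partial>gauss_measure)"
proof (induction k)
  case 0
  { case 1 then show ?case by simp }
  { case (2 y) then show ?case using transfer_nonneg[OF f0] s by simp }
  { case 3 then show ?case using lip by simp }
  { case (4 g) then show ?case using nn_integral_transfer_step[OF _ _ f0 s, of g] by simp }
next
  case (Suc k)
  let ?h = "(transfer ^^ Suc k) f"
  obtain C where C: "\<And>t. t \<in> {0<..<1::real} \<Longrightarrow> \<bar>?h t\<bar> \<le> C"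
    by (rule lipschitz_unit_bounded[OF Suc(3)]) blast
  have s': "summable (\<lambda>k. branch_weight k y * ?h (branch k y))" if "0 < y" "y < 1" for y
    using that by (intro transfer_summable_bounded[of ?h C] C)
  have [measurable]: "?h \<in> borel_measurable borel" by (rule Suc(1))
  have e: "(transfer ^^ Suc (Suc k)) f = transfer ?h" by simp
  { case 1 show ?case unfolding e by measurable }
  { case (2 y) then show ?case unfolding e by (intro transfer_nonneg Suc(2) s') auto }
  { case 3 show ?case unfolding e using transfer_contraction[OF Suc(3)] by (simp add: mult_ac) }
  { case (4 g)
    then have [measurable]: "g \<in> borel_measurable borel" .
    have "(\<integral>\<^sup>+x. ennreal (f x) * g ((gauss_map ^^ Suc (Suc k)) x) \<partial>gauss_measure) =
        (\<integral>\<^sup>+x. ennreal (f x) * (\<lambda>x. g (gauss_map x)) ((gauss_map ^^ Suc k) x) \<partial>gauss_measure)" by simp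
    also have "\<dots> = (\<integral>\<^sup>+y. ennreal (?h y) * g (gauss_map y) \<partial>gauss_measure)"
      by (rule Suc(4)) measurable
    also have "\<dots> = (\<integral>\<^sup>+y. ennreal (transfer ?h y) * g y \<partial>gauss_measure)"
      by (rule nn_integral_transfer_step[OF _ _ Suc(2) s']) measurable
    finally show ?case unfolding e . }
qed

text \<open>The iterate has mean m and oscillates by at most L (7/8)^k over (0, 1), hence lies below
  m + L (7/8)^k pointwise; this bound then factors out of the integral.\<close>

lemma gauss_mixing:
  fixes g :: "real \<Rightarrow> ennreal"
  assumes [measurable]: "f \<in> borel_measurable borel" "g \<in> borel_measurable borel"
    and f0: "\<And>t. 0 < t \<Longrightarrow> t < 1 \<Longrightarrow> 0 \<le> f t"
    and s: "\<And>y. 0 < y \<Longrightarrow> y < 1 \<Longrightarrow> summable (\<lambda>k. branch_weight k y * f (branch k y))"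
    and lip: "L-lipschitz_on {0<..<1} (transfer f)"
    and m: "(\<integral>\<^sup>+x. ennreal (f x) \<partial>gauss_measure) = ennreal m" "0 \<le> m"
  shows "(\<integral>\<^sup>+x. ennreal (f x) * g ((gauss_map ^^ Suc k) x) \<partial>gauss_measure) \<le>
    ennreal (m + L * (7/8)^k) * (\<integral>\<^sup>+x. g x \<partial>gauss_measure)"
proof -
  note it = transfer_iterate[OF assms(1) f0 s lip, where k = k]
  let ?h = "(transfer ^^ Suc k) f"
  let ?e = "L * (7/8)^k"
  have [measurable]: "?h \<in> borel_measurable borel" by (rule it(1))
  have hm: "(\<integral>\<^sup>+y. ennreal (?h y) \<partial>gauss_measure) = ennreal m"
    using it(4)[of "\<lambda>_. 1"] m by simp
  have le: "?h y \<le> m + ?e" if "0 < y" "y < 1" for y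
  proof -
    have *: "?h y - ?e \<le> ?h z" if z: "0 < z \<and> z < 1" for z
    proof -
      have "\<bar>?h y - ?h z\<bar> \<le> ?e * \<bar>y - z\<bar>"
        using lipschitz_onD[OF it(3), of y z] \<open>0 < y\<close> \<open>y < 1\<close> z by (simp add: dist_real_def)
      also have "\<dots> \<le> ?e * 1"
        using \<open>0 < y\<close> \<open>y < 1\<close> z lipschitz_on_nonneg[OF it(3)] by (intro mult_left_mono) auto
      finally show ?thesis by linarith
    qed
    have "ennreal (?h y - ?e) = (\<integral>\<^sup>+z. ennreal (?h y - ?e) \<partial>gauss_measure)"
      using gauss.emeasure_space_1 by simp
    also have "\<dots> \<le> (\<integral>\<^sup>+z. ennreal (?h z) \<partial>gauss_measure)"
      using AE_gauss_unit by (intro nn_integral_mono_AE, eventually_elim) (intro ennreal_leI *)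
    finally have "ennreal (?h y - ?e) \<le> ennreal m" by (simp only: hm)
    then have "?h y - ?e \<le> m" using m(2) by (auto simp add: ennreal_le_iff2 simp del: funpow.simps)
    then show ?thesis by simp
  qed
  have "(\<integral>\<^sup>+x. ennreal (f x) * g ((gauss_map ^^ Suc k) x) \<partial>gauss_measure) =
      (\<integral>\<^sup>+y. ennreal (?h y) * g y \<partial>gauss_measure)" by (rule it(4)) measurable
  also have "\<dots> \<le> (\<integral>\<^sup>+y. ennreal (m + ?e) * g y \<partial>gauss_measure)"
    using AE_gauss_unit
    by (intro nn_integral_mono_AE, eventually_elim) (auto intro!: mult_right_mono ennreal_leI le simp del: funpow.simps)
  also have "\<dots> = ennreal (m + ?e) * (\<integral>\<^sup>+x. g x \<partial>gauss_measure)" by (rule nn_integral_cmult) measurable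
  finally show ?thesis .
qed

section \<open>Second moments and the Gal-Koksma theorem\<close>

text \<open>In truncated subtraction (j - i) + (i - j) is |i - j|, so the exponents on either side
  of i are distinct and each side is bounded by a full geometric series.\<close>

lemma sum_power_distance_le:
  fixes \<theta> :: real and i :: nat
  assumes \<theta>: "0 \<le> \<theta>" "\<theta> < 1" and J: "finite J"
  shows "(\<Sum>j\<in>J - {i}. \<theta> ^ ((j - i) + (i - j) - 1)) \<le> 2 / (1 - \<theta>)"
proof -
  have half: "(\<Sum>j\<in>K. \<theta> ^ \<phi> j) \<le> 1 / (1 - \<theta>)" if "inj_on \<phi> K" "finite K" for K and \<phi> :: "nat \<Rightarrow> nat"
  proof -
    have "(\<Sum>j\<in>K. \<theta> ^ \<phi> j) = (\<Sum>k\<in>\<phi> ` K. \<theta> ^ k)" using that by (simp add: sum.reindex)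
    also have "\<dots> \<le> (\<Sum>k. \<theta> ^ k)" using \<theta> that by (intro sum_le_suminf summable_geometric) auto
    also have "\<dots> = 1 / (1 - \<theta>)" using \<theta> by (intro suminf_geometric) auto
    finally show ?thesis .
  qed
  have split: "J - {i} = {j \<in> J. i < j} \<union> {j \<in> J. j < i}" by auto
  have "(\<Sum>j\<in>J - {i}. \<theta> ^ ((j - i) + (i - j) - 1)) =
      (\<Sum>j\<in>{j \<in> J. i < j}. \<theta> ^ ((j - i) + (i - j) - 1)) + (\<Sum>j\<in>{j \<in> J. j < i}. \<theta> ^ ((j - i) + (i - j) - 1))"
    unfolding split by (rule sum.union_disjoint) (use J in auto)
  also have "\<dots> \<le> 1 / (1 - \<theta>) + 1 / (1 - \<theta>)"
    using J by (intro add_mono half) (auto simp: inj_on_def)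
  finally show ?thesis by simp
qed

text \<open>Each off-diagonal product moment is at most m^2 plus an exponentially small term. The
  square of the mean of the sum cancels all the m^2, and a bound linear in \<open>card J\<close>
  remains. Upper bounds on the products suffice because the means are known exactly.\<close>

lemma (in prob_space) second_moment_sum_le:
  fixes X :: "nat \<Rightarrow> 'a \<Rightarrow> real"
  assumes [measurable]: "\<And>i. X i \<in> borel_measurable M"
    and nonneg: "\<And>i. AE x in M. 0 \<le> X i x"
    and mean: "\<And>i. (\<integral>\<^sup>+x. ennreal (X i x) \<partial>M) = ennreal m"
    and sq: "\<And>i. (\<integral>\<^sup>+x. ennreal ((X i x)^2) \<partial>M) \<le> ennreal s"
    and cov: "\<And>i j. i < j \<Longrightarrow> (\<integral>\<^sup>+x. ennreal (X i x * X j x) \<partial>M) \<le> ennreal ((m + L * \<theta> ^ (j - i - 1)) * m)"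
    and m: "0 \<le> m" and L: "0 \<le> L" and s: "0 \<le> s" and \<theta>: "0 \<le> \<theta>" "\<theta> < 1" and J: "finite J"
  shows "(\<integral>\<^sup>+x. ennreal (((\<Sum>i\<in>J. X i x) - real (card J) * m)^2) \<partial>M) \<le>
    ennreal (real (card J) * (s + 2 / (1 - \<theta>) * L * m))"
proof -
  \<comment> \<open>Finite nonnegative integrals yield Bochner integrability, which the expansion of
    the square with its negative cross term requires.\<close>
  have bochner: "integrable M f \<and> integral\<^sup>L M f \<le> c"
    if [measurable]: "f \<in> borel_measurable M" and "AE x in M. 0 \<le> f x"
      "(\<integral>\<^sup>+x. ennreal (f x) \<partial>M) \<le> ennreal c" "0 \<le> c" for f :: "'a \<Rightarrow> real" and c
  proof
    show i: "integrable M f"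
      using that by (intro integrableI_nonneg) (auto intro: le_less_trans)
    have "ennreal (integral\<^sup>L M f) = (\<integral>\<^sup>+x. ennreal (f x) \<partial>M)"
      using that i by (intro nn_integral_eq_integral[symmetric]) auto
    then have "ennreal (integral\<^sup>L M f) \<le> ennreal c" using that(3) by simp
    then show "integral\<^sup>L M f \<le> c" using that(4) by (simp only: ennreal_le_iff)
  qed
  define c where "c i j = (if i = j then s else m^2 + L * m * \<theta> ^ ((j - i) + (i - j) - 1))" for i j :: nat
  have lt: "integrable M (\<lambda>x. X i x * X j x) \<and> expectation (\<lambda>x. X i x * X j x) \<le> c i j" if "i < j" for i j
  proof (rule bochner)
    show "AE x in M. 0 \<le> X i x * X j x" using nonneg[of i] nonneg[of j] by eventually_elim simp
    have "(m + L * \<theta> ^ (j - i - 1)) * m = c i j" using that by (simp add: c_def power2_eq_square algebra_simps)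
    then show "(\<integral>\<^sup>+x. ennreal (X i x * X j x) \<partial>M) \<le> ennreal (c i j)" using cov[OF that] by simp
    show "0 \<le> c i j" using m L s \<theta> by (simp add: c_def)
  qed measurable
  have prod: "integrable M (\<lambda>x. X i x * X j x) \<and> expectation (\<lambda>x. X i x * X j x) \<le> c i j" for i j
  proof (cases i j rule: linorder_cases)
    case equal
    show ?thesis
      by (rule bochner) (use sq[of i] s in \<open>auto simp: equal c_def power2_eq_square\<close>)
  next
    case greater
    then show ?thesis using lt[OF greater] by (simp add: mult.commute c_def add.commute)
  qed (rule lt)
  have X: "integrable M (X i)" "expectation (X i) = m" for i
  proof -
    show i: "integrable M (X i)" using bochner[of "X i" m] nonneg mean m by simp
    have "ennreal (expectation (X i)) = ennreal m"
      unfolding mean[of i, symmetric] using i nonneg by (intro nn_integral_eq_integral[symmetric])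
    then show "expectation (X i) = m" using m nonneg by (simp add: integral_nonneg_AE)
  qed
  let ?n = "real (card J)"
  have expand: "((\<Sum>i\<in>J. X i x) - ?n * m)^2 =
      (\<Sum>i\<in>J. \<Sum>j\<in>J. X i x * X j x) - 2 * ?n * m * (\<Sum>i\<in>J. X i x) + (?n * m)^2" for x
    by (simp add: power2_eq_square sum_product[symmetric] algebra_simps)
  have int: "integrable M (\<lambda>x. ((\<Sum>i\<in>J. X i x) - ?n * m)^2)"
    unfolding expand using prod X by (intro Bochner_Integration.integrable_add Bochner_Integration.integrable_diff
        Bochner_Integration.integrable_sum integrable_mult_right) auto
  have "expectation (\<lambda>x. ((\<Sum>i\<in>J. X i x) - ?n * m)^2) =
      (\<Sum>i\<in>J. \<Sum>j\<in>J. expectation (\<lambda>x. X i x * X j x)) - 2 * ?n * m * (\<Sum>i\<in>J. expectation (X i)) + (?n * m)^2"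
    unfolding expand using prod X prob_space by (simp add: Bochner_Integration.integral_sum)
  also have "\<dots> = (\<Sum>i\<in>J. \<Sum>j\<in>J. expectation (\<lambda>x. X i x * X j x)) - (?n * m)^2"
    by (simp add: X power2_eq_square)
  also have "\<dots> \<le> (\<Sum>i\<in>J. s + ?n * m^2 + 2 / (1 - \<theta>) * L * m) - (?n * m)^2"
  proof (intro diff_right_mono sum_mono)
    fix i assume i: "i \<in> J"
    have "(\<Sum>j\<in>J. expectation (\<lambda>x. X i x * X j x)) \<le> (\<Sum>j\<in>J. c i j)"
      using prod by (intro sum_mono) auto
    also have "\<dots> = s + (\<Sum>j\<in>J - {i}. m^2 + L * m * \<theta> ^ ((j - i) + (i - j) - 1))"
      using J i by (subst sum.remove[of _ i]) (auto simp: c_def intro!: sum.cong)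
    also have "\<dots> = s + real (card (J - {i})) * m^2 + L * m * (\<Sum>j\<in>J - {i}. \<theta> ^ ((j - i) + (i - j) - 1))"
      by (simp only: sum.distrib sum_distrib_left[symmetric] sum_constant)
    also have "\<dots> \<le> s + ?n * m^2 + L * m * (2 / (1 - \<theta>))"
      using m L J by (intro add_mono mult_left_mono mult_right_mono sum_power_distance_le \<theta>)
        (auto intro: card_mono)
    finally show "(\<Sum>j\<in>J. expectation (\<lambda>x. X i x * X j x)) \<le> s + ?n * m^2 + 2 / (1 - \<theta>) * L * m"
      by (simp only: mult_ac)
  qed
  also have "\<dots> = ?n * (s + 2 / (1 - \<theta>) * L * m)" by (simp add: power2_eq_square algebra_simps)
  finally have "expectation (\<lambda>x. ((\<Sum>i\<in>J. X i x) - ?n * m)^2) \<le> ?n * (s + 2 / (1 - \<theta>) * L * m)" .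
  then show ?thesis
    by (subst nn_integral_eq_integral[OF int]) (auto intro: ennreal_leI)
qed

section \<open>Squared increments over all dyadic subintervals of [a, a + 2^r], levels 0 to
  r\<close>

fun dyadic_sq :: "(nat \<Rightarrow> real) \<Rightarrow> nat \<Rightarrow> nat \<Rightarrow> real" where
  "dyadic_sq G 0 a = (G (a + 1) - G a)^2"
| "dyadic_sq G (Suc r) a = dyadic_sq G r a + dyadic_sq G r (a + 2^r) + (G (a + 2^r) - G a)^2"

lemma dyadic_sq_nonneg: "0 \<le> dyadic_sq G r a"
  by (induction r arbitrary: a) auto

text \<open>Cauchy-Schwarz with weights \<open>1\<close> and \<open>r + 1\<close>: the induction step that turns \<open>r + 1\<close> dyadic increments
  into the factor \<open>r + 1\<close>.\<close>

lemma square_add_le: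
  fixes x y d :: real
  assumes "y^2 \<le> (real r + 1) * d"
  shows "(x + y)^2 \<le> (real r + 2) * (x^2 + d)"
proof -
  let ?c = "real r + 1"
  have "?c * (x + y)^2 + (?c * x - y)^2 = (?c + 1) * (?c * x^2 + y^2)"
    by (simp add: power2_eq_square algebra_simps)
  moreover have "(?c + 1) * (?c * x^2 + y^2) \<le> (?c + 1) * (?c * x^2 + ?c * d)"
    using assms by (intro mult_left_mono add_left_mono) auto
  ultimately have "?c * (x + y)^2 \<le> (?c + 1) * (?c * x^2 + ?c * d)"
    using zero_le_power2[of "?c * x - y"] by linarith
  also have "\<dots> = ?c * ((real r + 2) * (x^2 + d))" by (simp add: algebra_simps)
  finally show ?thesis by (rule mult_left_le_imp_le) auto
qed

text \<open>The interval [a, a + n] splits into at most one dyadic interval per level, r + 1 in all.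
  The bound is pathwise, so a single quantity controls all n <= 2^r at once.\<close>

lemma increment_le_dyadic_sq:
  "n \<le> 2^r \<Longrightarrow> (G (a + n) - G a)^2 \<le> (real r + 1) * dyadic_sq G r a"
proof (induction r arbitrary: a n)
  case 0
  then have "n = 0 \<or> n = 1" by auto
  then show ?case by auto
next
  case (Suc r)
  note nn = dyadic_sq_nonneg[of G r]
  show ?case
  proof (cases "n \<le> 2^r")
    case True
    have "(real r + 1) * dyadic_sq G r a \<le> (real (Suc r) + 1) * dyadic_sq G (Suc r) a"
      using nn[of a] nn[of "a + 2^r"] by (intro mult_mono) auto
    then show ?thesis using Suc.IH[OF True, of a] by linarith
  next
    case False
    define n' where "n' = n - 2^r"
    have n: "n = 2^r + n'" "n' \<le> 2^r" using False Suc.prems by (auto simp: n'_def)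
    have "(G (a + n) - G a)^2 = ((G (a + 2^r) - G a) + (G (a + 2^r + n') - G (a + 2^r)))^2"
      by (simp add: n add.assoc)
    also have "\<dots> \<le> (real r + 2) * ((G (a + 2^r) - G a)^2 + dyadic_sq G r (a + 2^r))"
      by (rule square_add_le[OF Suc.IH[OF n(2)]])
    also have "\<dots> \<le> (real (Suc r) + 1) * dyadic_sq G (Suc r) a"
      using nn[of a] nn[of "a + 2^r"] by (intro mult_mono) (auto simp: nn intro!: add_nonneg_nonneg)
    finally show ?thesis .
  qed
qed

text \<open>At each of the r + 1 levels the dyadic intervals have total length 2^r, so each level
  contributes at most K 2^r. Measurability is carried along because \<open>dyadic_sq\<close> is
  recursive.\<close>

lemma nn_integral_dyadic_sq_le:
  fixes S :: "nat \<Rightarrow> 'a \<Rightarrow> real"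
  assumes [measurable]: "\<And>n. S n \<in> borel_measurable M"
    and K: "0 \<le> K"
    and le: "\<And>a n. (\<integral>\<^sup>+x. ennreal ((S (a + n) x - S a x)^2) \<partial>M) \<le> ennreal (K * real n)"
  shows "(\<lambda>x. dyadic_sq (\<lambda>n. S n x) r a) \<in> borel_measurable M \<and>
    (\<integral>\<^sup>+x. ennreal (dyadic_sq (\<lambda>n. S n x) r a) \<partial>M) \<le> ennreal (K * (real r + 1) * 2^r)"
proof (induction r arbitrary: a)
  case 0
  show ?case using le[where n = 1] by (auto intro!: borel_measurable_power borel_measurable_diff)
next
  case (Suc r)
  have [measurable]: "(\<lambda>x. dyadic_sq (\<lambda>n. S n x) r a) \<in> borel_measurable M" for a
    using Suc.IH by blast
  have "(\<integral>\<^sup>+x. ennreal (dyadic_sq (\<lambda>n. S n x) (Suc r) a) \<partial>M) =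
      (\<integral>\<^sup>+x. ennreal (dyadic_sq (\<lambda>n. S n x) r a) \<partial>M) + (\<integral>\<^sup>+x. ennreal (dyadic_sq (\<lambda>n. S n x) r (a + 2^r)) \<partial>M)
      + (\<integral>\<^sup>+x. ennreal ((S (a + 2^r) x - S a x)^2) \<partial>M)"
    by (simp add: ennreal_plus dyadic_sq_nonneg nn_integral_add)
  also have "\<dots> \<le> ennreal (K * (real r + 1) * 2^r) + ennreal (K * (real r + 1) * 2^r) + ennreal (K * real (2^r))"
    using Suc.IH by (intro add_mono le) auto
  also have "\<dots> = ennreal (K * (real r + 1) * 2^r + K * (real r + 1) * 2^r + K * real (2^r))"
  proof -
    have A: "0 \<le> K * (real r + 1) * 2^r" "0 \<le> K * real (2^r)" using K by auto
    show ?thesis by (simp only: A ennreal_plus add_nonneg_nonneg)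
  qed
  also have "\<dots> \<le> ennreal (K * (real (Suc r) + 1) * 2^Suc r)"
    using K by (intro ennreal_leI) (simp add: algebra_simps)
  finally show ?case by (simp add: borel_measurable_add borel_measurable_diff)
qed

text \<open>The expected sum is finite, so the sum is finite almost everywhere and its terms tend to
  0. This takes the place of Chebyshev's inequality with Borel-Cantelli and avoids choosing
  thresholds.\<close>

lemma AE_tendsto_0_if_summable_moments:
  fixes Y :: "nat \<Rightarrow> 'a \<Rightarrow> real"
  assumes [measurable]: "\<And>n. Y n \<in> borel_measurable M"
    and nonneg: "\<And>n x. 0 \<le> Y n x"
    and le: "\<And>n. (\<integral>\<^sup>+x. ennreal (Y n x) \<partial>M) \<le> ennreal (c n)"
    and c: "summable c" "\<And>n. 0 \<le> c n"
  shows "AE x in M. (\<lambda>n. Y n x) \<longlonglongrightarrow> 0"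
proof -
  have "(\<integral>\<^sup>+x. (\<Sum>n. ennreal (Y n x)) \<partial>M) = (\<Sum>n. \<integral>\<^sup>+x. ennreal (Y n x) \<partial>M)"
    by (rule nn_integral_suminf) measurable
  also have "\<dots> \<le> (\<Sum>n. ennreal (c n))" by (intro suminf_le le) auto
  also have "\<dots> = ennreal (\<Sum>n. c n)" by (intro suminf_ennreal2 c)
  finally have "(\<integral>\<^sup>+x. (\<Sum>n. ennreal (Y n x)) \<partial>M) \<noteq> \<infinity>" by (auto simp: top_unique)
  then have "AE x in M. (\<Sum>n. ennreal (Y n x)) \<noteq> \<infinity>" by (intro nn_integral_noteq_infinite) auto
  then show ?thesis
  proof eventually_elim
    case (elim x)
    then have "summable (\<lambda>n. Y n x)" by (intro summable_suminf_not_top nonneg) auto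
    then show ?case by (rule summable_LIMSEQ_zero)
  qed
qed

text \<open>Of the exponent 3 + 2 \<epsilon> for the square of S_n, one power of r pays for the
  Cauchy-Schwarz loss, one for the r + 1 dyadic levels, and 1 + 2 \<epsilon> for summability over r;
  the square root gives 3/2 + \<epsilon>.\<close>

theorem gal_koksma:
  fixes S :: "nat \<Rightarrow> 'a \<Rightarrow> real"
  assumes [measurable]: "\<And>n. S n \<in> borel_measurable M"
    and K: "0 \<le> K"
    and le: "\<And>a n. (\<integral>\<^sup>+x. ennreal ((S (a + n) x - S a x)^2) \<partial>M) \<le> ennreal (K * real n)"
    and S0: "\<And>x. S 0 x = 0"
    and \<epsilon>: "0 < \<epsilon>"
  shows "AE x in M. \<forall>\<^sub>F n in sequentially. \<bar>S n x\<bar> \<le> real n powr (1/2) * ln (real n) powr (3/2 + \<epsilon>)"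
proof -
  define e where "e = 3 + 2 * \<epsilon>"
  define Y where "Y r x = dyadic_sq (\<lambda>n. S n x) r 0 * ((real r + 1) / (2^r * (real r + 1) powr e))" for r x
  note dy = nn_integral_dyadic_sq_le[OF assms(1) K le]
  have [measurable]: "(\<lambda>x. dyadic_sq (\<lambda>n. S n x) r a) \<in> borel_measurable M" for r a using dy by blast
  have "AE x in M. (\<lambda>r. Y r x) \<longlonglongrightarrow> 0"
  proof (rule AE_tendsto_0_if_summable_moments)
    show "Y r \<in> borel_measurable M" for r unfolding Y_def by measurable
    show "0 \<le> Y r x" for r x by (simp add: Y_def dyadic_sq_nonneg)
    show "(\<integral>\<^sup>+x. ennreal (Y r x) \<partial>M) \<le> ennreal (K * (real r + 1) powr (- 1 - 2 * \<epsilon>))" for r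
    proof -
      have "(\<integral>\<^sup>+x. ennreal (Y r x) \<partial>M) = (\<integral>\<^sup>+x. ennreal (dyadic_sq (\<lambda>n. S n x) r 0) \<partial>M) *
          ennreal ((real r + 1) / (2^r * (real r + 1) powr e))"
      proof -
        have "ennreal (Y r x) = ennreal (dyadic_sq (\<lambda>n. S n x) r 0) *
            ennreal ((real r + 1) / (2^r * (real r + 1) powr e))" for x
          unfolding Y_def by (rule ennreal_mult) (auto simp: dyadic_sq_nonneg)
        then show ?thesis by (simp only:) (rule nn_integral_multc, measurable)
      qed
      also have "\<dots> \<le> ennreal (K * (real r + 1) * 2^r) * ennreal ((real r + 1) / (2^r * (real r + 1) powr e))"
        using dy by (intro mult_right_mono) auto
      also have "\<dots> = ennreal (K * (real r + 1) * 2^r * ((real r + 1) / (2^r * (real r + 1) powr e)))"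
        using K by (intro ennreal_mult[symmetric]) auto
      also have "K * (real r + 1) * 2^r * ((real r + 1) / (2^r * (real r + 1) powr e)) =
          K * ((real r + 1) powr 2 / (real r + 1) powr e)"
        by (simp add: power2_eq_square)
      also have "(real r + 1) powr 2 / (real r + 1) powr e = (real r + 1) powr (- 1 - 2 * \<epsilon>)"
      proof -
        have "- 1 - 2 * \<epsilon> = 2 - e" by (simp add: e_def)
        then show ?thesis by (simp only: powr_diff)
      qed
      finally show ?thesis .
    qed
    have "summable (\<lambda>r. real (Suc r) powr (- 1 - 2 * \<epsilon>))"
      using \<epsilon> by (subst summable_Suc_iff) (simp add: summable_real_powr_iff)
    then show "summable (\<lambda>r. K * (real r + 1) powr (- 1 - 2 * \<epsilon>))"
      by (intro summable_mult) (simp add: add.commute)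
    show "0 \<le> K * (real r + 1) powr (- 1 - 2 * \<epsilon>)" for r using K by simp
  qed
  then show ?thesis
  proof eventually_elim
    case (elim x)
    \<comment> \<open>Chosen to absorb the losses 2^r <= 2 n and r + 1 <= 3 ln n, so that the final
      bound holds with constant 1.\<close>
    define c where "c = 1 / (2 * 3 powr e)"
    have "c > 0" by (simp add: c_def)
    then have "\<forall>\<^sub>F r in sequentially. Y r x < c" using elim by (intro order_tendstoD)
    then obtain R where R: "\<And>r. r \<ge> R \<Longrightarrow> Y r x < c" by (auto simp: eventually_sequentially)
    show ?case
    \<comment> \<open>n >= 8 gives log2 n >= 3, hence log2 n + 2 <= (5/3) log2 n; n >= 2^R gives r
      >= R.\<close>
    proof (rule eventually_sequentiallyI[of "max 8 (2^R)"])
      fix n :: nat assume n: "max 8 (2^R) \<le> n"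
      define r where "r = nat \<lceil>log 2 (real n)\<rceil>"
      have l0: "3 \<le> log 2 (real n)" using n by (simp add: le_log_iff)
      have rr: "log 2 (real n) \<le> real r" "real r \<le> log 2 (real n) + 1" using l0 unfolding r_def by linarith+
      have "real n = 2 powr (log 2 (real n))" using n by simp
      also have "\<dots> \<le> 2 powr real r" using rr by (intro powr_mono) auto
      finally have n_le: "real n \<le> 2^r" by (simp add: powr_realpow)
      have "2^r = 2 powr real r" by (simp add: powr_realpow)
      also have "\<dots> \<le> 2 powr (log 2 (real n) + 1)" using rr by (intro powr_mono) auto
      also have "\<dots> = 2 * real n" using n by (simp add: powr_add)
      finally have le_n: "2^r \<le> 2 * real n" .
      have "R \<le> log 2 (real n)" using n by (simp add: le_log_iff powr_realpow)
      then have "R \<le> r" using rr by linarith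
      have "real r + 1 \<le> log 2 (real n) + 2" using rr by simp
      also have "\<dots> \<le> (5/3) * log 2 (real n)" using l0 by simp
      also have "\<dots> = ((5/3) / ln 2) * ln (real n)" by (simp add: log_def)
      also have "\<dots> \<le> 3 * ln (real n)"
        using n ln2_ge_two_thirds by (intro mult_right_mono) (auto simp: divide_le_eq)
      finally have r_le: "real r + 1 \<le> 3 * ln (real n)" .
      have "(S n x)^2 \<le> (real r + 1) * dyadic_sq (\<lambda>n. S n x) r 0"
        using increment_le_dyadic_sq[of n r "\<lambda>n. S n x" 0] n_le S0 by simp
      also have "\<dots> = Y r x * (2^r * (real r + 1) powr e)" by (simp add: Y_def)
      also have "\<dots> \<le> c * ((2 * real n) * (3 * ln (real n)) powr e)"
        using R[OF \<open>R \<le> r\<close>] le_n r_le \<open>c > 0\<close> \<epsilon>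
        by (intro mult_mono powr_mono2) (auto simp: Y_def dyadic_sq_nonneg e_def)
      also have "\<dots> = real n * ln (real n) powr e" using n by (simp add: c_def powr_mult)
      also have "\<dots> = (real n powr (1/2) * ln (real n) powr (3/2 + \<epsilon>))^2"
        using n by (simp add: power_mult_distrib powr_power e_def)
      finally show "\<bar>S n x\<bar> \<le> real n powr (1/2) * ln (real n) powr (3/2 + \<epsilon>)"
        by (intro power2_le_imp_le[of "\<bar>S n x\<bar>"]) auto
    qed
  qed
qed

section \<open>Logarithms along Gauss orbits\<close>

lemma nn_integral_gauss_invariant:
  fixes g :: "real \<Rightarrow> ennreal"
  assumes [measurable]: "g \<in> borel_measurable borel"
  shows "(\<integral>\<^sup>+x. g ((gauss_map ^^ n) x) \<partial>gauss_measure) = (\<integral>\<^sup>+x. g x \<partial>gauss_measure)"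
proof (induction n)
  case (Suc n)
  let ?g = "\<lambda>x. g ((gauss_map ^^ n) x)"
  have one: "transfer (\<lambda>_. 1) y = 1" if "0 < y" for y
    using branch_weight_sums_1[OF that] by (simp add: transfer_def sums_iff)
  have "(\<integral>\<^sup>+x. g ((gauss_map ^^ Suc n) x) \<partial>gauss_measure) = (\<integral>\<^sup>+x. ennreal 1 * ?g (gauss_map x) \<partial>gauss_measure)"
    by (simp add: funpow_swap1)
  also have "\<dots> = (\<integral>\<^sup>+y. ennreal (transfer (\<lambda>_. 1) y) * ?g y \<partial>gauss_measure)"
    using branch_weight_sums_1 by (intro nn_integral_transfer_step) (auto simp: sums_iff)
  also have "\<dots> = (\<integral>\<^sup>+y. ?g y \<partial>gauss_measure)"
    using AE_gauss_unit by (intro nn_integral_cong_AE, eventually_elim) (simp add: one)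
  finally show ?case using Suc by simp
qed simp

lemma AE_gauss_iter_nonneg:
  assumes "\<And>t. 0 < t \<Longrightarrow> t < 1 \<Longrightarrow> 0 \<le> f t"
  shows "AE x in gauss_measure. (0::real) \<le> f ((gauss_map ^^ i) x)"
  using AE_gauss_irrat01 by eventually_elim (intro assms gauss_iter_bounds)

text \<open>Invariance moves time i to 0, and mixing is applied with g = f. The exponent is j - i -
  1 since the first of the j - i applications of the operator is spent on reaching a Lipschitz
  function.\<close>

lemma gauss_covariance:
  assumes [measurable]: "f \<in> borel_measurable borel"
    and f0: "\<And>t. 0 < t \<Longrightarrow> t < 1 \<Longrightarrow> 0 \<le> f t"
    and s: "\<And>y. 0 < y \<Longrightarrow> y < 1 \<Longrightarrow> summable (\<lambda>k. branch_weight k y * f (branch k y))"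
    and lip: "L-lipschitz_on {0<..<1} (transfer f)"
    and m: "(\<integral>\<^sup>+x. ennreal (f x) \<partial>gauss_measure) = ennreal m" "0 \<le> m"
    and ij: "i < j"
  shows "(\<integral>\<^sup>+x. ennreal (f ((gauss_map ^^ i) x) * f ((gauss_map ^^ j) x)) \<partial>gauss_measure)
      \<le> ennreal ((m + L * (7/8) ^ (j - i - 1)) * m)"
proof -
  define k where "k = j - i - 1"
  have j: "j = Suc k + i" using ij by (simp add: k_def)
  have nn: "AE x in gauss_measure. 0 \<le> f ((gauss_map ^^ i) x)"
    by (intro AE_gauss_iter_nonneg f0)
  have "(\<integral>\<^sup>+x. ennreal (f ((gauss_map ^^ i) x) * f ((gauss_map ^^ j) x)) \<partial>gauss_measure) =
      (\<integral>\<^sup>+x. (\<lambda>x. ennreal (f x) * ennreal (f ((gauss_map ^^ Suc k) x))) ((gauss_map ^^ i) x) \<partial>gauss_measure)"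
    using nn unfolding j funpow_add o_def
    by (intro nn_integral_cong_AE, eventually_elim) (simp only: ennreal_mult')
  also have "\<dots> = (\<integral>\<^sup>+x. ennreal (f x) * ennreal (f ((gauss_map ^^ Suc k) x)) \<partial>gauss_measure)"
    by (rule nn_integral_gauss_invariant) measurable
  also have "\<dots> \<le> ennreal (m + L * (7/8)^k) * ennreal m"
    unfolding m(1)[symmetric] by (rule gauss_mixing[OF _ _ f0 s lip m]) measurable
  also have "\<dots> = ennreal ((m + L * (7/8)^k) * m)"
    using m(2) lipschitz_on_nonneg[OF lip] by (intro ennreal_mult[symmetric]) auto
  finally show ?thesis by (simp only: k_def)
qed

text \<open>The factor 16 is 2 / (1 - 7/8).\<close>

lemma gauss_second_moment:
  assumes [measurable]: "f \<in> borel_measurable borel"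
    and f0: "\<And>t. 0 < t \<Longrightarrow> t < 1 \<Longrightarrow> 0 \<le> f t"
    and s: "\<And>y. 0 < y \<Longrightarrow> y < 1 \<Longrightarrow> summable (\<lambda>k. branch_weight k y * f (branch k y))"
    and lip: "L-lipschitz_on {0<..<1} (transfer f)"
    and m: "(\<integral>\<^sup>+x. ennreal (f x) \<partial>gauss_measure) = ennreal m" "0 \<le> m"
    and sq: "(\<integral>\<^sup>+x. ennreal ((f x)^2) \<partial>gauss_measure) \<le> ennreal v" "0 \<le> v"
    and J: "finite J"
  shows "(\<integral>\<^sup>+x. ennreal (((\<Sum>i\<in>J. f ((gauss_map ^^ i) x)) - real (card J) * m)^2) \<partial>gauss_measure) \<le>
    ennreal (real (card J) * (v + 16 * L * m))"
proof -
  have "(\<integral>\<^sup>+x. ennreal (((\<Sum>i\<in>J. f ((gauss_map ^^ i) x)) - real (card J) * m)^2) \<partial>gauss_measure) \<le>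
    ennreal (real (card J) * (v + 2 / (1 - 7/8) * L * m))"
  proof (rule prob_space.second_moment_sum_le[OF prob_space_gauss_measure])
    show "(\<integral>\<^sup>+x. ennreal (f ((gauss_map ^^ i) x)) \<partial>gauss_measure) = ennreal m" for i
      using nn_integral_gauss_invariant[of "\<lambda>x. ennreal (f x)" i] m by simp
    show "(\<integral>\<^sup>+x. ennreal ((f ((gauss_map ^^ i) x))^2) \<partial>gauss_measure) \<le> ennreal v" for i
      using nn_integral_gauss_invariant[of "\<lambda>x. ennreal ((f x)^2)" i] sq by simp
  qed (use AE_gauss_iter_nonneg[OF f0] gauss_covariance[OF assms(1) f0 s lip m] m sq J
      lipschitz_on_nonneg[OF lip] in auto)
  then show ?thesis by simp
qed

text \<open>The antiderivative enters through one-sided limits because logarithmic integrands are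
  unbounded at 0.\<close>

lemma nn_integral_FTC_unit:
  fixes f F :: "real \<Rightarrow> real"
  assumes "\<And>x. 0 < x \<Longrightarrow> x < 1 \<Longrightarrow> (F has_real_derivative f x) (at x)"
    and "\<And>x. 0 < x \<Longrightarrow> x < 1 \<Longrightarrow> isCont f x"
    and "\<And>x. 0 < x \<Longrightarrow> x < 1 \<Longrightarrow> 0 \<le> f x"
    and "(F \<longlongrightarrow> A) (at_right 0)" "(F \<longlongrightarrow> B) (at_left 1)"
  shows "(\<integral>\<^sup>+x. ennreal (f x) * indicator {0<..<1} x \<partial>lborel) = ennreal (B - A)"
proof -
  have e: "einterval 0 1 = {0<..<1}" by (auto simp: einterval_def)
  have lim: "((F \<circ> real_of_ereal) \<longlongrightarrow> A) (at_right 0)" "((F \<circ> real_of_ereal) \<longlongrightarrow> B) (at_left 1)"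
    using assms(4,5) unfolding zero_ereal_def one_ereal_def by (auto simp: ereal_tendsto_simps)
  note ftc = interval_integral_FTC_nonneg[of 0 1 F f A B, OF _ _ _ _ lim]
  have si: "set_integrable lborel {0<..<1} f"
    using ftc(1) assms(1-3) unfolding e by (auto simp: ereal_less)
  have "(LBINT x=0..1. f x) = B - A" using ftc(2) assms(1-3) by (auto simp: ereal_less)
  then have "(LBINT x:{0<..<1}. f x) = B - A"
    by (simp add: interval_lebesgue_integral_def e)
  then have "integral\<^sup>L lborel (\<lambda>x. indicator {0<..<1} x * f x) = B - A"
    by (simp add: set_lebesgue_integral_def)
  moreover have "(\<integral>\<^sup>+x. ennreal (indicator {0<..<1} x * f x) \<partial>lborel) =
      ennreal (integral\<^sup>L lborel (\<lambda>x. indicator {0<..<1} x * f x))"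
    using si assms(3) by (intro nn_integral_eq_integral) (auto simp: set_integrable_def indicator_def)
  moreover have "ennreal (f x) * indicator {0<..<1} x = ennreal (indicator {0<..<1} x * f x)" for x
    by (simp add: indicator_def)
  ultimately show ?thesis by simp
qed

text \<open>Two consecutive powers are subtracted so that these integrals are the nonnegative terms
  of the paired series for - ln x / (1 + x).\<close>

lemma nn_integral_ln_times_power_diff:
  "(\<integral>\<^sup>+x. ennreal (- ln x * (x^p - x^Suc p)) * indicator {0<..<1} x \<partial>lborel) =
    ennreal (1 / (real p + 1)^2 - 1 / (real p + 2)^2)"
proof -
  \<comment> \<open>An antiderivative of - ln x times x^q. The product x ln x is kept as a factor,
    so that its limit 0 at 0 settles every q, including q = 0.\<close>
  define G where "G q x = (1 / (real q + 1))^2 * x^Suc q - 1 / (real q + 1) * (x^q * (x * ln x))"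
    for q and x :: real
  have dG: "(G q has_real_derivative - ln x * x^q) (at x)" if "0 < x" for q x
  proof -
    define c where "c = 1 / (real q + 1)"
    have c: "c * real (Suc q) = 1" by (simp add: c_def)
    have "((\<lambda>x. c^2 * x^Suc q - c * (x^Suc q * ln x)) has_real_derivative
        c^2 * (real (Suc q) * x^q) - c * (real (Suc q) * x^q * ln x + x^Suc q * (1 / x))) (at x)"
      using that by (auto intro!: derivative_eq_intros simp del: power_Suc)
    also have "c^2 * (real (Suc q) * x^q) - c * (real (Suc q) * x^q * ln x + x^Suc q * (1 / x)) =
        c * (c * real (Suc q)) * x^q - (c * real (Suc q)) * x^q * ln x - c * x^q"
      using that by (simp add: power2_eq_square algebra_simps)
    also have "\<dots> = - ln x * x^q" unfolding c by simp
    finally show ?thesis unfolding G_def c_def by (simp add: mult_ac)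
  qed
  have xlnx: "((\<lambda>x::real. x * ln x) \<longlongrightarrow> 0) (at_right 0)" by real_asymp
  have G0: "(G q \<longlongrightarrow> 0) (at_right 0)" for q
  proof -
    have "(G q \<longlongrightarrow> (1 / (real q + 1))^2 * 0^Suc q - 1 / (real q + 1) * (0^q * 0)) (at_right 0)"
      unfolding G_def by (intro tendsto_intros xlnx) auto
    then show ?thesis by simp
  qed
  have G1: "(G q \<longlongrightarrow> 1 / (real q + 1)^2) (at_left 1)" for q
  proof -
    have "(G q \<longlongrightarrow> (1 / (real q + 1))^2 * 1^Suc q - 1 / (real q + 1) * (1^q * (1 * ln 1))) (at_left 1)"
      unfolding G_def by (intro tendsto_intros) auto
    then show ?thesis by (simp add: power_divide)
  qed
  have "(\<integral>\<^sup>+x. ennreal (- ln x * (x^p - x^Suc p)) * indicator {0<..<1} x \<partial>lborel) =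
      ennreal ((1 / (real p + 1)^2 - 1 / (real (Suc p) + 1)^2) - (0 - 0))"
  proof (rule nn_integral_FTC_unit[where F = "\<lambda>x. G p x - G (Suc p) x"])
    show "((\<lambda>x. G p x - G (Suc p) x) has_real_derivative - ln x * (x^p - x^Suc p)) (at x)"
      if "0 < x" "x < 1" for x
      unfolding right_diff_distrib by (intro DERIV_diff dG that)
    show "0 \<le> - ln x * (x^p - x^Suc p)" if "0 < x" "x < 1" for x :: real
      using that by (intro mult_nonneg_nonneg) (auto simp: mult_left_le_one_le)
    show "isCont (\<lambda>x. - ln x * (x^p - x^Suc p)) x" if "0 < x" "x < 1" for x :: real
      using that by (intro continuous_intros) auto
  qed (intro tendsto_diff G0 G1)+
  then show ?thesis by (simp add: add_ac)
qed

text \<open>The terms with even denominator make up a quarter of \<pi>^2 / 6; subtracting them twice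
  leaves half.\<close>

lemma alternating_inverse_squares_sums:
  "(\<lambda>n. 1 / (real (2 * n) + 1)^2 - 1 / (real (2 * n) + 2)^2) sums (pi^2 / 12)"
proof -
  define a where "a n = 1 / (real n + 1)^2" for n :: nat
  have a: "a sums (pi^2 / 6)" using inverse_squares_sums by (simp add: a_def[abs_def] add.commute)
  have "(\<lambda>n. \<Sum>i = n * 2..<n * 2 + 2. a i) sums (pi^2 / 6)" by (rule sums_group[OF a]) simp
  moreover have "(\<Sum>i = n * 2..<n * 2 + 2. a i) = a (2 * n) + a (2 * n + 1)" for n
    by (simp add: mult.commute numeral_2_eq_2)
  ultimately have 1: "(\<lambda>n. a (2 * n) + a (2 * n + 1)) sums (pi^2 / 6)" by simp
  have "(\<lambda>n. (1/2) * a n) sums ((1/2) * (pi^2 / 6))" by (intro sums_mult a)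
  moreover have "(1/2) * a n = 2 * a (2 * n + 1)" for n
    by (simp add: a_def power2_eq_square divide_simps) (simp add: algebra_simps)
  ultimately have "(\<lambda>n. 2 * a (2 * n + 1)) sums ((1/2) * (pi^2 / 6))" by (simp only:)
  from sums_diff[OF 1 this] have "(\<lambda>n. a (2 * n) - a (2 * n + 1)) sums (pi^2 / 6 - (1/2) * (pi^2 / 6))"
    by simp
  then show ?thesis by (simp add: a_def add_ac)
qed

text \<open>Expand 1 / (1 + x) as the sum of x^(2n) - x^(2n+1). Grouping in pairs keeps all terms
  nonnegative, so the series is integrated termwise without a convergence argument at x = 1.\<close>

lemma nn_integral_gauss_ln:
  "(\<integral>\<^sup>+x. ennreal (- ln x) \<partial>gauss_measure) = ennreal (pi^2 / (12 * ln 2))"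
proof -
  have geo: "(\<lambda>n. - ln x * (x^(2 * n) - x^Suc (2 * n))) sums (- ln x * (1 / (1 + x)))"
    if "0 < x" "x < 1" for x :: real
  proof (rule sums_mult)
    have "x^2 < 1" using that by (simp add: power_less_one_iff)
    then have "(\<lambda>n. (1 - x) * (x^2)^n) sums ((1 - x) * (1 / (1 - x^2)))"
      by (intro sums_mult geometric_sums) auto
    moreover have "(1 - x) * (1 / (1 - x^2)) = 1 / (1 + x)"
      using that by (simp add: power2_eq_square divide_simps square_eq_1_iff) (simp add: algebra_simps)
    moreover have "(1 - x) * (x^2)^n = x^(2 * n) - x^Suc (2 * n)" for n
      by (simp only: power_Suc power_mult left_diff_distrib mult_1_left)
    ultimately show "(\<lambda>n. x^(2 * n) - x^Suc (2 * n)) sums (1 / (1 + x))"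
      by (simp only:)
  qed
  have "(\<integral>\<^sup>+x. ennreal (- ln x) \<partial>gauss_measure) =
      (\<integral>\<^sup>+x. ennreal (1 / (ln 2 * (1 + x))) * ennreal (- ln x) * indicator {0<..<1} x \<partial>lborel)"
    by (rule nn_integral_gauss) measurable
  also have "\<dots> = (\<integral>\<^sup>+x. ennreal (1 / ln 2) * (\<Sum>n. ennreal (- ln x * (x^(2 * n) - x^Suc (2 * n))) * indicator {0<..<1} x) \<partial>lborel)"
  proof (intro nn_integral_cong)
    fix x :: real
    show "ennreal (1 / (ln 2 * (1 + x))) * ennreal (- ln x) * indicator {0<..<1} x =
      ennreal (1 / ln 2) * (\<Sum>n. ennreal (- ln x * (x^(2 * n) - x^Suc (2 * n))) * indicator {0<..<1} x)"
    proof (cases "0 < x \<and> x < 1")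
      case True
      have "(\<Sum>n. ennreal (- ln x * (x^(2 * n) - x^Suc (2 * n)))) = ennreal (\<Sum>n. - ln x * (x^(2 * n) - x^Suc (2 * n)))"
        using True geo[of x] by (intro suminf_ennreal2 mult_nonneg_nonneg) (auto simp: mult_left_le_one_le sums_iff)
      also have "\<dots> = ennreal (- ln x * (1 / (1 + x)))" using geo[of x] True by (simp add: sums_iff)
      finally show ?thesis using True
        by (simp add: ennreal_mult'[symmetric] ennreal_mult[symmetric] mult_ac del: power_Suc)
    qed auto
  qed
  also have "\<dots> = ennreal (1 / ln 2) * (\<integral>\<^sup>+x. (\<Sum>n. ennreal (- ln x * (x^(2 * n) - x^Suc (2 * n))) * indicator {0<..<1} x) \<partial>lborel)"
    by (rule nn_integral_cmult) measurable
  also have "(\<integral>\<^sup>+x. (\<Sum>n. ennreal (- ln x * (x^(2 * n) - x^Suc (2 * n))) * indicator {0<..<1} x) \<partial>lborel) =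
      (\<Sum>n. \<integral>\<^sup>+x. ennreal (- ln x * (x^(2 * n) - x^Suc (2 * n))) * indicator {0<..<1} x \<partial>lborel)"
    by (rule nn_integral_suminf) measurable
  also have "\<dots> = (\<Sum>n. ennreal (1 / (real (2 * n) + 1)^2 - 1 / (real (2 * n) + 2)^2))"
    by (simp only: nn_integral_ln_times_power_diff)
  also have "\<dots> = ennreal (pi^2 / 12)"
    unfolding sums_unique[OF alternating_inverse_squares_sums]
    by (intro suminf_ennreal2 sums_summable[OF alternating_inverse_squares_sums])
      (auto intro!: divide_left_mono power_mono)
  also have "ennreal (1 / ln 2) * ennreal (pi^2 / 12) = ennreal (pi^2 / (12 * ln 2))"
    by (subst ennreal_mult[symmetric]) auto
  finally show ?thesis .
qed

lemma nn_integral_gauss_ln_square: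
  "(\<integral>\<^sup>+x. ennreal ((- ln x)^2) \<partial>gauss_measure) \<le> ennreal (2 / ln 2)"
proof -
  define F where "F x = x * (ln x)^2 - 2 * (x * ln x) + 2 * x" for x :: real
  have "(\<integral>\<^sup>+x. ennreal ((- ln x)^2) \<partial>gauss_measure) =
      (\<integral>\<^sup>+x. ennreal (1 / (ln 2 * (1 + x))) * ennreal ((- ln x)^2) * indicator {0<..<1} x \<partial>lborel)"
    by (rule nn_integral_gauss) measurable
  also have "\<dots> \<le> (\<integral>\<^sup>+x. ennreal (1 / ln 2) * (ennreal ((ln x)^2) * indicator {0<..<1} x) \<partial>lborel)"
  proof (intro nn_integral_mono)
    fix x :: real
    show "ennreal (1 / (ln 2 * (1 + x))) * ennreal ((- ln x)^2) * indicator {0<..<1} x \<le>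
        ennreal (1 / ln 2) * (ennreal ((ln x)^2) * indicator {0<..<1} x)"
    proof (cases "0 < x \<and> x < 1")
      case True
      then have "1 / (ln 2 * (1 + x)) \<le> 1 / (ln 2 * 1)"
        by (intro divide_left_mono mult_left_mono mult_pos_pos) auto
      then show ?thesis using True by (auto intro!: mult_right_mono ennreal_leI)
    qed auto
  qed
  also have "\<dots> = ennreal (1 / ln 2) * (\<integral>\<^sup>+x. ennreal ((ln x)^2) * indicator {0<..<1} x \<partial>lborel)"
    by (rule nn_integral_cmult) measurable
  also have "(\<integral>\<^sup>+x. ennreal ((ln x)^2) * indicator {0<..<1} x \<partial>lborel) = ennreal (2 - 0)"
  proof (rule nn_integral_FTC_unit[where F = F])
    show "(F has_real_derivative (ln x)^2) (at x)" if "0 < x" "x < 1" for x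
      unfolding F_def using that
      by (auto intro!: derivative_eq_intros simp: power2_eq_square field_simps)
    show "isCont (\<lambda>x. (ln x)^2) x" if "0 < x" "x < 1" for x :: real
      using that by (intro continuous_intros) auto
    show "(F \<longlongrightarrow> 0) (at_right 0)" unfolding F_def by real_asymp
    show "(F \<longlongrightarrow> 2) (at_left 1)" unfolding F_def by real_asymp
  qed auto
  also have "ennreal (1 / ln 2) * ennreal (2 - 0) = ennreal (2 / ln 2)"
    by (subst ennreal_mult[symmetric]) auto
  finally show ?thesis .
qed

section \<open>Logarithms under the transfer operator\<close>

lemma ln_branch: "0 < y \<Longrightarrow> - ln (branch k y) = ln (real k + 1 + y)"
  by (simp add: branch_def ln_div)

lemma transfer_ln_summable:
  assumes "0 < y"
  shows "summable (\<lambda>k. branch_weight k y * (- ln (branch k y)))"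
proof (rule summable_comparison_test_bigo)
  show "summable (\<lambda>k. norm (real k powr (- (3/2))))" by (simp add: summable_real_powr_iff)
  show "(\<lambda>k. branch_weight k y * (- ln (branch k y))) \<in> O(\<lambda>k. real k powr (- (3/2)))"
    unfolding ln_branch[OF assms] branch_weight_def by real_asymp
qed

lemma sum_inverse_squares_le: "(\<Sum>k<n. 1 / (real k + 2)^2) \<le> 1"
proof -
  have "1 / (real k + 2)^2 \<le> 1 / (real k + 1) - 1 / (real (Suc k) + 1)" for k
  proof -
    have "1 / (real k + 2)^2 \<le> 1 / ((real k + 1) * (real k + 2))"
      by (intro divide_left_mono) (auto simp: power2_eq_square)
    also have "\<dots> = 1 / (real k + 1) - 1 / (real (Suc k) + 1)" by (simp add: divide_simps)
    finally show ?thesis .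
  qed
  then have "(\<Sum>k<n. 1 / (real k + 2)^2) \<le> (\<Sum>k<n. 1 / (real k + 1) - 1 / (real (Suc k) + 1))"
    by (intro sum_mono)
  also have "\<dots> = 1 / (real 0 + 1) - 1 / (real n + 1)" by (rule sum_lessThan_telescope')
  finally show ?thesis by (simp add: order_trans)
qed

lemma ln_diff_le_inverse:
  fixes a b c :: real
  assumes "1 \<le> c" "0 < a" "0 < b"
  shows "\<bar>ln (c + a) - ln (c + b)\<bar> \<le> 1 / c * \<bar>a - b\<bar>"
proof -
  have *: "ln (c + a) - ln (c + b) \<le> 1 / c * (a - b)" "0 \<le> ln (c + a) - ln (c + b)" if "b \<le> a" "0 < a" "0 < b" for a b
  proof -
    have "0 < c + b" using that assms by linarith
    then have "1 + (a - b) / (c + b) = (c + a) / (c + b)" by (simp add: field_simps)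
    then have "ln (c + a) - ln (c + b) = ln (1 + (a - b) / (c + b))"
      using that assms by (simp add: ln_div)
    also have "\<dots> \<le> (a - b) / (c + b)" using that assms by (intro ln_add_one_self_le_self) auto
    also have "\<dots> \<le> (a - b) / c" using that assms by (intro divide_left_mono) auto
    finally show "ln (c + a) - ln (c + b) \<le> 1 / c * (a - b)" by simp
    show "0 \<le> ln (c + a) - ln (c + b)" using that assms by simp
  qed
  show ?thesis using *[of a b] *[of b a] assms by (cases "b \<le> a") (auto simp: abs_if)
qed

text \<open>On branch k the function is ln (k + 1 + y): it is 1-Lipschitz in y and its increment in
  k is at most 1 / (k + 1). The two parts of the estimate contribute 1 each, the second through the
  sum of 1 / (k + 2)^2.\<close>

lemma transfer_ln_lipschitz: "2-lipschitz_on {0<..<1} (transfer (\<lambda>x. - ln x))"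
proof (rule lipschitz_onI)
  fix y z :: real assume yz: "y \<in> {0<..<1}" "z \<in> {0<..<1}"
  then have pos: "0 < y" "0 < z" by auto
  have "\<bar>(\<Sum>k. branch_weight k y * (- ln (branch k y))) - (\<Sum>k. branch_weight k z * (- ln (branch k z)))\<bar>
      \<le> (1 + 1) * \<bar>y - z\<bar>"
  proof (rule lipschitz_weighted_sum[where A = "\<lambda>k. 1" and B = "\<lambda>k. 1 / (real k + 1)"
      and F = "\<lambda>k y. - ln (branch k y)", OF pos])
    show "\<bar>- ln (branch k y) - - ln (branch k z)\<bar> \<le> 1 * \<bar>y - z\<bar>" for k
    proof -
      have "\<bar>ln (real k + 1 + y) - ln (real k + 1 + z)\<bar> \<le> 1 / (real k + 1) * \<bar>y - z\<bar>"
        using pos by (intro ln_diff_le_inverse) auto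
      also have "\<dots> \<le> 1 * \<bar>y - z\<bar>" by (intro mult_right_mono) auto
      finally show ?thesis using ln_branch[of y k] ln_branch[of z k] pos by simp
    qed
    show "\<bar>- ln (branch (Suc k) z) - - ln (branch k z)\<bar> \<le> 1 / (real k + 1)" for k
      using ln_diff_le_inverse[of "real k + 1" "1 + z" z] ln_branch[of z k] ln_branch[of z "Suc k"] pos
      by (simp add: add_ac)
    show "(\<Sum>k<n. branch_weight k y * 1) \<le> 1" for n
      using sum_branch_weight_le_1[OF pos(1), of n] by simp
    show "(\<Sum>k<n. 1 / (real k + 1) * ((real k + 1) / (real k + 2)^2)) \<le> 1" for n
      using sum_inverse_squares_le[of n] by simp
    show "(\<lambda>n. - ln (branch n z) / (real n + 1)) \<longlonglongrightarrow> 0"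
      unfolding ln_branch[OF pos(2)] by real_asymp
  qed (intro transfer_ln_summable pos)+
  then show "dist (transfer (\<lambda>x. - ln x) y) (transfer (\<lambda>x. - ln x) z) \<le> 2 * dist y z"
    by (simp add: transfer_def dist_real_def)
qed simp

text \<open>The mean of - ln x, which is Levy's limit of (ln q_n) / n almost everywhere.\<close>

definition levy_const :: real where
  "levy_const = pi^2 / (12 * ln 2)"

lemma levy_const_pos: "0 < levy_const"
  by (simp add: levy_const_def)

theorem log_sum_deviation:
  assumes "0 < \<epsilon>"
  shows "AE x in gauss_measure. \<forall>\<^sub>F n in sequentially.
    \<bar>(\<Sum>k<n. - ln ((gauss_map ^^ k) x)) - real n * levy_const\<bar>
      \<le> real n powr (1/2) * ln (real n) powr (3/2 + \<epsilon>)"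
\<comment> \<open>K is v + 16 L m with second moment v = 2 / ln 2, Lipschitz constant L = 2 and mean
  m = \<open>levy_const\<close>.\<close>
proof (rule gal_koksma[where K = "2 / ln 2 + 16 * 2 * levy_const", OF _ _ _ _ assms])
  show "0 \<le> 2 / ln 2 + 16 * 2 * levy_const" using levy_const_pos by simp
  fix a n :: nat
  have eq: "((\<Sum>k<a + n. - ln ((gauss_map ^^ k) x)) - real (a + n) * levy_const) -
      ((\<Sum>k<a. - ln ((gauss_map ^^ k) x)) - real a * levy_const) =
      (\<Sum>k\<in>{a..<a + n}. - ln ((gauss_map ^^ k) x)) - real (card {a..<a + n}) * levy_const" for x
  proof -
    have split: "{..<a + n} = {..<a} \<union> {a..<a + n}" by auto
    have "(\<Sum>k<a + n. - ln ((gauss_map ^^ k) x)) =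
        (\<Sum>k<a. - ln ((gauss_map ^^ k) x)) + (\<Sum>k\<in>{a..<a + n}. - ln ((gauss_map ^^ k) x))"
      unfolding split by (rule sum.union_disjoint) auto
    then show ?thesis by (simp add: algebra_simps)
  qed
  have "(\<integral>\<^sup>+x. ennreal (((\<Sum>k\<in>{a..<a + n}. - ln ((gauss_map ^^ k) x)) - real (card {a..<a + n}) * levy_const)^2)
      \<partial>gauss_measure) \<le> ennreal (real (card {a..<a + n}) * (2 / ln 2 + 16 * 2 * levy_const))"
    by (rule gauss_second_moment[where f = "\<lambda>x. - ln x"])
      (use transfer_ln_summable transfer_ln_lipschitz nn_integral_gauss_ln nn_integral_gauss_ln_square levy_const_pos
        in \<open>auto simp: levy_const_def\<close>)
  then show "(\<integral>\<^sup>+x. ennreal ((((\<Sum>k<a + n. - ln ((gauss_map ^^ k) x)) - real (a + n) * levy_const) -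
      ((\<Sum>k<a. - ln ((gauss_map ^^ k) x)) - real a * levy_const))^2) \<partial>gauss_measure) \<le>
      ennreal ((2 / ln 2 + 16 * 2 * levy_const) * real n)"
    unfolding eq by (simp add: mult.commute)
qed auto

section \<open>Trimmed sums of partial quotients\<close>

definition trimmed_sum :: "(nat \<Rightarrow> real) \<Rightarrow> nat \<Rightarrow> real" where
  "trimmed_sum a n = (\<Sum>i<n. a i) - Max (insert 0 (a ` {..<n}))"

text \<open>A new term adds a_n to the sum and at most a_n to the maximum.\<close>

lemma trimmed_sum_mono:
  assumes "\<And>i. 0 \<le> a i" "m \<le> n"
  shows "trimmed_sum a m \<le> trimmed_sum a n"
proof (rule lift_Suc_mono_le[of "trimmed_sum a", OF _ assms(2)])
  fix n
  let ?A = "insert 0 (a ` {..<n})"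
  have "insert 0 (a ` {..<Suc n}) = insert (a n) ?A" by (auto simp: lessThan_Suc)
  then have "Max (insert 0 (a ` {..<Suc n})) = max (a n) (Max ?A)"
    by (simp only:) (rule Max_insert; simp)
  moreover have "0 \<le> Max ?A" by (rule Max_ge) auto
  ultimately show "trimmed_sum a n \<le> trimmed_sum a (Suc n)"
    using assms(1)[of n] unfolding trimmed_sum_def sum.lessThan_Suc by linarith
qed

text \<open>If one term exceeds u, it is the maximum: trimming deletes it, truncation replaces it by
  u. If none does, truncation changes nothing and trimming removes at most u.\<close>

lemma trimmed_sum_truncated:
  fixes a :: "nat \<Rightarrow> real"
  assumes a: "\<And>i. 0 \<le> a i" and u: "0 \<le> u"
    and one: "\<And>i j. i < j \<Longrightarrow> j < n \<Longrightarrow> \<not> (u < a i \<and> u < a j)"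
  shows "\<bar>trimmed_sum a n - (\<Sum>i<n. min (a i) u)\<bar> \<le> u"
proof (cases "\<exists>i<n. u < a i")
  case False
  then have le: "a i \<le> u" if "i < n" for i using that by (meson not_less)
  then have "(\<Sum>i<n. min (a i) u) = (\<Sum>i<n. a i)" by (intro sum.cong) auto
  moreover have "0 \<le> Max (insert 0 (a ` {..<n}))" by (rule Max_ge) auto
  moreover have "Max (insert 0 (a ` {..<n})) \<le> u"
    using le u by (intro Max.boundedI) auto
  ultimately show ?thesis by (simp add: trimmed_sum_def)
next
  case True
  then obtain k where k: "k < n" "u < a k" by blast
  have le: "a i \<le> u" if "i < n" "i \<noteq> k" for i
    using one[of i k] one[of k i] that k by (cases "i < k") (auto simp: not_less)
  have "Max (insert 0 (a ` {..<n})) = a k"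
    using k le a u by (intro Max_eqI) (auto intro: order_trans[OF le less_imp_le[OF k(2)]])
  then have "trimmed_sum a n = (\<Sum>i\<in>{..<n} - {k}. a i)"
    using k by (simp add: trimmed_sum_def sum.remove[of "{..<n}" k])
  moreover have "(\<Sum>i<n. min (a i) u) = u + (\<Sum>i\<in>{..<n} - {k}. min (a i) u)"
    using k by (simp add: sum.remove[of "{..<n}" k] min_def)
  moreover have "(\<Sum>i\<in>{..<n} - {k}. min (a i) u) = (\<Sum>i\<in>{..<n} - {k}. a i)"
    using le by (intro sum.cong) (auto simp: min_def)
  ultimately show ?thesis using u by simp
qed

text \<open>\<open>J n\<close> is the last index with t j <= n, so n <= \<open>t (Suc (J n))\<close>
  by maximality. Monotonicity puts D n / \<phi> n between the sampled quotients at
  \<open>J n\<close> and \<open>Suc (J n)\<close>, distorted by a ratio that tends to 1.\<close>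

lemma mono_ratio_interpolate:
  fixes D \<phi> :: "nat \<Rightarrow> real" and t :: "nat \<Rightarrow> nat"
  assumes D: "mono D" and \<phi>: "mono \<phi>" and D0: "\<And>n. 0 \<le> D n" and \<phi>0: "\<And>n. N \<le> n \<Longrightarrow> 0 < \<phi> n"
    and t: "filterlim t at_top sequentially"
    and lim: "(\<lambda>j. D (t j) / \<phi> (t j)) \<longlonglongrightarrow> l"
    and ratio: "(\<lambda>j. \<phi> (t (Suc j)) / \<phi> (t j)) \<longlonglongrightarrow> 1"
  shows "(\<lambda>n. D n / \<phi> n) \<longlonglongrightarrow> l"
proof -
  define J where "J n = Max {j. t j \<le> n}" for n
  have fin: "finite {j. t j \<le> n}" for n
  proof -
    obtain k where "\<And>j. k \<le> j \<Longrightarrow> Suc n \<le> t j"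
      using t unfolding filterlim_at_top eventually_sequentially by meson
    then have "{j. t j \<le> n} \<subseteq> {..<k}" by (auto simp: not_less_eq_eq intro: ccontr) (meson Suc_n_not_le_n le_trans not_le)
    then show ?thesis by (rule finite_subset) simp
  qed
  have J_ge: "k \<le> J n" if "t k \<le> n" for k n
    unfolding J_def using that by (intro Max_ge fin) simp
  have Jt: "t (J n) \<le> n" if "t k \<le> n" for k n
    using Max_in[OF fin, of n] that unfolding J_def by auto
  have Jt': "n \<le> t (Suc (J n))" for n
    using J_ge[of "Suc (J n)" n] by (cases "t (Suc (J n)) \<le> n") auto
  have Jlim: "filterlim J at_top sequentially"
    unfolding filterlim_at_top
  proof
    fix k show "\<forall>\<^sub>F n in sequentially. k \<le> J n"
      using J_ge[of k] by (intro eventually_sequentiallyI[of "t k"]) auto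
  qed
  have S: "filterlim (\<lambda>n. Suc (J n)) at_top sequentially"
    using filterlim_compose[OF filterlim_Suc Jlim] by simp
  have tJ: "filterlim (\<lambda>n. t (J n)) at_top sequentially" by (rule filterlim_compose[OF t Jlim])
  have ev: "\<forall>\<^sub>F n in sequentially. t 0 \<le> n \<and> N \<le> t (J n)"
    using tJ by (auto simp: filterlim_at_top eventually_conj_iff eventually_ge_at_top)
  have r: "(\<lambda>n. \<phi> (t (Suc (J n))) / \<phi> (t (J n))) \<longlonglongrightarrow> 1" by (rule filterlim_compose[OF ratio Jlim])
  have lo: "(\<lambda>n. (D (t (J n)) / \<phi> (t (J n))) / (\<phi> (t (Suc (J n))) / \<phi> (t (J n)))) \<longlonglongrightarrow> l / 1"
    by (intro tendsto_divide r filterlim_compose[OF lim Jlim]) auto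
  have hi: "(\<lambda>n. (D (t (Suc (J n))) / \<phi> (t (Suc (J n)))) * (\<phi> (t (Suc (J n))) / \<phi> (t (J n)))) \<longlonglongrightarrow> l * 1"
    by (intro tendsto_mult r filterlim_compose[OF lim S])
  show ?thesis
  proof (rule tendsto_sandwich)
    show "(\<lambda>n. (D (t (J n)) / \<phi> (t (J n))) / (\<phi> (t (Suc (J n))) / \<phi> (t (J n)))) \<longlonglongrightarrow> l" using lo by simp
    show "(\<lambda>n. (D (t (Suc (J n))) / \<phi> (t (Suc (J n)))) * (\<phi> (t (Suc (J n))) / \<phi> (t (J n)))) \<longlonglongrightarrow> l"
      using hi by simp
    show "\<forall>\<^sub>F n in sequentially. (D (t (J n)) / \<phi> (t (J n))) / (\<phi> (t (Suc (J n))) / \<phi> (t (J n))) \<le> D n / \<phi> n"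
      using ev
    proof eventually_elim
      case (elim n)
      have p: "0 < \<phi> (t (J n))" "0 < \<phi> n" using elim Jt[of 0 n] by (auto intro!: \<phi>0)
      have "\<phi> n \<le> \<phi> (t (Suc (J n)))" by (rule monoD[OF \<phi> Jt'])
      moreover have "D (t (J n)) \<le> D n" using elim by (intro monoD[OF D] Jt[of 0]) auto
      ultimately have "D (t (J n)) / \<phi> (t (Suc (J n))) \<le> D n / \<phi> n"
        using p D0 by (intro frac_le) auto
      then show ?case using p by simp
    qed
    show "\<forall>\<^sub>F n in sequentially. D n / \<phi> n \<le> (D (t (Suc (J n))) / \<phi> (t (Suc (J n)))) * (\<phi> (t (Suc (J n))) / \<phi> (t (J n)))"
      using ev
    proof eventually_elim
      case (elim n)
      have p: "0 < \<phi> (t (J n))" "0 < \<phi> n" using elim Jt[of 0 n] by (auto intro!: \<phi>0)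
      have q: "\<phi> n \<le> \<phi> (t (Suc (J n)))" by (rule monoD[OF \<phi> Jt'])
      have "\<phi> (t (J n)) \<le> \<phi> n" using elim by (intro monoD[OF \<phi>] Jt[of 0]) auto
      moreover have "D n \<le> D (t (Suc (J n)))" by (rule monoD[OF D Jt'])
      ultimately have "D n / \<phi> n \<le> D (t (Suc (J n))) / \<phi> (t (J n))"
        using p D0 by (intro frac_le) auto
      then show ?case using p q by simp
    qed
  qed
qed

section \<open>Moments of the truncated first quotient\<close>

definition truncated_quotient :: "nat \<Rightarrow> real \<Rightarrow> real" where
  "truncated_quotient u x = min (of_int \<lfloor>1 / x\<rfloor>) (real u)"

lemma truncated_quotient_measurable [measurable]:
  "truncated_quotient u \<in> borel_measurable borel"
  unfolding truncated_quotient_def by measurable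

lemma truncated_quotient_nonneg: "0 < x \<Longrightarrow> 0 \<le> truncated_quotient u x"
  by (simp add: truncated_quotient_def)

lemma truncated_quotient_branch:
  "0 < y \<Longrightarrow> y < 1 \<Longrightarrow> truncated_quotient u (branch k y) = min (real k + 1) (real u)"
  by (simp add: truncated_quotient_def floor_inverse_branch)

lemma truncated_quotient_summable:
  "0 < y \<Longrightarrow> y < 1 \<Longrightarrow> summable (\<lambda>k. branch_weight k y * truncated_quotient u (branch k y))"
  by (rule transfer_summable_bounded[where C = "real u"]) (auto simp: truncated_quotient_def)

text \<open>The increments of \<open>min (k + 1) u\<close> in \<open>k\<close> are at most \<open>1\<close> and vanish for \<open>k + 1 \<ge> u\<close>,
  so the Lipschitz constant is bounded by a harmonic sum.\<close>

lemma transfer_truncated_lipschitz: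
  "(ln (real u + 1))-lipschitz_on {0<..<1} (transfer (truncated_quotient u))"
proof (rule lipschitz_onI)
  fix y z :: real assume "y \<in> {0<..<1}" "z \<in> {0<..<1}"
  then have yz: "0 < y" "y < 1" "0 < z" "z < 1" by auto
  note br = truncated_quotient_branch[OF yz(1,2)] truncated_quotient_branch[OF yz(3,4)]
  have "\<bar>(\<Sum>k. branch_weight k y * truncated_quotient u (branch k y)) -
      (\<Sum>k. branch_weight k z * truncated_quotient u (branch k z))\<bar> \<le> (0 + ln (real u + 1)) * \<bar>y - z\<bar>"
  proof (rule lipschitz_weighted_sum[where A = "\<lambda>k. 0" and B = "\<lambda>k. if k < u then 1 else 0"
      and F = "\<lambda>k y. truncated_quotient u (branch k y)", OF yz(1,3)])
    show "(\<Sum>k<n. (if k < u then 1 else 0) * ((real k + 1) / (real k + 2)^2)) \<le> ln (real u + 1)" for n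
    proof -
      define g where "g k = ln (real (min k u) + 1)" for k :: nat
      have "(if k < u then 1 else 0) * ((real k + 1) / (real k + 2)^2) \<le> g (Suc k) - g k" for k
      proof (cases "k < u")
        case True
        have "(real k + 1) / (real k + 2)^2 \<le> 1 / (real k + 2)"
          by (simp add: divide_simps power2_eq_square)
        also have "\<dots> \<le> ln (real k + 2) - ln (real k + 1)"
          using ln_diff_le[of "real k + 1" "real k + 2"] by simp
        finally show ?thesis using True by (simp add: g_def min_def add_ac)
      qed (simp add: g_def min_def)
      then have "(\<Sum>k<n. (if k < u then 1 else 0) * ((real k + 1) / (real k + 2)^2)) \<le> (\<Sum>k<n. g (Suc k) - g k)"
        by (intro sum_mono)
      also have "\<dots> = g n - g 0" by (rule sum_lessThan_telescope)
      also have "\<dots> \<le> ln (real u + 1)" by (simp add: g_def)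
      finally show ?thesis .
    qed
    have "(\<lambda>n. real u / (real n + 1)) \<longlonglongrightarrow> 0" by real_asymp
    then show "(\<lambda>n. truncated_quotient u (branch n z) / (real n + 1)) \<longlonglongrightarrow> 0"
      by (rule Lim_null_comparison[rotated]) (auto simp: br intro!: divide_right_mono always_eventually)
    show "summable (\<lambda>k. branch_weight k y * truncated_quotient u (branch k y))"
      "summable (\<lambda>k. branch_weight k z * truncated_quotient u (branch k z))"
      using yz by (auto intro: truncated_quotient_summable)
  qed (auto simp: br)
  then show "dist (transfer (truncated_quotient u) y) (transfer (truncated_quotient u) z)
      \<le> ln (real u + 1) * dist y z"
    by (simp add: transfer_def dist_real_def)
qed simp

lemma le_floor_inverse_iff:
  assumes "0 < x"
  shows "int j + 1 \<le> \<lfloor>1 / x\<rfloor> \<longleftrightarrow> x \<le> 1 / (real j + 1)"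
proof -
  have "int j + 1 \<le> \<lfloor>1 / x\<rfloor> \<longleftrightarrow> real j + 1 \<le> 1 / x" by (simp add: le_floor_iff)
  also have "\<dots> \<longleftrightarrow> x \<le> 1 / (real j + 1)" using assms by (simp add: field_simps)
  finally show ?thesis .
qed

lemma log_2_1p_nonneg: "0 \<le> t \<Longrightarrow> 0 \<le> log 2 (1 + t)"
  by (subst zero_le_log_cancel_iff) auto

text \<open>Layer-cake formula: a function of a_1 is a sum over thresholds, and a_1 >= j + 1 means x
  <= 1 / (j + 1), an event of Gauss measure log2 (1 + 1 / (j + 1)).\<close>

lemma nn_integral_quotient_layers:
  assumes g: "\<And>x. 0 < x \<Longrightarrow> x < 1 \<Longrightarrow> g x = (\<Sum>j<u. if int j + 1 \<le> \<lfloor>1 / x\<rfloor> then c j else 0)"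
    and c: "\<And>j. 0 \<le> c j"
  shows "(\<integral>\<^sup>+x. ennreal (g x) \<partial>gauss_measure) = ennreal (\<Sum>j<u. c j * log 2 (1 + 1 / (real j + 1)))"
proof -
  have "(\<integral>\<^sup>+x. ennreal (g x) \<partial>gauss_measure) =
      (\<integral>\<^sup>+x. (\<Sum>j<u. ennreal (c j) * indicator {..1 / (real j + 1)} x) \<partial>gauss_measure)"
    using AE_gauss_unit
  proof (intro nn_integral_cong_AE, eventually_elim)
    case (elim x)
    have "ennreal (g x) = (\<Sum>j<u. ennreal (if int j + 1 \<le> \<lfloor>1 / x\<rfloor> then c j else 0))"
      using g c elim by (simp add: sum_ennreal)
    also have "\<dots> = (\<Sum>j<u. ennreal (c j) * indicator {..1 / (real j + 1)} x)"
      using elim by (intro sum.cong) (auto simp: le_floor_inverse_iff indicator_def)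
    finally show ?case .
  qed
  also have "\<dots> = (\<Sum>j<u. ennreal (c j) * emeasure gauss_measure {..1 / (real j + 1)})"
    by (subst nn_integral_sum) (auto simp: nn_integral_cmult_indicator)
  also have "\<dots> = (\<Sum>j<u. ennreal (c j * log 2 (1 + 1 / (real j + 1))))"
    using c by (intro sum.cong) (auto simp: emeasure_gauss_atMost ennreal_mult log_2_1p_nonneg)
  also have "\<dots> = ennreal (\<Sum>j<u. c j * log 2 (1 + 1 / (real j + 1)))"
    using c by (intro sum_ennreal) (auto intro!: mult_nonneg_nonneg log_2_1p_nonneg)
  finally show ?thesis .
qed

lemma sum_layers_min:
  fixes k :: int and c :: "nat \<Rightarrow> real"
  assumes "0 \<le> k"
  shows "(\<Sum>j<u. if int j + 1 \<le> k then c j else 0) = (\<Sum>j<min u (nat k). c j)"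
proof -
  have "(\<Sum>j<u. if int j + 1 \<le> k then c j else 0) = (\<Sum>j\<in>{j \<in> {..<u}. int j + 1 \<le> k}. c j)"
    by (rule sum.inter_filter[symmetric]) simp
  also have "{j \<in> {..<u}. int j + 1 \<le> k} = {..<min u (nat k)}" using assms by auto
  finally show ?thesis .
qed

lemma min_of_int_of_nat:
  assumes "0 \<le> k"
  shows "min (real_of_int k) (real u) = real (min u (nat k))"
  using assms by (elim nonneg_int_cases) (auto simp: min_def)

text \<open>All layers have weight 1 and their measures log2 (j + 2) - log2 (j + 1) telescope. This
  logarithmic growth in u is the source of the factor ln n in the trimmed sums.\<close>

lemma nn_integral_truncated_quotient:
  "(\<integral>\<^sup>+x. ennreal (truncated_quotient u x) \<partial>gauss_measure) = ennreal (log 2 (real u + 1))"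
proof -
  have "(\<integral>\<^sup>+x. ennreal (truncated_quotient u x) \<partial>gauss_measure) =
      ennreal (\<Sum>j<u. 1 * log 2 (1 + 1 / (real j + 1)))"
  proof (rule nn_integral_quotient_layers)
    fix x :: real assume "0 < x" "x < 1"
    then have k: "0 \<le> \<lfloor>1 / x\<rfloor>" by simp
    show "truncated_quotient u x = (\<Sum>j<u. if int j + 1 \<le> \<lfloor>1 / x\<rfloor> then 1 else 0)"
      unfolding sum_layers_min[OF k] by (simp add: truncated_quotient_def min_of_int_of_nat[OF k] del: of_nat_min)
  qed simp
  also have "(\<Sum>j<u. 1 * log 2 (1 + 1 / (real j + 1))) = (\<Sum>j<u. log 2 (real (Suc j) + 1) - log 2 (real j + 1))"
  proof (intro sum.cong refl)
    fix j
    have "1 + 1 / (real j + 1) = (real (Suc j) + 1) / (real j + 1)" by (simp add: field_simps)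
    then show "1 * log 2 (1 + 1 / (real j + 1)) = log 2 (real (Suc j) + 1) - log 2 (real j + 1)"
      by (simp add: log_divide del: of_nat_Suc)
  qed
  also have "\<dots> = log 2 (real u + 1) - log 2 (real 0 + 1)" by (rule sum_lessThan_telescope)
  finally show ?thesis by simp
qed

lemma log_2_1p_le: "0 \<le> t \<Longrightarrow> log 2 (1 + t) \<le> 3/2 * t"
proof -
  assume t: "0 \<le> (t::real)"
  have "log 2 (1 + t) \<le> t / ln 2"
    unfolding log_def using t by (intro divide_right_mono ln_add_one_self_le_self) auto
  also have "\<dots> \<le> t / (2/3)" using t ln2_ge_two_thirds by (intro divide_left_mono) auto
  finally show ?thesis by simp
qed

text \<open>The layer weights 2 j + 1 add up to squares, and each layer has mass at most 3 because
  its measure decays like 1/j; so the second moment is at most linear in u.\<close>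

lemma nn_integral_truncated_quotient_square:
  "(\<integral>\<^sup>+x. ennreal ((truncated_quotient u x)^2) \<partial>gauss_measure) \<le> ennreal (3 * real u)"
proof -
  have sq: "(\<Sum>j<n. 2 * real j + 1) = (real n)^2" for n
    by (induction n) (auto simp: power2_eq_square algebra_simps)
  have "(\<integral>\<^sup>+x. ennreal ((truncated_quotient u x)^2) \<partial>gauss_measure) =
      ennreal (\<Sum>j<u. (2 * real j + 1) * log 2 (1 + 1 / (real j + 1)))"
  proof (rule nn_integral_quotient_layers)
    fix x :: real assume "0 < x" "x < 1"
    then have k: "0 \<le> \<lfloor>1 / x\<rfloor>" by simp
    show "(truncated_quotient u x)^2 = (\<Sum>j<u. if int j + 1 \<le> \<lfloor>1 / x\<rfloor> then 2 * real j + 1 else 0)"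
      unfolding sum_layers_min[OF k] sq by (simp add: truncated_quotient_def min_of_int_of_nat[OF k] del: of_nat_min)
  qed simp
  also have "\<dots> \<le> ennreal (\<Sum>j<u. 3)"
  proof (intro ennreal_leI sum_mono)
    fix j
    have "(2 * real j + 1) * log 2 (1 + 1 / (real j + 1)) \<le> (2 * real j + 1) * (3/2 * (1 / (real j + 1)))"
      by (intro mult_left_mono log_2_1p_le) auto
    also have "\<dots> \<le> 3" by (simp add: divide_simps)
    finally show "(2 * real j + 1) * log 2 (1 + 1 / (real j + 1)) \<le> 3" .
  qed
  finally show ?thesis by (simp add: mult.commute)
qed

lemma truncated_sum_variance:
  "(\<integral>\<^sup>+x. ennreal (((\<Sum>i<n. truncated_quotient u ((gauss_map ^^ i) x)) - real n * log 2 (real u + 1))^2)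
     \<partial>gauss_measure) \<le> ennreal (real n * (3 * real u + 16 * ln (real u + 1) * log 2 (real u + 1)))"
proof -
  have "(\<integral>\<^sup>+x. ennreal (((\<Sum>i\<in>{..<n}. truncated_quotient u ((gauss_map ^^ i) x)) -
      real (card {..<n}) * log 2 (real u + 1))^2) \<partial>gauss_measure) \<le>
    ennreal (real (card {..<n}) * (3 * real u + 16 * ln (real u + 1) * log 2 (real u + 1)))"
    by (rule gauss_second_moment)
      (auto intro: truncated_quotient_nonneg truncated_quotient_summable transfer_truncated_lipschitz
        nn_integral_truncated_quotient nn_integral_truncated_quotient_square)
  then show ?thesis by simp
qed

section \<open>Rarity of two quotients above the cutoff\<close>

definition exceed :: "nat \<Rightarrow> real \<Rightarrow> real" where
  "exceed u x = (if int u + 1 \<le> \<lfloor>1 / x\<rfloor> then 1 else 0)"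

lemma exceed_measurable [measurable]: "exceed u \<in> borel_measurable borel"
  unfolding exceed_def by measurable

lemma exceed_branch: "0 < y \<Longrightarrow> y < 1 \<Longrightarrow> exceed u (branch k y) = (if u \<le> k then 1 else 0)"
  by (simp add: exceed_def floor_inverse_branch)

lemma exceed_summable:
  "0 < y \<Longrightarrow> y < 1 \<Longrightarrow> summable (\<lambda>k. branch_weight k y * exceed u (branch k y))"
  by (rule transfer_summable_bounded[where C = 1]) (auto simp: exceed_def)

text \<open>As a function of k the values on the branches have at most one jump, at k + 1 = u, whose
  Abel weight u / (u + 1)^2 is below 1 / (u + 1). The constant thus has the order of the mean, which
  keeps pair probabilities at O(1/u^2) even for adjacent times.\<close>

lemma transfer_exceed_lipschitz:
  "(1 / (real u + 1))-lipschitz_on {0<..<1} (transfer (exceed u))"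
proof (rule lipschitz_onI)
  fix y z :: real assume "y \<in> {0<..<1}" "z \<in> {0<..<1}"
  then have yz: "0 < y" "y < 1" "0 < z" "z < 1" by auto
  note br = exceed_branch[OF yz(1,2)] exceed_branch[OF yz(3,4)]
  have "\<bar>(\<Sum>k. branch_weight k y * exceed u (branch k y)) -
      (\<Sum>k. branch_weight k z * exceed u (branch k z))\<bar> \<le> (0 + 1 / (real u + 1)) * \<bar>y - z\<bar>"
  proof (rule lipschitz_weighted_sum[where A = "\<lambda>k. 0" and B = "\<lambda>k. if Suc k = u then 1 else 0"
      and F = "\<lambda>k y. exceed u (branch k y)", OF yz(1,3)])
    show "(\<Sum>k<n. (if Suc k = u then 1 else 0) * ((real k + 1) / (real k + 2)^2)) \<le> 1 / (real u + 1)" for n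
    proof -
      have "(\<Sum>k<n. (if Suc k = u then 1 else 0) * ((real k + 1) / (real k + 2)^2)) \<le>
          (\<Sum>k<n. if k = u - 1 then 1 / (real u + 1) else 0)"
        by (intro sum_mono) (auto simp: divide_simps power2_eq_square)
      also have "\<dots> \<le> 1 / (real u + 1)" by simp
      finally show ?thesis .
    qed
    have "(\<lambda>n. 1 / (real n + 1)) \<longlonglongrightarrow> 0" by real_asymp
    then show "(\<lambda>n. exceed u (branch n z) / (real n + 1)) \<longlonglongrightarrow> 0"
      by (rule Lim_null_comparison[rotated]) (auto simp: br intro!: always_eventually)
    show "summable (\<lambda>k. branch_weight k y * exceed u (branch k y))"
      "summable (\<lambda>k. branch_weight k z * exceed u (branch k z))"
      using yz by (auto intro: exceed_summable)
  qed (auto simp: br)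
  then show "dist (transfer (exceed u) y) (transfer (exceed u) z) \<le> 1 / (real u + 1) * dist y z"
    by (simp add: transfer_def dist_real_def)
qed simp

lemma nn_integral_exceed:
  "(\<integral>\<^sup>+x. ennreal (exceed u x) \<partial>gauss_measure) = ennreal (log 2 (1 + 1 / (real u + 1)))"
proof -
  have "(\<integral>\<^sup>+x. ennreal (exceed u x) \<partial>gauss_measure) =
      ennreal (\<Sum>j<Suc u. (if j = u then 1 else 0) * log 2 (1 + 1 / (real j + 1)))"
  proof (rule nn_integral_quotient_layers)
    fix x :: real
    have "(\<Sum>j<Suc u. if int j + 1 \<le> \<lfloor>1 / x\<rfloor> then (if j = u then 1 else 0) else 0) =
        (\<Sum>j<Suc u. if j = u then exceed u x else 0)" by (intro sum.cong) (auto simp: exceed_def)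
    then show "exceed u x = (\<Sum>j<Suc u. if int j + 1 \<le> \<lfloor>1 / x\<rfloor> then (if j = u then 1 else 0) else 0)"
      by (simp add: sum.delta)
  qed simp
  also have "(\<Sum>j<Suc u. (if j = u then 1 else 0) * log 2 (1 + 1 / (real j + 1))) = log 2 (1 + 1 / (real u + 1))"
    by simp
  finally show ?thesis .
qed

text \<open>With L = 1 / (u + 1) and mean at most (3/2) L, the bound is (3/2 + 1) (3/2) L^2 = (15/4)
  L^2, rounded up to 4 L^2.\<close>

lemma exceed_pair:
  assumes "i < j"
  shows "(\<integral>\<^sup>+x. ennreal (exceed u ((gauss_map ^^ i) x) * exceed u ((gauss_map ^^ j) x)) \<partial>gauss_measure)
    \<le> ennreal (4 / (real u + 1)^2)"
proof -
  let ?m = "log 2 (1 + 1 / (real u + 1))" and ?L = "1 / (real u + 1)"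
  have m: "0 \<le> ?m" "?m \<le> 3/2 * ?L" using log_2_1p_le[of ?L] log_2_1p_nonneg[of ?L] by simp_all
  have "(\<integral>\<^sup>+x. ennreal (exceed u ((gauss_map ^^ i) x) * exceed u ((gauss_map ^^ j) x)) \<partial>gauss_measure)
      \<le> ennreal ((?m + ?L * (7/8)^(j - i - 1)) * ?m)"
    by (rule gauss_covariance[OF _ _ exceed_summable transfer_exceed_lipschitz nn_integral_exceed m(1) assms])
      (auto simp: exceed_def)
  also have "\<dots> \<le> ennreal (4 / (real u + 1)^2)"
  proof (rule ennreal_leI)
    have "?L * (7/8)^(j - i - 1) \<le> ?L * 1" by (intro mult_left_mono power_le_one) auto
    with m(2) have "?m + ?L * (7/8)^(j - i - 1) \<le> 5/2 * ?L" by linarith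
    then have "(?m + ?L * (7/8)^(j - i - 1)) * ?m \<le> (5/2 * ?L) * (3/2 * ?L)"
      using m by (intro mult_mono) auto
    also have "\<dots> = (15/4) / (real u + 1)^2"
      by (simp add: power2_eq_square) (simp add: algebra_simps)
    also have "\<dots> \<le> 4 / (real u + 1)^2" by (intro divide_right_mono) auto
    finally show "(?m + ?L * (7/8)^(j - i - 1)) * ?m \<le> 4 / (real u + 1)^2" .
  qed
  finally show ?thesis .
qed

text \<open>Counts the pairs i < j < n with both quotients above u; being an integer, it vanishes as
  soon as it is below 1.\<close>

definition exceed_pairs :: "nat \<Rightarrow> nat \<Rightarrow> real \<Rightarrow> real" where
  "exceed_pairs u n x = (\<Sum>j<n. \<Sum>i<j. exceed u ((gauss_map ^^ i) x) * exceed u ((gauss_map ^^ j) x))"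

lemma exceed_pairs_measurable [measurable]: "exceed_pairs u n \<in> borel_measurable borel"
  unfolding exceed_pairs_def by measurable

lemma exceed_nonneg: "0 \<le> exceed u x"
  by (simp add: exceed_def)

lemma exceed_pairs_nonneg: "0 \<le> exceed_pairs u n x"
  unfolding exceed_pairs_def by (intro sum_nonneg mult_nonneg_nonneg exceed_nonneg)

lemma exceed_pairs_ge_1:
  assumes "i < j" "j < n" "int u + 1 \<le> partial_quotient x (Suc i)" "int u + 1 \<le> partial_quotient x (Suc j)"
  shows "1 \<le> exceed_pairs u n x"
proof -
  let ?e = "\<lambda>i j. exceed u ((gauss_map ^^ i) x) * exceed u ((gauss_map ^^ j) x)"
  have "1 = ?e i j" using assms(3,4) by (simp add: exceed_def partial_quotient.simps(2))
  also have "\<dots> \<le> (\<Sum>i<j. ?e i j)"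
    using assms(1) by (intro member_le_sum) (auto simp: exceed_nonneg)
  also have "\<dots> \<le> (\<Sum>j<n. \<Sum>i<j. ?e i j)"
    using assms(2) by (intro member_le_sum[where f = "\<lambda>j. \<Sum>i<j. ?e i j"]) (auto simp: exceed_nonneg intro!: sum_nonneg)
  finally show ?thesis by (simp add: exceed_pairs_def)
qed

lemma nn_integral_exceed_pairs:
  "(\<integral>\<^sup>+x. ennreal (exceed_pairs u n x) \<partial>gauss_measure) \<le> ennreal (4 * (real n)^2 / (real u + 1)^2)"
proof -
  let ?e = "\<lambda>i j x. exceed u ((gauss_map ^^ i) x) * exceed u ((gauss_map ^^ j) x)"
  have split: "ennreal (exceed_pairs u n x) = (\<Sum>j<n. \<Sum>i<j. ennreal (?e i j x))" for x
  proof -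
    have "(\<Sum>i<j. ennreal (?e i j x)) = ennreal (\<Sum>i<j. ?e i j x)" for j
      by (rule sum_ennreal) (simp add: exceed_nonneg)
    moreover have "(\<Sum>j<n. ennreal (\<Sum>i<j. ?e i j x)) = ennreal (\<Sum>j<n. \<Sum>i<j. ?e i j x)"
      by (rule sum_ennreal) (simp add: exceed_nonneg sum_nonneg)
    ultimately show ?thesis by (simp only: exceed_pairs_def)
  qed
  have "(\<integral>\<^sup>+x. ennreal (exceed_pairs u n x) \<partial>gauss_measure) =
      (\<Sum>j<n. \<Sum>i<j. \<integral>\<^sup>+x. ennreal (?e i j x) \<partial>gauss_measure)"
    unfolding split by (simp add: nn_integral_sum)
  also have "\<dots> \<le> (\<Sum>j<n. \<Sum>i<j. ennreal (4 / (real u + 1)^2))"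
    by (intro sum_mono exceed_pair) auto
  also have "\<dots> \<le> (\<Sum>j<n. \<Sum>i<n. ennreal (4 / (real u + 1)^2))"
    by (intro sum_mono sum_mono2) auto
  also have "\<dots> = ennreal (4 * (real n)^2 / (real u + 1)^2)"
    by (simp add: ennreal_of_nat_eq_real_of_nat ennreal_mult[symmetric] power2_eq_square mult_ac)
  finally show ?thesis .
qed

text \<open>The exponent lies between 4/5 and 1: below 1 so that consecutive samples have ratio
  tending to 1, above 4/5 so that (ln n)^(-5/4) is summable along n =
  \<open>sample j\<close>.\<close>

definition sample :: "nat \<Rightarrow> nat" where
  "sample j = nat \<lceil>exp (real j powr (9/10))\<rceil>"

text \<open>The power c = 3/4 of ln n meets two needs: c < 1 makes the truncation error u equal to
  o(n ln n), and c > 1/2 lets the pair bound n^2 / u^2, of order (ln n)^(-2c), be summable along n =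
  exp (j^s) for some s < 1.\<close>

definition cutoff :: "nat \<Rightarrow> nat" where
  "cutoff n = nat \<lceil>real n * ln (real n) powr (3/4)\<rceil>"

text \<open>The variance bound is of order n u; divided by (n ln n)^2 it has order (ln n)^(3/4 - 2),
  that is j^(-9/8).\<close>

lemma AE_truncated_sum_asymp:
  "AE x in gauss_measure. (\<lambda>j.
     ((\<Sum>i<sample j. truncated_quotient (cutoff (sample j)) ((gauss_map ^^ i) x)) -
       real (sample j) * log 2 (real (cutoff (sample j)) + 1)) /
     (real (sample j) * ln (real (sample j)))) \<longlonglongrightarrow> 0"
proof -
  define Z where "Z j x =
     ((\<Sum>i<sample j. truncated_quotient (cutoff (sample j)) ((gauss_map ^^ i) x)) -
       real (sample j) * log 2 (real (cutoff (sample j)) + 1))" for j x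
  define w where "w j = real (sample j) * ln (real (sample j))" for j
  define b where "b j = real (sample j) * (3 * real (cutoff (sample j)) +
      16 * ln (real (cutoff (sample j)) + 1) * log 2 (real (cutoff (sample j)) + 1))" for j
  have [measurable]: "Z j \<in> borel_measurable borel" for j unfolding Z_def by measurable
  have b0: "0 \<le> b j" for j
    unfolding b_def by (intro mult_nonneg_nonneg add_nonneg_nonneg) (auto simp: log_def)
  have "AE x in gauss_measure. (\<lambda>j. (Z j x)^2 * (1 / (w j)^2)) \<longlonglongrightarrow> 0"
  proof (rule AE_tendsto_0_if_summable_moments)
    show "(\<integral>\<^sup>+x. ennreal ((Z j x)^2 * (1 / (w j)^2)) \<partial>gauss_measure) \<le> ennreal (b j * (1 / (w j)^2))" for j
    proof -
      have "(\<integral>\<^sup>+x. ennreal ((Z j x)^2 * (1 / (w j)^2)) \<partial>gauss_measure) =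
          (\<integral>\<^sup>+x. ennreal ((Z j x)^2) * ennreal (1 / (w j)^2) \<partial>gauss_measure)"
        by (intro nn_integral_cong ennreal_mult) auto
      also have "\<dots> = (\<integral>\<^sup>+x. ennreal ((Z j x)^2) \<partial>gauss_measure) * ennreal (1 / (w j)^2)"
        by (rule nn_integral_multc) measurable
      also have "\<dots> \<le> ennreal (b j) * ennreal (1 / (w j)^2)"
        unfolding Z_def b_def by (intro mult_right_mono truncated_sum_variance) auto
      also have "\<dots> = ennreal (b j * (1 / (w j)^2))" using b0 by (intro ennreal_mult[symmetric]) auto
      finally show ?thesis .
    qed
    show "summable (\<lambda>j. b j * (1 / (w j)^2))"
    proof (rule summable_comparison_test_bigo)
      show "summable (\<lambda>j. norm (real j powr (- (9/8))))" by (simp add: summable_real_powr_iff)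
      show "(\<lambda>j. b j * (1 / (w j)^2)) \<in> O(\<lambda>j. real j powr (- (9/8)))"
        unfolding b_def w_def sample_def cutoff_def by real_asymp
    qed
    show "0 \<le> b j * (1 / (w j)^2)" for j using b0 by simp
  qed auto
  then show ?thesis
  proof eventually_elim
    case (elim x)
    have "(\<lambda>j. sqrt ((Z j x)^2 * (1 / (w j)^2))) \<longlonglongrightarrow> sqrt 0" by (intro tendsto_real_sqrt elim)
    then have "(\<lambda>j. \<bar>Z j x / w j\<bar>) \<longlonglongrightarrow> 0"
      by (simp add: real_sqrt_mult real_sqrt_divide abs_divide)
    then show ?case unfolding Z_def w_def by (rule tendsto_rabs_zero_cancel)
  qed
qed

text \<open>Here n^2 / u^2 has order (ln n)^(-3/2), that is j^(-27/20).\<close>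

lemma AE_exceed_pairs_tendsto_0:
  "AE x in gauss_measure. (\<lambda>j. exceed_pairs (cutoff (sample j)) (sample j) x) \<longlonglongrightarrow> 0"
proof (rule AE_tendsto_0_if_summable_moments[OF _ _ nn_integral_exceed_pairs])
  show "summable (\<lambda>j. 4 * (real (sample j))^2 / (real (cutoff (sample j)) + 1)^2)"
  proof (rule summable_comparison_test_bigo)
    show "summable (\<lambda>j. norm (real j powr (- (27/20))))" by (simp add: summable_real_powr_iff)
    show "(\<lambda>j. 4 * (real (sample j))^2 / (real (cutoff (sample j)) + 1)^2) \<in> O(\<lambda>j. real j powr (- (27/20)))"
      unfolding sample_def cutoff_def by real_asymp
  qed
qed (auto simp: exceed_pairs_nonneg)

theorem AE_trimmed_quotient_sum_asymp:
  "AE x in gauss_measure. (\<lambda>n. trimmed_sum (\<lambda>i. of_int (partial_quotient x (Suc i))) n /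
     (real n * ln (real n))) \<longlonglongrightarrow> 1 / ln 2"
  using AE_truncated_sum_asymp AE_exceed_pairs_tendsto_0 AE_gauss_irrat01
proof eventually_elim
  case (elim x)
  define a where "a i = real_of_int (partial_quotient x (Suc i))" for i
  define \<phi> where "\<phi> n = real n * ln (real n)" for n :: nat
  let ?u = "\<lambda>j. cutoff (sample j)"
  let ?S = "\<lambda>j. \<Sum>i<sample j. truncated_quotient (?u j) ((gauss_map ^^ i) x)"
  have a0: "0 \<le> a i" for i using partial_quotient_ge_1[OF elim(3), of i] by (simp add: a_def)
  have S: "?S j = (\<Sum>i<sample j. min (a i) (real (?u j)))" for j
    by (simp add: truncated_quotient_def a_def partial_quotient.simps(2))
  have "\<forall>\<^sub>F j in sequentially. exceed_pairs (?u j) (sample j) x < 1"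
    using elim(2) by (rule order_tendstoD) simp
  then have close: "\<forall>\<^sub>F j in sequentially. norm ((trimmed_sum a (sample j) - ?S j) / \<phi> (sample j))
      \<le> norm (real (?u j) / \<phi> (sample j))"
  proof eventually_elim
    case (elim j)
    have "\<bar>trimmed_sum a (sample j) - ?S j\<bar> \<le> real (?u j)"
      unfolding S
    proof (rule trimmed_sum_truncated[OF a0])
      fix i k assume ik: "i < k" "k < sample j"
      show "\<not> (real (?u j) < a i \<and> real (?u j) < a k)"
      proof
        assume "real (?u j) < a i \<and> real (?u j) < a k"
        then have "int (?u j) + 1 \<le> partial_quotient x (Suc i)" "int (?u j) + 1 \<le> partial_quotient x (Suc k)"
          by (auto simp: a_def)
        from exceed_pairs_ge_1[OF ik this] elim show False by simp
      qed
    qed simp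
    then show ?case unfolding real_norm_def abs_divide by (intro divide_right_mono) auto
  qed
  have "(\<lambda>j. real (?u j) / \<phi> (sample j)) \<longlonglongrightarrow> 0"
    unfolding \<phi>_def sample_def cutoff_def by real_asymp
  then have "(\<lambda>j. (trimmed_sum a (sample j) - ?S j) / \<phi> (sample j)) \<longlonglongrightarrow> 0"
    by (intro Lim_null_comparison[OF close] tendsto_norm_zero)
  moreover have "(\<lambda>j. (?S j - real (sample j) * log 2 (real (?u j) + 1)) / \<phi> (sample j)) \<longlonglongrightarrow> 0"
    unfolding \<phi>_def by (rule elim(1))
  \<comment> \<open>Since ln u ~ ln n, the mean log2 (u + 1) of a truncated quotient is asymptotic
    to ln n / ln 2.\<close>
  moreover have "(\<lambda>j. real (sample j) * log 2 (real (?u j) + 1) / \<phi> (sample j)) \<longlonglongrightarrow> inverse (ln 2)"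
    unfolding \<phi>_def sample_def cutoff_def by real_asymp
  ultimately have "(\<lambda>j. (trimmed_sum a (sample j) - ?S j) / \<phi> (sample j) +
      ((?S j - real (sample j) * log 2 (real (?u j) + 1)) / \<phi> (sample j) +
      real (sample j) * log 2 (real (?u j) + 1) / \<phi> (sample j))) \<longlonglongrightarrow> 0 + (0 + inverse (ln 2))"
    by (intro tendsto_add)
  then have lim: "(\<lambda>j. trimmed_sum a (sample j) / \<phi> (sample j)) \<longlonglongrightarrow> 1 / ln 2"
    by (simp add: add_divide_distrib[symmetric] inverse_eq_divide)
  have "(\<lambda>n. trimmed_sum a n / \<phi> n) \<longlonglongrightarrow> 1 / ln 2"
  proof (rule mono_ratio_interpolate[where N = 2 and t = sample])
    show "(\<lambda>j. trimmed_sum a (sample j) / \<phi> (sample j)) \<longlonglongrightarrow> 1 / ln 2" by (rule lim)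
    show "mono (trimmed_sum a)" by (intro monoI trimmed_sum_mono a0)
    show "0 \<le> trimmed_sum a n" for n
      using trimmed_sum_mono[of a 0 n, OF a0] by (simp add: trimmed_sum_def[of a 0])
    show "mono \<phi>"
    proof (rule monoI)
      fix m n :: nat assume "m \<le> n"
      then show "\<phi> m \<le> \<phi> n" unfolding \<phi>_def by (cases "m = 0"; cases "n = 0") (auto intro!: mult_mono)
    qed
    show "0 < \<phi> n" if "2 \<le> n" for n using that by (simp add: \<phi>_def)
    show "filterlim sample at_top sequentially" unfolding sample_def by real_asymp
    show "(\<lambda>j. \<phi> (sample (Suc j)) / \<phi> (sample j)) \<longlonglongrightarrow> 1"
      unfolding \<phi>_def sample_def by real_asymp
  qed
  then show ?case by (simp add: a_def[abs_def] \<phi>_def)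
qed

section \<open>Inversion in terms of the height\<close>

lemma conv_index_tendsto:
  assumes "x \<in> irrat01"
  shows "filterlim (\<lambda>Q. conv_index Q x) at_top sequentially"
  unfolding filterlim_at_top
proof
  fix k
  show "\<forall>\<^sub>F Q in sequentially. k \<le> conv_index Q x"
  proof (rule eventually_sequentiallyI[of "nat (cf_Q x (Suc k) + cf_Q x k)"])
    fix Q assume Q: "nat (cf_Q x (Suc k) + cf_Q x k) \<le> Q"
    show "k \<le> conv_index Q x"
    proof (rule ccontr)
      assume "\<not> k \<le> conv_index Q x"
      then have "cf_Q x (Suc (conv_index Q x)) \<le> cf_Q x (Suc k)" "cf_Q x (conv_index Q x) \<le> cf_Q x k"
        by (auto intro!: cf_Q_mono_le assms simp del: cf_Q.simps)
      then show False using conv_index_upper[OF assms, of Q] Q by linarith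
    qed
  qed
qed

definition deviation_bound :: "real \<Rightarrow> real \<Rightarrow> real" where
  "deviation_bound \<epsilon> y = y powr (1/2) * ln y powr (3/2 + \<epsilon>)"

lemma deviation_bound_mono:
  assumes "0 < \<epsilon>" "1 \<le> y" "y \<le> z"
  shows "deviation_bound \<epsilon> y \<le> deviation_bound \<epsilon> z"
  unfolding deviation_bound_def using assms by (intro mult_mono powr_mono2) auto

text \<open>Once y >= c, ln (c y) <= 2 ln y; this is the source of the factor
  \<open>2 powr (3/2 + \<epsilon>)\<close>.\<close>

lemma deviation_bound_scale:
  assumes \<epsilon>: "0 < \<epsilon>" and c: "0 < c"
  shows "\<forall>\<^sub>F y in at_top. deviation_bound \<epsilon> (c * y) \<le> c powr (1/2) * 2 powr (3/2 + \<epsilon>) * deviation_bound \<epsilon> y"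
  using eventually_ge_at_top[of c] eventually_ge_at_top[of "1 / c"] eventually_ge_at_top[of 1]
proof eventually_elim
  case (elim y)
  have y: "0 < y" "1 \<le> c * y" using elim c by (auto simp: field_simps)
  have "ln (c * y) = ln c + ln y" using c y by (simp add: ln_mult)
  also have "\<dots> \<le> 2 * ln y" using elim c by simp
  finally have "ln (c * y) powr (3/2 + \<epsilon>) \<le> (2 * ln y) powr (3/2 + \<epsilon>)"
    using y \<epsilon> by (intro powr_mono2) auto
  also have "\<dots> = 2 powr (3/2 + \<epsilon>) * ln y powr (3/2 + \<epsilon>)" using elim by (simp add: powr_mult)
  finally have "c powr (1/2) * y powr (1/2) * ln (c * y) powr (3/2 + \<epsilon>) \<le>
      c powr (1/2) * y powr (1/2) * (2 powr (3/2 + \<epsilon>) * ln y powr (3/2 + \<epsilon>))"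
    by (intro mult_left_mono) auto
  then show ?case using c y by (simp add: deviation_bound_def powr_mult mult_ac)
qed

text \<open>The sums at N - 1 and N enclose ln Q up to ln 2, so N \<kappa> and ln Q differ by at
  most 2 R(N). A rough bound N <= (2 / \<kappa>) ln Q, extracted from the same inequality, then
  replaces R(N) by a multiple of R(ln Q). The constant depends on \<epsilon> only, as the quantifier
  order of the claim demands.\<close>

lemma conv_index_deviation:
  assumes x: "x \<in> irrat01" and \<epsilon>: "0 < \<epsilon>"
    and dev: "\<forall>\<^sub>F n in sequentially. \<bar>(\<Sum>k<n. - ln ((gauss_map ^^ k) x)) - real n * levy_const\<bar>
      \<le> real n powr (1/2) * ln (real n) powr (3/2 + \<epsilon>)"
  shows "\<forall>\<^sub>F Q in sequentially. \<bar>real (conv_index Q x) - ln (real Q) / levy_const\<bar> \<le>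
    2 / levy_const * ((2 / levy_const) powr (1/2) * 2 powr (3/2 + \<epsilon>)) * deviation_bound \<epsilon> (ln (real Q))"
proof -
  let ?\<kappa> = levy_const and ?R = "deviation_bound \<epsilon>"
  let ?S = "\<lambda>n. \<Sum>k<n. - ln ((gauss_map ^^ k) x)"
  have \<kappa>: "0 < ?\<kappa>" by (rule levy_const_pos)
  have dev': "\<forall>\<^sub>F n in sequentially. \<bar>?S n - real n * ?\<kappa>\<bar> \<le> ?R (real n)"
    using dev by (simp add: deviation_bound_def)
  then have dev'': "\<forall>\<^sub>F n in sequentially. \<bar>?S (n - 1) - real (n - 1) * ?\<kappa>\<bar> \<le> ?R (real (n - 1))"
    by (rule eventually_compose_filterlim) real_asymp
  \<comment> \<open>A second copy of R(N) absorbs ln 2 and the cost \<kappa> of the shift from N - 1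
    to N.\<close>
  have big: "\<forall>\<^sub>F n in sequentially. ?\<kappa> + ln 2 \<le> ?R (real n)"
  proof -
    have "filterlim (\<lambda>n. ?R (real n)) at_top sequentially"
      unfolding deviation_bound_def using \<epsilon> by real_asymp
    then show ?thesis by (simp add: filterlim_at_top)
  qed
  \<comment> \<open>Because R is sublinear, 2 R(N) is at most half of N \<kappa>; this yields the
    rough bound on N.\<close>
  have small: "\<forall>\<^sub>F n in sequentially. 2 * ?R (real n) \<le> ?\<kappa> / 2 * real n"
  proof -
    have "(\<lambda>n. ?R (real n) / real n) \<longlonglongrightarrow> 0"
      unfolding deviation_bound_def using \<epsilon> by real_asymp
    then have "\<forall>\<^sub>F n in sequentially. ?R (real n) / real n < ?\<kappa> / 4"
      using \<kappa> by (intro order_tendstoD) auto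
    then show ?thesis using eventually_gt_at_top[of 0]
      by eventually_elim (simp add: field_simps)
  qed
  have ev: "\<forall>\<^sub>F n in sequentially. 2 \<le> n \<and> \<bar>?S n - real n * ?\<kappa>\<bar> \<le> ?R (real n) \<and>
      \<bar>?S (n - 1) - real (n - 1) * ?\<kappa>\<bar> \<le> ?R (real (n - 1)) \<and> ?\<kappa> + ln 2 \<le> ?R (real n) \<and>
      2 * ?R (real n) \<le> ?\<kappa> / 2 * real n"
    using dev' dev'' big small eventually_ge_at_top[of 2] by eventually_elim simp
  have evQ: "\<forall>\<^sub>F Q in sequentially. 2 \<le> conv_index Q x \<and>
      \<bar>?S (conv_index Q x) - real (conv_index Q x) * ?\<kappa>\<bar> \<le> ?R (real (conv_index Q x)) \<and>
      \<bar>?S (conv_index Q x - 1) - real (conv_index Q x - 1) * ?\<kappa>\<bar> \<le> ?R (real (conv_index Q x - 1)) \<and>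
      ?\<kappa> + ln 2 \<le> ?R (real (conv_index Q x)) \<and>
      2 * ?R (real (conv_index Q x)) \<le> ?\<kappa> / 2 * real (conv_index Q x)"
    by (rule eventually_compose_filterlim[OF ev conv_index_tendsto[OF x]])
  have lnQ: "filterlim (\<lambda>Q. ln (real Q)) at_top sequentially" by real_asymp
  have sc: "\<forall>\<^sub>F Q in sequentially. ?R (2 / ?\<kappa> * ln (real Q)) \<le>
      (2 / ?\<kappa>) powr (1/2) * 2 powr (3/2 + \<epsilon>) * ?R (ln (real Q))"
    using \<kappa> by (intro eventually_compose_filterlim[OF deviation_bound_scale lnQ] \<epsilon>) simp
  show ?thesis using evQ sc eventually_ge_at_top[of 1]
  proof eventually_elim
    case (elim Q)
    define n where "n = conv_index Q x"
    define y where "y = ln (real Q)"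
    have n: "2 \<le> n" "\<bar>?S n - real n * ?\<kappa>\<bar> \<le> ?R (real n)"
      "\<bar>?S (n - 1) - real (n - 1) * ?\<kappa>\<bar> \<le> ?R (real (n - 1))"
      "?\<kappa> + ln 2 \<le> ?R (real n)" "2 * ?R (real n) \<le> ?\<kappa> / 2 * real n"
      using elim by (auto simp: n_def)
    have Q: "1 \<le> Q" using elim by simp
    have y: "?S (n - 1) \<le> y" "y \<le> ?S n + ln 2"
      unfolding y_def n_def by (rule log_sum_conv_index[OF x Q])+
    have m: "?R (real (n - 1)) \<le> ?R (real n)"
      using n(1) \<epsilon> by (intro deviation_bound_mono) auto
    have e: "real (n - 1) * ?\<kappa> = real n * ?\<kappa> - ?\<kappa>" using n(1) by (simp add: algebra_simps)
    have d: "\<bar>real n * ?\<kappa> - y\<bar> \<le> 2 * ?R (real n)"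
      using n(2-4) y m e \<kappa> ln_gt_zero[of 2] by (simp only: abs_le_iff) linarith
    have "?\<kappa> / 2 * real n = real n * ?\<kappa> / 2" by simp
    then have "real n * ?\<kappa> / 2 \<le> y" using d n(5) unfolding abs_le_iff by linarith
    then have "real n \<le> 2 / ?\<kappa> * y" using \<kappa> by (simp add: field_simps)
    then have "?R (real n) \<le> ?R (2 / ?\<kappa> * y)" using n(1) \<epsilon> by (intro deviation_bound_mono) auto
    also have "\<dots> \<le> (2 / ?\<kappa>) powr (1/2) * 2 powr (3/2 + \<epsilon>) * ?R y" using elim by (simp only: y_def)
    finally have R: "?R (real n) \<le> (2 / ?\<kappa>) powr (1/2) * 2 powr (3/2 + \<epsilon>) * ?R y" .
    have "real n - y / ?\<kappa> = (real n * ?\<kappa> - y) / ?\<kappa>" using \<kappa> by (simp add: diff_divide_distrib)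
    then have "\<bar>real n - y / ?\<kappa>\<bar> = \<bar>real n * ?\<kappa> - y\<bar> / ?\<kappa>" using \<kappa> by (simp add: abs_divide)
    also have "\<dots> \<le> 2 * ?R (real n) / ?\<kappa>" using d \<kappa> by (intro divide_right_mono) auto
    also have "\<dots> = 2 / ?\<kappa> * ?R (real n)" by simp
    also have "\<dots> \<le> 2 / ?\<kappa> * ((2 / ?\<kappa>) powr (1/2) * 2 powr (3/2 + \<epsilon>) * ?R y)"
      using R \<kappa> by (intro mult_left_mono) auto
    finally show ?case by (simp only: n_def y_def mult.assoc)
  qed
qed

lemma conv_index_ratio_tendsto:
  assumes "\<forall>\<^sub>F Q in sequentially. \<bar>real (N Q) - ln (real Q) / \<kappa>\<bar> \<le> C * deviation_bound 1 (ln (real Q))"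
  shows "(\<lambda>Q. real (N Q) / ln (real Q)) \<longlonglongrightarrow> 1 / \<kappa>"
proof -
  have "\<forall>\<^sub>F Q in sequentially. norm (real (N Q) / ln (real Q) - 1 / \<kappa>) \<le>
      C * (deviation_bound 1 (ln (real Q)) / ln (real Q))"
    using assms eventually_gt_at_top[of 1]
  proof eventually_elim
    case (elim Q)
    have y: "0 < ln (real Q)" using elim by simp
    have "real (N Q) / ln (real Q) - 1 / \<kappa> = (real (N Q) - ln (real Q) / \<kappa>) / ln (real Q)"
      using y by (simp add: diff_divide_distrib)
    then have "norm (real (N Q) / ln (real Q) - 1 / \<kappa>) = \<bar>real (N Q) - ln (real Q) / \<kappa>\<bar> / ln (real Q)"
      using y by (simp add: abs_divide)
    also have "\<dots> \<le> C * deviation_bound 1 (ln (real Q)) / ln (real Q)"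
      using elim y by (intro divide_right_mono) auto
    finally show ?case by simp
  qed
  moreover have "(\<lambda>Q. deviation_bound 1 (ln (real Q)) / ln (real Q)) \<longlonglongrightarrow> 0"
    unfolding deviation_bound_def by real_asymp
  then have "(\<lambda>Q. C * (deviation_bound 1 (ln (real Q)) / ln (real Q))) \<longlonglongrightarrow> 0"
    by (rule tendsto_mult_right_zero)
  ultimately have "(\<lambda>Q. real (N Q) / ln (real Q) - 1 / \<kappa>) \<longlonglongrightarrow> 0" by (rule Lim_null_comparison)
  then show ?thesis by (simp add: LIM_zero_iff)
qed

text \<open>The difference is exactly m + b, where m is the trimmed maximum of a_1, ..., a_{N-1} and
  b the partial last block; each is at most M_0, hence the factor 2.\<close>

lemma num_intermediate_trimmed:
  assumes x: "x \<in> irrat01" and Q: "1 \<le> Q"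
  defines "n \<equiv> conv_index Q x - 1"
  shows "\<bar>real (num_intermediate Q x) -
      (trimmed_sum (\<lambda>i. of_int (partial_quotient x (Suc i))) n - real n)\<bar> \<le> 2 * of_int (max_quotient Q x)"
proof -
  let ?a = "\<lambda>i. real_of_int (partial_quotient x (Suc i))"
  let ?A = "insert (conv_coeff Q x) (partial_quotient x ` {1..<conv_index Q x})"
  obtain b where b: "0 \<le> b" "b \<le> conv_coeff Q x"
    "int (num_intermediate Q x) = (\<Sum>i<n. partial_quotient x (Suc i) - 1) + b"
    using num_intermediate_eq[OF x Q] unfolding n_def by blast
  have max: "k \<le> max_quotient Q x" if "k \<in> ?A" for k
    unfolding max_quotient_def using that by (intro Max_ge) auto
  have bM: "real_of_int b \<le> of_int (max_quotient Q x)" using b(2) max[of "conv_coeff Q x"] by simp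
  define m where "m = Max (insert 0 (?a ` {..<n}))"
  have m0: "0 \<le> m" unfolding m_def by (rule Max_ge) auto
  have mM: "m \<le> of_int (max_quotient Q x)"
    unfolding m_def
  proof (rule Max.boundedI)
    fix r assume "r \<in> insert 0 (?a ` {..<n})"
    then consider "r = 0" | i where "i < n" "r = ?a i" by auto
    then show "r \<le> of_int (max_quotient Q x)"
    proof cases
      case 1
      then show ?thesis using b max[of "conv_coeff Q x"] by simp
    next
      case (2 i)
      then have "partial_quotient x (Suc i) \<in> ?A" by (auto simp: n_def)
      then show ?thesis using max 2 by simp
    qed
  qed auto
  have "real (num_intermediate Q x) = real_of_int ((\<Sum>i<n. partial_quotient x (Suc i) - 1) + b)"
    unfolding b(3)[symmetric] by simp
  also have "\<dots> = (\<Sum>i<n. ?a i) - real n + of_int b" by (simp add: sum_subtractf)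
  finally have "real (num_intermediate Q x) - (trimmed_sum ?a n - real n) = m + of_int b"
    by (simp add: trimmed_sum_def m_def)
  then show ?thesis using bM mM m0 b(1) by simp
qed

text \<open>With n = N - 1 ~ ln Q / \<kappa> also ln n ~ ln ln Q, and the subtracted n is of lower
  order than n ln n.\<close>

lemma intermediate_main_term:
  fixes N :: "nat \<Rightarrow> nat" and T :: "nat \<Rightarrow> real"
  assumes N: "filterlim N at_top sequentially"
    and ratio: "(\<lambda>Q. real (N Q) / ln (real Q)) \<longlonglongrightarrow> 1 / levy_const"
    and T: "(\<lambda>n. T n / (real n * ln (real n))) \<longlonglongrightarrow> 1 / ln 2"
  shows "(\<lambda>Q. (T (N Q - 1) - real (N Q - 1)) / (12 / pi^2 * ln (real Q) * ln (ln (real Q)))) \<longlonglongrightarrow> 1"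
proof -
  let ?n = "\<lambda>Q. N Q - 1" and ?y = "\<lambda>Q. ln (real Q)"
  have n: "filterlim ?n at_top sequentially"
    by (rule filterlim_compose[OF _ N]) real_asymp
  have ev: "\<forall>\<^sub>F Q in sequentially. 2 \<le> ?n Q \<and> 2 < ?y Q"
  proof (intro eventually_conj)
    show "\<forall>\<^sub>F Q in sequentially. 2 \<le> ?n Q" using n by (simp add: filterlim_at_top)
    show "\<forall>\<^sub>F Q in sequentially. 2 < ?y Q" by real_asymp
  qed
  have "(\<lambda>Q. 1 / ?y Q) \<longlonglongrightarrow> 0" by real_asymp
  from tendsto_diff[OF ratio this] have "(\<lambda>Q. real (N Q) / ?y Q - 1 / ?y Q) \<longlonglongrightarrow> 1 / levy_const"
    by (simp only: diff_zero)
  then have r: "(\<lambda>Q. real (?n Q) / ?y Q) \<longlonglongrightarrow> 1 / levy_const"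
    by (rule Lim_transform_eventually)
      (use ev in \<open>auto elim!: eventually_mono simp: diff_divide_distrib\<close>)
  have "(\<lambda>Q. 1 / ln (?y Q)) \<longlonglongrightarrow> 0" by real_asymp
  then have "(\<lambda>Q. ln (real (?n Q) / ?y Q) * (1 / ln (?y Q)) + 1) \<longlonglongrightarrow> ln (1 / levy_const) * 0 + 1"
    using levy_const_pos by (intro tendsto_intros r) auto
  then have "(\<lambda>Q. ln (real (?n Q) / ?y Q) * (1 / ln (?y Q)) + 1) \<longlonglongrightarrow> 1"
    by (simp only: mult_zero_right add_0_left)
  then have l: "(\<lambda>Q. ln (real (?n Q)) / ln (?y Q)) \<longlonglongrightarrow> 1"
  proof (rule Lim_transform_eventually)
    show "\<forall>\<^sub>F Q in sequentially. ln (real (?n Q) / ?y Q) * (1 / ln (?y Q)) + 1 = ln (real (?n Q)) / ln (?y Q)"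
      using ev
    proof eventually_elim
      case (elim Q)
      have "0 < real (?n Q)" "0 < ?y Q" using elim by linarith+
      then have "ln (real (?n Q) / ?y Q) = ln (real (?n Q)) - ln (?y Q)" by (metis ln_divide_pos)
      moreover have "ln (?y Q) \<noteq> 0" using elim by simp
      ultimately show ?case by (simp add: diff_divide_distrib)
    qed
  qed
  have "(\<lambda>n. 1 / ln (real n)) \<longlonglongrightarrow> 0" by real_asymp
  then have "(\<lambda>n. T n / (real n * ln (real n)) - 1 / ln (real n)) \<longlonglongrightarrow> 1 / ln 2 - 0"
    by (intro tendsto_diff T)
  from filterlim_compose[OF this n]
  have t: "(\<lambda>Q. T (?n Q) / (real (?n Q) * ln (real (?n Q))) - 1 / ln (real (?n Q))) \<longlonglongrightarrow> 1 / ln 2" by simp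
  have "(\<lambda>Q. (T (?n Q) / (real (?n Q) * ln (real (?n Q))) - 1 / ln (real (?n Q))) *
      ((real (?n Q) / ?y Q) * (ln (real (?n Q)) / ln (?y Q))) * (pi^2 / 12)) \<longlonglongrightarrow>
      (1 / ln 2) * ((1 / levy_const) * 1) * (pi^2 / 12)"
    by (intro tendsto_mult t r l tendsto_const)
  also have "(1 / ln 2) * ((1 / levy_const) * 1) * (pi^2 / 12) = 1"
    by (simp add: levy_const_def)
  finally show ?thesis
  proof (rule Lim_transform_eventually)
    show "\<forall>\<^sub>F Q in sequentially.
      (T (?n Q) / (real (?n Q) * ln (real (?n Q))) - 1 / ln (real (?n Q))) *
      ((real (?n Q) / ?y Q) * (ln (real (?n Q)) / ln (?y Q))) * (pi^2 / 12) =
      (T (?n Q) - real (?n Q)) / (12 / pi^2 * ?y Q * ln (?y Q))"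
      using ev
    proof eventually_elim
      case (elim Q)
      then have "0 < real (?n Q)" "0 < ln (real (?n Q))" "0 < ?y Q" "0 < ln (?y Q)" by auto
      moreover have "(t / (n * l) - 1 / l) * ((n / y) * (l / m)) * (p / 12) = (t - n) / (12 / p * y * m)"
        if "0 < n" "0 < l" "0 < y" "0 < m" for t n l y m p :: real
        using that by (simp add: diff_divide_distrib algebra_simps)
      ultimately show ?case by blast
    qed
  qed
qed

theorem theorem2:
  shows "(\<forall>\<epsilon>>0. \<exists>C::real. AE x in lebesgue_on {0..<1}. \<forall>\<^sub>F Q in sequentially.
            \<bar>real (conv_index Q x) - 12 * ln 2 / pi\<^sup>2 * ln (real Q)\<bar>
              \<le> C * (ln (real Q) powr (1/2) * ln (ln (real Q)) powr (3/2 + \<epsilon>)))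
       \<and> (\<exists>C::real. AE x in lebesgue_on {0..<1}. \<exists>\<eta> :: nat \<Rightarrow> real.
            \<eta> \<longlonglongrightarrow> 0 \<and>
            (\<forall>\<^sub>F Q in sequentially.
              \<bar>real (num_intermediate Q x)
                 - 12 / pi\<^sup>2 * ln (real Q) * ln (ln (real Q)) * (1 + \<eta> Q)\<bar>
                \<le> C * real_of_int (max_quotient Q x)))"
proof (intro conjI allI impI)
  fix \<epsilon> :: real assume \<epsilon>: "0 < \<epsilon>"
  let ?C = "2 / levy_const * ((2 / levy_const) powr (1/2) * 2 powr (3/2 + \<epsilon>))"
  have c: "12 * ln 2 / pi^2 * y = y / levy_const" for y by (simp add: levy_const_def)
  have "AE x in gauss_measure. \<forall>\<^sub>F Q in sequentially.
      \<bar>real (conv_index Q x) - 12 * ln 2 / pi^2 * ln (real Q)\<bar>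
        \<le> ?C * (ln (real Q) powr (1/2) * ln (ln (real Q)) powr (3/2 + \<epsilon>))"
    using log_sum_deviation[OF \<epsilon>] AE_gauss_irrat01
    by eventually_elim (use conv_index_deviation[OF _ \<epsilon>] in \<open>simp only: deviation_bound_def c\<close>)
  then show "\<exists>C::real. AE x in lebesgue_on {0..<1}. \<forall>\<^sub>F Q in sequentially.
      \<bar>real (conv_index Q x) - 12 * ln 2 / pi^2 * ln (real Q)\<bar>
        \<le> C * (ln (real Q) powr (1/2) * ln (ln (real Q)) powr (3/2 + \<epsilon>))"
    by (intro exI AE_gauss_imp_lebesgue)
next
  let ?M = "\<lambda>Q. 12 / pi^2 * ln (real Q) * ln (ln (real Q))"
  have "AE x in gauss_measure. \<exists>\<eta> :: nat \<Rightarrow> real. \<eta> \<longlonglongrightarrow> 0 \<and> (\<forall>\<^sub>F Q in sequentially.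
      \<bar>real (num_intermediate Q x) - ?M Q * (1 + \<eta> Q)\<bar> \<le> 2 * real_of_int (max_quotient Q x))"
    \<comment> \<open>The first claim enters here only through N ~ ln Q / \<kappa>, so \<epsilon> is
      fixed at 1.\<close>
    using log_sum_deviation[OF zero_less_one] AE_trimmed_quotient_sum_asymp AE_gauss_irrat01
  proof eventually_elim
    case (elim x)
    define T where "T = trimmed_sum (\<lambda>i. of_int (partial_quotient x (Suc i)))"
    \<comment> \<open>The exact relative error of the main term, so that
      \<open>?M Q * (1 + \<eta> Q)\<close> equals the trimmed count whenever \<open>?M Q\<close> is
      nonzero.\<close>
    define \<eta> where "\<eta> Q = (T (conv_index Q x - 1) - real (conv_index Q x - 1)) / ?M Q - 1" for Q
    note ratio = conv_index_ratio_tendsto[OF conv_index_deviation[OF elim(3) zero_less_one elim(1)]]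
    have "(\<lambda>Q. (T (conv_index Q x - 1) - real (conv_index Q x - 1)) / ?M Q) \<longlonglongrightarrow> 1"
      by (rule intermediate_main_term[OF conv_index_tendsto[OF elim(3)] ratio elim(2)[folded T_def]])
    then have "\<eta> \<longlonglongrightarrow> 1 - 1" unfolding \<eta>_def by (intro tendsto_diff tendsto_const)
    moreover have "\<forall>\<^sub>F Q in sequentially. 2 < ln (real Q)" by real_asymp
    then have "\<forall>\<^sub>F Q in sequentially.
        \<bar>real (num_intermediate Q x) - ?M Q * (1 + \<eta> Q)\<bar> \<le> 2 * real_of_int (max_quotient Q x)"
      using eventually_ge_at_top[of 1]
    proof eventually_elim
      case (elim Q)
      have "?M Q \<noteq> 0" using elim(1) by simp
      then have "?M Q * (1 + \<eta> Q) = T (conv_index Q x - 1) - real (conv_index Q x - 1)"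
        unfolding \<eta>_def by simp
      then show ?case
        using num_intermediate_trimmed[OF \<open>x \<in> irrat01\<close> elim(2)] by (simp only: T_def)
    qed
    ultimately show ?case by (intro exI[of _ \<eta>]) simp
  qed
  then show "\<exists>C::real. AE x in lebesgue_on {0..<1}. \<exists>\<eta> :: nat \<Rightarrow> real. \<eta> \<longlonglongrightarrow> 0 \<and>
      (\<forall>\<^sub>F Q in sequentially. \<bar>real (num_intermediate Q x) - ?M Q * (1 + \<eta> Q)\<bar>
        \<le> C * real_of_int (max_quotient Q x))"
    by (intro exI AE_gauss_imp_lebesgue)
qed

end
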